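(* The operad $\mathrm{APE}$ of planar rooted trees (in $\mathbb{Z}$-modules) is isomorphic to the quotient of the free operad on generators $C_n$ in $n+1$ variables, $n\ge1$ (the corresponding operations being denoted $\{x_1\mid x_2,\dots,x_{n+1}\}$), by the relations $$\{\{z\mid x_1,\dots,x_n\}\mid y_1,\dots,y_m\}=\sum\{z\mid Y_0,\{x_1\mid Y_1\},Y_2,\{x_2\mid Y_3\},Y_4,\dots,Y_{2n-2},\{x_n\mid Y_{2n-1}\},Y_{2n}\}$$ for all $n,m\ge1$, where the sum is over the partitions of the ordered set $\{y_1,\dots,y_m\}$ into successive, possibly empty, intervals $Y_0\sqcup Y_1\sqcup\dots\sqcup Y_{2n}$.
   Context: Convention in the relations: $\{x\mid\ \}=x$ when the interval is empty. The generators $C_n$ satisfy no symmetry relation (each generates a free $\mathfrak S_{n+1}$-module). **The operad $\mathrm{APE}$.** For a nonempty finite set $I$, a planar rooted tree on $I$ is a connected graph without cycles with vertex set $I$, with a distinguished vertex (the root) and a planar embedding; edges are oriented towards the root, the root is drawn at the bottom on the boundary of a half-disc, and the tree is otherwise inside it. Equivalently: a rooted tree with vertex set $I$ and, at each vertex $j$, a total (left to right) order on the set $\mathrm{Entr}(T,j)$ of incoming edges. $\mathrm{APE}(I)$ is the free $\mathbb{Z}$-module on these trees. An angle of a tree $S$ is a pair $(s,\alpha)$ with $s$ a vertex and $\alpha$ a sector at $s$ of the complement of $S$ in the half-disc; a vertex with $k$ incoming edges has $k+1$ angles (before the first, between consecutive ones, after the last). The set $\mathrm{Angles}(S)$ is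 totally ordered from left to right, i.e. in the order of the contour traversal: for a root $r$ with subtrees $S_1,\dots,S_k$ the order is $(r,0),\mathrm{Angles}(S_1),(r,1),\mathrm{Angles}(S_2),\dots,\mathrm{Angles}(S_k),(r,k)$. For trees $T$ on $J$ and $S$ on $I$ and $j\in J$, $$T\circ_jS=\sum_{f}T\circ_j^fS,$$ summed over weakly increasing maps $f:\mathrm{Entr}(T,j)\to\mathrm{Angles}(S)$, where $T\circ_j^fS$ is the tree obtained by substituting $S$ for the vertex $j$ of $T$ (the outgoing edge of $j$, if any, being attached to the root of $S$; otherwise the root of $S$ becomes the root), the edges of $T$ entering $j$ being grafted on $S$ at the angles given by $f$, in their original order within each angle. The unit is the one-vertex tree and symmetric groups act by relabelling. *)

theory Defs
  imports "HOL-Algebra.Free_Abelian_Groups"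
begin

section \<open>Symmetric operads in \<open>\<int>\<close>-modules\<close>

text \<open>
  Operads are presented by partial compositions and indexed by finite sets of labels.
  \<open>\<int>\<close>-modules are abelian groups; they are \<^const>\<open>comm_group\<close>s of HOL-Algebra, so the addition of
  a component is written multiplicatively. For \<open>x \<in> P(J)\<close>, \<open>j \<in> J\<close> and
  \<open>y \<in> P(I)\<close>, the term \<open>circ P J I j x y\<close> is \<open>x \<circ>\<^sub>j y \<in> P(J - {j} \<union> I)\<close>.
\<close>

record ('a, 'm) operad =
  component :: "'a set \<Rightarrow> 'm monoid"
  op_unit :: "'a \<Rightarrow> 'm"
  relabel :: "('a \<Rightarrow> 'a) \<Rightarrow> 'm \<Rightarrow> 'm"
  circ :: "'a set \<Rightarrow> 'a set \<Rightarrow> 'a \<Rightarrow> 'm \<Rightarrow> 'm \<Rightarrow> 'm"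

definition composable :: "'a set \<Rightarrow> 'a set \<Rightarrow> 'a \<Rightarrow> bool" where
  "composable J I j \<longleftrightarrow> finite J \<and> finite I \<and> j \<in> J \<and> (J - {j}) \<inter> I = {}"

text \<open>Only the label \<open>j\<close> disappears, so \<open>j \<in> I\<close> is allowed in \<^const>\<open>composable\<close>.\<close>

locale operad =
  fixes P :: "('a, 'm) operad"
  assumes component_group: "finite I \<Longrightarrow> comm_group (component P I)"
    and unit_closed: "op_unit P i \<in> carrier (component P {i})"
    and relabel_hom: "\<lbrakk>finite I; bij_betw \<sigma> I I'\<rbrakk> \<Longrightarrow>
      relabel P \<sigma> \<in> hom (component P I) (component P I')"
    and relabel_cong: "\<lbrakk>finite I; inj_on \<sigma> I; \<And>i. i \<in> I \<Longrightarrow> \<sigma> i = \<tau> i; x \<in> carrier (component P I)\<rbrakk> \<Longrightarrow>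
      relabel P \<sigma> x = relabel P \<tau> x"
    and relabel_id: "\<lbrakk>finite I; x \<in> carrier (component P I)\<rbrakk> \<Longrightarrow> relabel P id x = x"
    and relabel_comp: "\<lbrakk>finite I; bij_betw \<sigma> I I'; bij_betw \<tau> I' I''; x \<in> carrier (component P I)\<rbrakk> \<Longrightarrow>
      relabel P (\<tau> \<circ> \<sigma>) x = relabel P \<tau> (relabel P \<sigma> x)"
    and relabel_unit: "relabel P \<sigma> (op_unit P i) = op_unit P (\<sigma> i)"
    and circ_hom_left: "\<lbrakk>composable J I j; y \<in> carrier (component P I)\<rbrakk> \<Longrightarrow>
      (\<lambda>x. circ P J I j x y) \<in> hom (component P J) (component P (J - {j} \<union> I))"
    and circ_hom_right: "\<lbrakk>composable J I j; x \<in> carrier (component P J)\<rbrakk> \<Longrightarrow>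
      (\<lambda>y. circ P J I j x y) \<in> hom (component P I) (component P (J - {j} \<union> I))"
    and circ_relabel: "\<lbrakk>composable J I j; bij_betw \<sigma> J J'; bij_betw \<tau> I I'; composable J' I' (\<sigma> j);
        x \<in> carrier (component P J); y \<in> carrier (component P I)\<rbrakk> \<Longrightarrow>
      circ P J' I' (\<sigma> j) (relabel P \<sigma> x) (relabel P \<tau> y)
        = relabel P (\<lambda>a. if a \<in> I then \<tau> a else \<sigma> a) (circ P J I j x y)"
    and unit_left: "\<lbrakk>finite I; y \<in> carrier (component P I)\<rbrakk> \<Longrightarrow>
      circ P {j} I j (op_unit P j) y = y"
    and unit_right: "\<lbrakk>composable J {i} j; x \<in> carrier (component P J)\<rbrakk> \<Longrightarrow>
      circ P J {i} j x (op_unit P i) = relabel P (id(j := i)) x"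
    and assoc_sequential: "\<lbrakk>composable J I j; i \<in> I; composable (J - {j} \<union> I) K i;
        x \<in> carrier (component P J); y \<in> carrier (component P I); z \<in> carrier (component P K)\<rbrakk> \<Longrightarrow>
      circ P (J - {j} \<union> I) K i (circ P J I j x y) z
        = circ P J (I - {i} \<union> K) j x (circ P I K i y z)"
    and assoc_parallel: "\<lbrakk>composable J I j; composable J K k; j \<noteq> k; I \<inter> K = {};
        x \<in> carrier (component P J); y \<in> carrier (component P I); z \<in> carrier (component P K)\<rbrakk> \<Longrightarrow>
      circ P (J - {j} \<union> I) K k (circ P J I j x y) z
        = circ P (J - {k} \<union> K) I j (circ P J K k x z) y"

definition operad_iso :: "('a, 'm) operad \<Rightarrow> ('a, 'n) operad \<Rightarrow> ('a set \<Rightarrow> 'm \<Rightarrow> 'n) set" where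
  "operad_iso P Q = {\<phi>.
     (\<forall>I. finite I \<longrightarrow> \<phi> I \<in> iso (component P I) (component Q I)) \<and>
     (\<forall>i. \<phi> {i} (op_unit P i) = op_unit Q i) \<and>
     (\<forall>I I' \<sigma>. \<forall>x\<in>carrier (component P I). finite I \<longrightarrow> bij_betw \<sigma> I I' \<longrightarrow>
        \<phi> I' (relabel P \<sigma> x) = relabel Q \<sigma> (\<phi> I x)) \<and>
     (\<forall>J I j. \<forall>x\<in>carrier (component P J). \<forall>y\<in>carrier (component P I). composable J I j \<longrightarrow>
        \<phi> (J - {j} \<union> I) (circ P J I j x y) = circ Q J I j (\<phi> J x) (\<phi> I y))}"

definition operad_isomorphic :: "('a, 'm) operad \<Rightarrow> ('a, 'n) operad \<Rightarrow> bool" where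
  "operad_isomorphic P Q \<longleftrightarrow> operad P \<and> operad Q \<and> operad_iso P Q \<noteq> {}"


section \<open>Operadic ideals and quotients\<close>

definition operadic_ideal :: "('a, 'm) operad \<Rightarrow> ('a set \<Rightarrow> 'm set) \<Rightarrow> bool" where
  "operadic_ideal P N \<longleftrightarrow>
     (\<forall>I. finite I \<longrightarrow> subgroup (N I) (component P I)) \<and>
     (\<forall>I I' \<sigma>. finite I \<longrightarrow> bij_betw \<sigma> I I' \<longrightarrow> relabel P \<sigma> ` N I \<subseteq> N I') \<and>
     (\<forall>J I j. \<forall>x\<in>N J. \<forall>y\<in>carrier (component P I). composable J I j \<longrightarrow>
        circ P J I j x y \<in> N (J - {j} \<union> I)) \<and>
     (\<forall>J I j. \<forall>x\<in>carrier (component P J). \<forall>y\<in>N I. composable J I j \<longrightarrow>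
        circ P J I j x y \<in> N (J - {j} \<union> I))"

definition generated_ideal :: "('a, 'm) operad \<Rightarrow> ('a set \<Rightarrow> 'm set) \<Rightarrow> 'a set \<Rightarrow> 'm set" where
  "generated_ideal P R I =
     carrier (component P I) \<inter> \<Inter> {N I | N. operadic_ideal P N \<and> (\<forall>K. finite K \<longrightarrow> R K \<subseteq> N K)}"

definition quotient_operad :: "('a, 'm) operad \<Rightarrow> ('a set \<Rightarrow> 'm set) \<Rightarrow> ('a, 'm set) operad" where
  "quotient_operad P N =
     \<lparr>component = (\<lambda>I. component P I Mod N I),
      op_unit = (\<lambda>i. N {i} #>\<^bsub>component P {i}\<^esub> op_unit P i),
      relabel = (\<lambda>\<sigma> X. relabel P \<sigma> ` X),
      circ = (\<lambda>J I j X Y. \<Union>x\<in>X. \<Union>y\<in>Y.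
        N (J - {j} \<union> I) #>\<^bsub>component P (J - {j} \<union> I)\<^esub> circ P J I j x y)\<rparr>"


section \<open>Operads spanned by combinatorial objects\<close>

text \<open>
  Operad data whose component at \<open>I\<close> is the free \<open>\<int>\<close>-module on \<open>B I\<close>, with unit, relabelling
  and composition given on basis elements and extended (bi)linearly.
\<close>

definition linear_operad ::
  "('a set \<Rightarrow> 'b set) \<Rightarrow> ('a \<Rightarrow> 'b) \<Rightarrow> (('a \<Rightarrow> 'a) \<Rightarrow> 'b \<Rightarrow> 'b) \<Rightarrow> ('a \<Rightarrow> 'b \<Rightarrow> 'b \<Rightarrow> 'b \<Rightarrow>\<^sub>0 int)
    \<Rightarrow> ('a, 'b \<Rightarrow>\<^sub>0 int) operad" where
  "linear_operad B u r c =
     \<lparr>component = (\<lambda>I. free_Abelian_group (B I)),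
      op_unit = (\<lambda>i. frag_of (u i)),
      relabel = (\<lambda>\<sigma>. frag_extend (\<lambda>t. frag_of (r \<sigma> t))),
      circ = (\<lambda>J I j x y. frag_extend (\<lambda>t. frag_extend (\<lambda>s. c j t s) y) x)\<rparr>"


section \<open>Free operads\<close>

text \<open>
  \<open>G\<close> is a set of generators without symmetries, \<open>ar g\<close> being the number of inputs of \<open>g\<close>.
  The free operad is spanned by the tree monomials, i.e. the terms in the generators in which every
  label of \<open>I\<close> occurs exactly once; composition is substitution. The terms \<open>Op g [Var i\<^sub>1, \<dots>, Var i\<^sub>k]\<close>,
  one for each ordering of \<open>I\<close>, are the basis of the free \<open>\<SS>\<^sub>k\<close>-module generated by \<open>g\<close>.
\<close>

datatype ('g, 'a) monomial = Var 'a | Op 'g "('g, 'a) monomial list"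

primrec well_formed :: "'g set \<Rightarrow> ('g \<Rightarrow> nat) \<Rightarrow> ('g, 'a) monomial \<Rightarrow> bool" where
  "well_formed G ar (Var i) = True"
| "well_formed G ar (Op g ts) = (g \<in> G \<and> length ts = ar g \<and> list_all id (map (well_formed G ar) ts))"

primrec variables :: "('g, 'a) monomial \<Rightarrow> 'a list" where
  "variables (Var i) = [i]"
| "variables (Op g ts) = concat (map variables ts)"

primrec substitute :: "'a \<Rightarrow> ('g, 'a) monomial \<Rightarrow> ('g, 'a) monomial \<Rightarrow> ('g, 'a) monomial" where
  "substitute j (Var i) s = (if i = j then s else Var i)"
| "substitute j (Op g ts) s = Op g (map (\<lambda>t. substitute j t s) ts)"

definition tree_monomials :: "'g set \<Rightarrow> ('g \<Rightarrow> nat) \<Rightarrow> 'a set \<Rightarrow> ('g, 'a) monomial set" where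
  "tree_monomials G ar I = {t. well_formed G ar t \<and> distinct (variables t) \<and> set (variables t) = I}"

definition free_operad :: "'g set \<Rightarrow> ('g \<Rightarrow> nat) \<Rightarrow> ('a, ('g, 'a) monomial \<Rightarrow>\<^sub>0 int) operad" where
  "free_operad G ar =
     linear_operad (tree_monomials G ar) Var (map_monomial id) (\<lambda>j t s. frag_of (substitute j t s))"


section \<open>The brace relations\<close>

text \<open>The generator \<open>C\<^sub>n\<close> is the number \<open>n \<ge> 1\<close>, of arity \<open>n + 1\<close>.\<close>

abbreviation free_brace_operad :: "('a, (nat, 'a) monomial \<Rightarrow>\<^sub>0 int) operad" where
  "free_brace_operad \<equiv> free_operad {1..} (\<lambda>n. n + 1)"

text \<open>\<open>brace x [x\<^sub>1, \<dots>, x\<^sub>n]\<close> is \<open>{x | x\<^sub>1, \<dots>, x\<^sub>n}\<close>, with the convention \<open>{x | } = x\<close>.\<close>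

definition brace :: "(nat, 'a) monomial \<Rightarrow> (nat, 'a) monomial list \<Rightarrow> (nat, 'a) monomial" where
  "brace x xs = (if xs = [] then x else Op (length xs) (x # xs))"

definition interval_partitions :: "nat \<Rightarrow> 'a list \<Rightarrow> 'a list list set" where
  "interval_partitions k ys = {Y. length Y = k \<and> concat Y = ys}"

definition brace_lhs :: "'a \<Rightarrow> 'a list \<Rightarrow> 'a list \<Rightarrow> (nat, 'a) monomial" where
  "brace_lhs z xs ys = brace (brace (Var z) (map Var xs)) (map Var ys)"

definition brace_rhs_term :: "'a \<Rightarrow> 'a list \<Rightarrow> 'a list list \<Rightarrow> (nat, 'a) monomial" where
  "brace_rhs_term z xs Y = brace (Var z)
     (map Var (Y ! 0) @
      concat (map (\<lambda>i. brace (Var (xs ! i)) (map Var (Y ! (2*i + 1))) # map Var (Y ! (2*i + 2)))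
                  [0..<length xs]))"

definition brace_relations :: "'a set \<Rightarrow> ((nat, 'a) monomial \<Rightarrow>\<^sub>0 int) set" where
  "brace_relations I =
     {frag_of (brace_lhs z xs ys)
        - (\<Sum>Y\<in>interval_partitions (2 * length xs + 1) ys. frag_of (brace_rhs_term z xs Y))
      | z xs ys. length xs \<ge> 1 \<and> length ys \<ge> 1 \<and> distinct (z # xs @ ys) \<and> set (z # xs @ ys) = I}"


section \<open>The operad of planar rooted trees\<close>

text \<open>\<open>Node r [S\<^sub>1, \<dots>, S\<^sub>k]\<close> has root \<open>r\<close>, and \<open>S\<^sub>1, \<dots>, S\<^sub>k\<close> are its subtrees from left to right.\<close>

datatype 'a ptree = Node 'a "'a ptree list"

primrec vertices :: "'a ptree \<Rightarrow> 'a list" where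
  "vertices (Node r ts) = r # concat (map vertices ts)"

definition planar_trees :: "'a set \<Rightarrow> 'a ptree set" where
  "planar_trees I = {T. distinct (vertices T) \<and> set (vertices T) = I}"

text \<open>
  The subtrees lying above the vertex \<open>j\<close>, from left to right. The incoming edges of \<open>j\<close> are represented
  by the positions in this list. (In trees with distinct labels at most one subtree contains \<open>j\<close>.)
\<close>

primrec subtrees_at :: "'a \<Rightarrow> 'a ptree \<Rightarrow> 'a ptree list" where
  "subtrees_at j (Node r ts) = (if r = j then ts else concat (map (subtrees_at j) ts))"

definition Entr :: "'a ptree \<Rightarrow> 'a \<Rightarrow> nat set" where
  "Entr T j = {..<length (subtrees_at j T)}"

text \<open>
  The angle \<open>(s, i)\<close> is the sector at \<open>s\<close> after the first \<open>i\<close> incoming edges. The list \<open>angles S\<close>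
  enumerates the angles from left to right.
\<close>

primrec angles :: "'a ptree \<Rightarrow> ('a \<times> nat) list" where
  "angles (Node r ts) =
     (r, 0) # concat (map2 (\<lambda>i as. as @ [(r, i + 1)]) [0..<length ts] (map angles ts))"

definition angle_le :: "'a ptree \<Rightarrow> 'a \<times> nat \<Rightarrow> 'a \<times> nat \<Rightarrow> bool" where
  "angle_le S a b \<longleftrightarrow> (\<exists>m n. m \<le> n \<and> n < length (angles S) \<and> angles S ! m = a \<and> angles S ! n = b)"

definition grafting_maps :: "'a ptree \<Rightarrow> 'a \<Rightarrow> 'a ptree \<Rightarrow> (nat \<Rightarrow> 'a \<times> nat) set" where
  "grafting_maps T j S = {f \<in> Entr T j \<rightarrow>\<^sub>E set (angles S).
     \<forall>p\<in>Entr T j. \<forall>q\<in>Entr T j. p \<le> q \<longrightarrow> angle_le S (f p) (f q)}"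

text \<open>\<open>graft g S\<close> grafts, for each angle \<open>a\<close> of \<open>S\<close>, the list of trees \<open>g a\<close> at \<open>a\<close>.\<close>

primrec graft :: "('a \<times> nat \<Rightarrow> 'a ptree list) \<Rightarrow> 'a ptree \<Rightarrow> 'a ptree" where
  "graft g (Node s ts) =
     Node s (g (s, 0) @ concat (map2 (\<lambda>i t. t # g (s, i + 1)) [0..<length ts] (map (graft g) ts)))"

text \<open>\<open>insert_tree j S f T\<close> is \<open>T \<circ>\<^sub>j\<^sup>f S\<close>.\<close>

primrec insert_tree :: "'a \<Rightarrow> 'a ptree \<Rightarrow> (nat \<Rightarrow> 'a \<times> nat) \<Rightarrow> 'a ptree \<Rightarrow> 'a ptree" where
  "insert_tree j S f (Node r ts) =
     (if r = j then graft (\<lambda>a. map (\<lambda>p. ts ! p) (filter (\<lambda>p. f p = a) [0..<length ts])) S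
      else Node r (map (insert_tree j S f) ts))"

definition ape_circ :: "'a \<Rightarrow> 'a ptree \<Rightarrow> 'a ptree \<Rightarrow> 'a ptree \<Rightarrow>\<^sub>0 int" where
  "ape_circ j T S = (\<Sum>f\<in>grafting_maps T j S. frag_of (insert_tree j S f T))"

definition APE :: "('a, 'a ptree \<Rightarrow>\<^sub>0 int) operad" where
  "APE = linear_operad planar_trees (\<lambda>i. Node i []) map_ptree ape_circ"

end

theory Submission
  imports Defs "HOL-Library.Multiset"
begin

text \<open>
  Interpreting \<open>C\<^sub>n\<close> as the corolla with \<open>n\<close> leaves evaluates every tree monomial to a sum of planar trees.
  Compatibility of this evaluation with composition reduces to the associativity of the product of ordered
  forests that grafts one forest on another. Evaluation is onto: a tree with root \<open>r\<close> and subtrees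
  \<open>S\<^sub>1, \<dots>, S\<^sub>k\<close> is the value of its normal form \<open>{r | S\<^sub>1, \<dots>, S\<^sub>k}\<close>, where the \<open>S\<^sub>i\<close> are written in normal
  form as well. Hence the operad axioms for \<open>APE\<close> and for the quotient are both inherited from the free operad.
  The brace relations move brackets off the first argument, so modulo any ideal that contains them each monomial
  is congruent to the sum of the normal forms of the terms of its value. Therefore the kernel of evaluation is
  the ideal generated by the relations.
\<close>

section \<open>The product of ordered forests\<close>

text \<open>One partial composition is not stable under recursion on trees: below a root the
  incoming edges of the replaced vertex spread over several subtrees at once. Hence everything is
  phrased for forests and for substitution at all vertices simultaneously, and grafting is described
  by cutting the grafted list into intervals, alternately for a gap and for a subtree. The
  identities between such sums then rest on exchange of sums, on coassociativity of cutting, and on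
  the fact that cutting a product cuts both factors. The left factor of the product is a list of
  functions instead of a forest, so that the same \<open>weave\<close> describes grafting of trees
  (functions \<open>attach t\<close>) and the right-hand sides of the brace relations (functions
  \<open>\<lambda>ys. [brace x ys]\<close>). The definition of \<open>APE\<close> by weakly
  increasing maps into angles is compared with this recursion in \<open>sum_grafting_maps\<close>.
  On the side of monomials the difficulty is with labels: the relations are stated for variables,
  whereas the reduction applies them to monomials inside a context. Placeholders are chosen among
  the variables of the monomials themselves, which works because \<open>composable\<close> lets the
  replaced label reappear in the inserted element.\<close>

lemma sum_list_concat_map:
  "(\<Sum>y\<leftarrow>concat (map f xs). k y) = (\<Sum>x\<leftarrow>xs. \<Sum>y\<leftarrow>f x. (k y :: 'c::comm_monoid_add))"
  by (induction xs) auto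

lemma sum_list_swap:
  "(\<Sum>x\<leftarrow>xs. \<Sum>y\<leftarrow>ys. f x y) = (\<Sum>y\<leftarrow>ys. \<Sum>x\<leftarrow>xs. (f x y :: 'c::comm_monoid_add))"
  by (induction xs) (auto simp: sum_list_addf)

lemma sum_list_cong:
  "(\<And>x. x \<in> set xs \<Longrightarrow> f x = g x) \<Longrightarrow> (\<Sum>x\<leftarrow>xs. f x) = (\<Sum>x\<leftarrow>xs. g x)"
  by (metis map_cong)

text \<open>The deconcatenation coproduct of the tensor algebra, given by the list of its terms;
  each cut occurs once.\<close>

primrec splits :: "'b list \<Rightarrow> ('b list \<times> 'b list) list" where
  "splits [] = [([], [])]"
| "splits (y # ys) = ([], y # ys) # map (map_prod ((#) y) id) (splits ys)"

lemma splits_append: "p \<in> set (splits ys) \<Longrightarrow> fst p @ snd p = ys"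
  by (induction ys arbitrary: p) auto

lemma splits_map: "splits (map f ys) = map (map_prod (map f) (map f)) (splits ys)"
  by (induction ys) (auto simp: o_def)

text \<open>Both sides run over the cuts of \<open>ys\<close> into three consecutive intervals.
  Every regrouping of intervals below is an instance of this.\<close>

lemma splits_coassoc:
  "(\<Sum>p\<leftarrow>splits ys. \<Sum>q\<leftarrow>splits (snd p). f (fst p) (fst q) (snd q))
    = (\<Sum>p\<leftarrow>splits ys. \<Sum>q\<leftarrow>splits (fst p). (f (fst q) (snd q) (snd p) :: 'c::comm_monoid_add))"
proof (induction ys arbitrary: f)
  case (Cons y ys)
  show ?case using Cons[of "\<lambda>a. f (y # a)"] by (simp add: o_def sum_list_addf add.assoc)
qed simp

text \<open>A cut lies either before or after the marked letter \<open>y\<close>. Without a marked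
  letter the cut at the boundary would be counted twice.\<close>

lemma sum_splits_append:
  "(\<Sum>p\<leftarrow>splits (xs @ y # ys). f (fst p) (snd p))
    = (\<Sum>p\<leftarrow>splits xs. f (fst p) (snd p @ y # ys))
      + (\<Sum>p\<leftarrow>splits ys. (f (xs @ y # fst p) (snd p) :: 'c::comm_monoid_add))"
proof (induction xs arbitrary: f)
  case (Cons x xs)
  show ?case using Cons[of "\<lambda>a. f (x # a)"] by (simp add: o_def add.assoc)
qed (simp add: o_def)

text \<open>
  A formal sum with nonnegative coefficients is represented by the list of its terms. Two such sums are
  compared by summing an arbitrary function \<open>k\<close> over them, as the lists agree only up to order.

  With \<open>gs = map attach ss\<close>, \<open>weave gs ys\<close> is the product of the forests \<open>ss\<close> and \<open>ys\<close>: the sum over all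
  ways of grafting \<open>ys\<close>, in order, at the angles of \<open>ss\<close> or next to the trees of \<open>ss\<close>.
\<close>

primrec weave :: "('b list \<Rightarrow> 'b list) list \<Rightarrow> 'b list \<Rightarrow> 'b list list" where
  "weave [] ys = [ys]"
| "weave (g # gs) ys = [fst p @ t # w. p \<leftarrow> splits ys, q \<leftarrow> splits (snd p), t \<leftarrow> g (fst q), w \<leftarrow> weave gs (snd q)]"

lemma sum_weave_Cons:
  "(\<Sum>w\<leftarrow>weave (g # gs) ys. k w) = (\<Sum>p\<leftarrow>splits ys. \<Sum>q\<leftarrow>splits (snd p). \<Sum>t\<leftarrow>g (fst q).
     \<Sum>w\<leftarrow>weave gs (snd q). (k (fst p @ t # w) :: 'c::comm_monoid_add))"
  by (simp add: sum_list_concat_map o_def)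

declare weave.simps(2) [simp del]

text \<open>One interval of \<open>zs\<close> goes to \<open>g\<close>; what precedes it is spread
  over \<open>gs\<close> and the gaps around its members, what follows over \<open>hs\<close> in the
  same way. The marked factor \<open>g\<close> again keeps the gaps on its two sides apart.\<close>

lemma sum_weave_append:
  "(\<Sum>w\<leftarrow>weave (gs @ g # hs) zs. k w) = (\<Sum>p\<leftarrow>splits zs. \<Sum>q\<leftarrow>splits (snd p). \<Sum>a\<leftarrow>weave gs (fst p).
     \<Sum>t\<leftarrow>g (fst q). \<Sum>c\<leftarrow>weave hs (snd q). (k (a @ t # c) :: 'c::comm_monoid_add))"
proof (induction gs arbitrary: zs k)
  case Nil
  then show ?case by (simp add: sum_weave_Cons)
next
  case (Cons h gs)
  let ?F = "\<lambda>A B C W X. \<Sum>s\<leftarrow>h B. \<Sum>a\<leftarrow>weave gs C. \<Sum>t\<leftarrow>g W. \<Sum>c\<leftarrow>weave hs X. k (A @ s # a @ t # c)"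
  have "(\<Sum>w\<leftarrow>weave ((h # gs) @ g # hs) zs. k w) =
    (\<Sum>p\<leftarrow>splits zs. \<Sum>q\<leftarrow>splits (snd p). \<Sum>s\<leftarrow>h (fst q). \<Sum>u\<leftarrow>splits (snd q). \<Sum>v\<leftarrow>splits (snd u).
      \<Sum>a\<leftarrow>weave gs (fst u). \<Sum>t\<leftarrow>g (fst v). \<Sum>c\<leftarrow>weave hs (snd v). k (fst p @ s # a @ t # c))"
    by (simp add: sum_weave_Cons Cons.IH)
  also have "\<dots> = (\<Sum>p\<leftarrow>splits zs. \<Sum>q\<leftarrow>splits (snd p). \<Sum>u\<leftarrow>splits (snd q). \<Sum>v\<leftarrow>splits (snd u).
      ?F (fst p) (fst q) (fst u) (fst v) (snd v))"
    by (simp only: sum_list_swap[where xs="h _" and ys="splits _"])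
  \<comment> \<open>Two applications of coassociativity bring the cut in front of the interval of
    \<open>g\<close> to the outermost place.\<close>
  also have "\<dots> = (\<Sum>p\<leftarrow>splits zs. \<Sum>u\<leftarrow>splits (snd p). \<Sum>q\<leftarrow>splits (fst u). \<Sum>v\<leftarrow>splits (snd u).
      ?F (fst p) (fst q) (snd q) (fst v) (snd v))"
    by (intro sum_list_cong
       splits_coassoc[where f="\<lambda>a b c. \<Sum>v\<leftarrow>splits c. ?F _ a b (fst v) (snd v)"])
  also have "\<dots> = (\<Sum>u\<leftarrow>splits zs. \<Sum>p\<leftarrow>splits (fst u). \<Sum>q\<leftarrow>splits (snd p). \<Sum>v\<leftarrow>splits (snd u).
      ?F (fst p) (fst q) (snd q) (fst v) (snd v))"
    by (rule splits_coassoc[where f="\<lambda>a b c. \<Sum>q\<leftarrow>splits b. \<Sum>v\<leftarrow>splits c. ?F a (fst q) (snd q) (fst v) (snd v)"])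
  also have "\<dots> = (\<Sum>u\<leftarrow>splits zs. \<Sum>p\<leftarrow>splits (fst u). \<Sum>v\<leftarrow>splits (snd u). \<Sum>q\<leftarrow>splits (snd p).
      ?F (fst p) (fst q) (snd q) (fst v) (snd v))"
    by (intro sum_list_cong sum_list_swap)
  also have "\<dots> = (\<Sum>u\<leftarrow>splits zs. \<Sum>v\<leftarrow>splits (snd u). \<Sum>p\<leftarrow>splits (fst u). \<Sum>q\<leftarrow>splits (snd p).
      ?F (fst p) (fst q) (snd q) (fst v) (snd v))"
    by (intro sum_list_cong sum_list_swap)
  also have "\<dots> = (\<Sum>p\<leftarrow>splits zs. \<Sum>q\<leftarrow>splits (snd p). \<Sum>a\<leftarrow>weave (h # gs) (fst p).
     \<Sum>t\<leftarrow>g (fst q). \<Sum>c\<leftarrow>weave hs (snd q). k (a @ t # c))"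
    by (simp add: sum_weave_Cons)
  finally show ?case .
qed

text \<open>Deconcatenation is multiplicative for the forest product: a cut of a term falls between
  two trees, so it separates the factors in \<open>gs\<close> and the letters of \<open>zs\<close>
  at the same time.\<close>

lemma sum_weave_splits:
  "(\<Sum>w\<leftarrow>weave gs zs. \<Sum>p\<leftarrow>splits w. f (fst p) (snd p))
    = (\<Sum>P\<leftarrow>splits gs. \<Sum>q\<leftarrow>splits zs. \<Sum>a\<leftarrow>weave (fst P) (fst q). \<Sum>b\<leftarrow>weave (snd P) (snd q).
        (f a b :: 'c::comm_monoid_add))"
proof (induction gs arbitrary: zs f)
  case Nil
  then show ?case by simp
next
  case (Cons g gs)
  have "(\<Sum>w\<leftarrow>weave (g # gs) zs. \<Sum>p\<leftarrow>splits w. f (fst p) (snd p)) =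
    (\<Sum>p\<leftarrow>splits zs. \<Sum>q\<leftarrow>splits (snd p). \<Sum>t\<leftarrow>g (fst q). \<Sum>w\<leftarrow>weave gs (snd q).
        \<Sum>r\<leftarrow>splits (fst p). f (fst r) (snd r @ t # w)) +
    (\<Sum>p\<leftarrow>splits zs. \<Sum>q\<leftarrow>splits (snd p). \<Sum>t\<leftarrow>g (fst q). \<Sum>w\<leftarrow>weave gs (snd q).
        \<Sum>r\<leftarrow>splits w. f (fst p @ t # fst r) (snd r))"
    by (simp add: sum_weave_Cons sum_splits_append sum_list_addf)
  \<comment> \<open>The cut lies to the left of the tree from \<open>g\<close>: this is the summand
    for the empty prefix of \<open>g # gs\<close>.\<close>
  also have "(\<Sum>p\<leftarrow>splits zs. \<Sum>q\<leftarrow>splits (snd p). \<Sum>t\<leftarrow>g (fst q). \<Sum>w\<leftarrow>weave gs (snd q).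
        \<Sum>r\<leftarrow>splits (fst p). f (fst r) (snd r @ t # w)) =
     (\<Sum>q\<leftarrow>splits zs. \<Sum>b\<leftarrow>weave (g # gs) (snd q). f (fst q) b)"
  proof -
    have "(\<Sum>p\<leftarrow>splits zs. \<Sum>q\<leftarrow>splits (snd p). \<Sum>t\<leftarrow>g (fst q). \<Sum>w\<leftarrow>weave gs (snd q).
        \<Sum>r\<leftarrow>splits (fst p). f (fst r) (snd r @ t # w)) =
      (\<Sum>p\<leftarrow>splits zs. \<Sum>r\<leftarrow>splits (fst p). \<Sum>q\<leftarrow>splits (snd p). \<Sum>t\<leftarrow>g (fst q). \<Sum>w\<leftarrow>weave gs (snd q).
         f (fst r) (snd r @ t # w))"
      by (simp only: sum_list_swap[where xs="g _" and ys="splits _"] sum_list_swap[where xs="weave _ _" and ys="splits _"]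
          sum_list_swap[where xs="splits (snd _)" and ys="splits (fst _)"])
    also have "\<dots> = (\<Sum>p\<leftarrow>splits zs. \<Sum>r\<leftarrow>splits (snd p). \<Sum>q\<leftarrow>splits (snd r). \<Sum>t\<leftarrow>g (fst q). \<Sum>w\<leftarrow>weave gs (snd q).
         f (fst p) (fst r @ t # w))"
      by (rule splits_coassoc[symmetric, where f="\<lambda>a b c. \<Sum>q\<leftarrow>splits c. \<Sum>t\<leftarrow>g (fst q). \<Sum>w\<leftarrow>weave gs (snd q).
         f a (b @ t # w)"])
    finally show ?thesis by (simp add: sum_weave_Cons)
  qed
  \<comment> \<open>The cut lies to the right of the tree from \<open>g\<close>: these are the
    summands whose prefix contains \<open>g\<close>, and the induction hypothesis cuts the
    rest.\<close>
  also have "(\<Sum>p\<leftarrow>splits zs. \<Sum>q\<leftarrow>splits (snd p). \<Sum>t\<leftarrow>g (fst q). \<Sum>w\<leftarrow>weave gs (snd q).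
        \<Sum>r\<leftarrow>splits w. f (fst p @ t # fst r) (snd r)) =
     (\<Sum>P\<leftarrow>splits gs. \<Sum>q\<leftarrow>splits zs. \<Sum>a\<leftarrow>weave (g # fst P) (fst q). \<Sum>b\<leftarrow>weave (snd P) (snd q). f a b)"
  proof -
    let ?H = "\<lambda>P A B C V. \<Sum>t\<leftarrow>g B. \<Sum>a\<leftarrow>weave (fst P) C. \<Sum>b\<leftarrow>weave (snd P) V. f (A @ t # a) b"
    have "(\<Sum>p\<leftarrow>splits zs. \<Sum>q\<leftarrow>splits (snd p). \<Sum>t\<leftarrow>g (fst q). \<Sum>w\<leftarrow>weave gs (snd q).
        \<Sum>r\<leftarrow>splits w. f (fst p @ t # fst r) (snd r)) =
      (\<Sum>p\<leftarrow>splits zs. \<Sum>q\<leftarrow>splits (snd p). \<Sum>t\<leftarrow>g (fst q). \<Sum>P\<leftarrow>splits gs. \<Sum>r\<leftarrow>splits (snd q).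
        \<Sum>a\<leftarrow>weave (fst P) (fst r). \<Sum>b\<leftarrow>weave (snd P) (snd r). f (fst p @ t # a) b)"
      by (intro sum_list_cong Cons.IH)
    also have "\<dots> = (\<Sum>p\<leftarrow>splits zs. \<Sum>q\<leftarrow>splits (snd p). \<Sum>P\<leftarrow>splits gs. \<Sum>t\<leftarrow>g (fst q). \<Sum>r\<leftarrow>splits (snd q).
        \<Sum>a\<leftarrow>weave (fst P) (fst r). \<Sum>b\<leftarrow>weave (snd P) (snd r). f (fst p @ t # a) b)"
      by (intro sum_list_cong sum_list_swap)
    also have "\<dots> = (\<Sum>p\<leftarrow>splits zs. \<Sum>P\<leftarrow>splits gs. \<Sum>q\<leftarrow>splits (snd p). \<Sum>t\<leftarrow>g (fst q). \<Sum>r\<leftarrow>splits (snd q).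
        \<Sum>a\<leftarrow>weave (fst P) (fst r). \<Sum>b\<leftarrow>weave (snd P) (snd r). f (fst p @ t # a) b)"
      by (intro sum_list_cong sum_list_swap)
    also have "\<dots> = (\<Sum>P\<leftarrow>splits gs. \<Sum>p\<leftarrow>splits zs. \<Sum>q\<leftarrow>splits (snd p). \<Sum>t\<leftarrow>g (fst q). \<Sum>r\<leftarrow>splits (snd q).
        \<Sum>a\<leftarrow>weave (fst P) (fst r). \<Sum>b\<leftarrow>weave (snd P) (snd r). f (fst p @ t # a) b)"
      by (rule sum_list_swap)
    also have "\<dots> = (\<Sum>P\<leftarrow>splits gs. \<Sum>p\<leftarrow>splits zs. \<Sum>q\<leftarrow>splits (snd p). \<Sum>r\<leftarrow>splits (snd q).
        ?H P (fst p) (fst q) (fst r) (snd r))"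
      by (intro sum_list_cong sum_list_swap)
    also have "\<dots> = (\<Sum>P\<leftarrow>splits gs. \<Sum>p\<leftarrow>splits zs. \<Sum>q\<leftarrow>splits (snd p). \<Sum>r\<leftarrow>splits (fst q).
        ?H P (fst p) (fst r) (snd r) (snd q))"
      by (intro sum_list_cong splits_coassoc[where f="\<lambda>a b c. ?H _ _ a b c"])
    also have "\<dots> = (\<Sum>P\<leftarrow>splits gs. \<Sum>q\<leftarrow>splits zs. \<Sum>p\<leftarrow>splits (fst q). \<Sum>r\<leftarrow>splits (snd p).
        ?H P (fst p) (fst r) (snd r) (snd q))"
      by (intro sum_list_cong splits_coassoc[where f="\<lambda>a b c. \<Sum>r\<leftarrow>splits b. ?H _ a (fst r) (snd r) c"])
    finally show ?thesis by (simp add: sum_weave_Cons)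
  qed
  finally show ?case by (simp add: o_def)
qed

text \<open>The sum of all graftings of a forest on one tree. At the root the subtrees and the gaps
  around them behave like a forest that is multiplied by \<open>ys\<close>. The second argument is
  abstracted so that the recursive calls form the list of functions that \<open>weave\<close>
  expects.\<close>

primrec attach :: "'a ptree \<Rightarrow> 'a ptree list \<Rightarrow> 'a ptree list" where
  "attach (Node r ts) = (\<lambda>ys. map (Node r) (weave (map attach ts) ys))"

text \<open>Associativity comes from the compatibility of the product with deconcatenation (\<open>sum_weave_splits\<close>).\<close>

lemma weave_attach_assoc:
  assumes "\<And>t y z k. t \<in> set xs \<Longrightarrow> (\<Sum>u\<leftarrow>attach t y. \<Sum>v\<leftarrow>attach u z. k v) =
     (\<Sum>w\<leftarrow>weave (map attach y) z. \<Sum>v\<leftarrow>attach t w. (k v :: 'c::comm_monoid_add))"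
  shows "(\<Sum>w\<leftarrow>weave (map attach xs) ys. \<Sum>v\<leftarrow>weave (map attach w) zs. k v)
    = (\<Sum>w\<leftarrow>weave (map attach ys) zs. \<Sum>v\<leftarrow>weave (map attach xs) w. (k v :: 'c))"
  using assms
proof (induction xs arbitrary: ys zs k)
  case Nil
  then show ?case by simp
next
  case (Cons t xs)
  have IH: "(\<Sum>w\<leftarrow>weave (map attach xs) ys. \<Sum>v\<leftarrow>weave (map attach w) zs. k v)
    = (\<Sum>w\<leftarrow>weave (map attach ys) zs. \<Sum>v\<leftarrow>weave (map attach xs) w. (k v :: 'c))" for ys zs k
    using Cons by simp
  have t: "(\<Sum>u\<leftarrow>attach t y. \<Sum>v\<leftarrow>attach u z. k v) =
     (\<Sum>w\<leftarrow>weave (map attach y) z. \<Sum>v\<leftarrow>attach t w. (k v :: 'c))" for y z k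
    using Cons.prems by simp
  let ?K = "\<lambda>p q u v. \<Sum>a\<leftarrow>weave (map attach (fst p)) (fst u).
        \<Sum>b\<leftarrow>weave (map attach (fst q)) (fst v). \<Sum>s\<leftarrow>attach t b.
        \<Sum>c\<leftarrow>weave (map attach (snd q)) (snd v). \<Sum>d\<leftarrow>weave (map attach xs) c. k (a @ s # d)"
  let ?L = "\<lambda>P Q u v. \<Sum>a\<leftarrow>weave (fst P) (fst u). \<Sum>b\<leftarrow>weave (fst Q) (fst v).
        \<Sum>c\<leftarrow>weave (snd Q) (snd v). \<Sum>s\<leftarrow>attach t b. \<Sum>d\<leftarrow>weave (map attach xs) c. k (a @ s # d)"
  have "(\<Sum>w\<leftarrow>weave (map attach (t # xs)) ys. \<Sum>v\<leftarrow>weave (map attach w) zs. k v) =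
    (\<Sum>p\<leftarrow>splits ys. \<Sum>q\<leftarrow>splits (snd p). \<Sum>s\<leftarrow>attach t (fst q). \<Sum>w\<leftarrow>weave (map attach xs) (snd q).
      \<Sum>u\<leftarrow>splits zs. \<Sum>v\<leftarrow>splits (snd u). \<Sum>a\<leftarrow>weave (map attach (fst p)) (fst u). \<Sum>s'\<leftarrow>attach s (fst v).
        \<Sum>w'\<leftarrow>weave (map attach w) (snd v). k (a @ s' # w'))"
    by (simp add: sum_weave_Cons sum_weave_append)
  also have "\<dots> = (\<Sum>p\<leftarrow>splits ys. \<Sum>q\<leftarrow>splits (snd p). \<Sum>u\<leftarrow>splits zs. \<Sum>v\<leftarrow>splits (snd u).
      \<Sum>a\<leftarrow>weave (map attach (fst p)) (fst u). \<Sum>s\<leftarrow>attach t (fst q). \<Sum>s'\<leftarrow>attach s (fst v).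
      \<Sum>w\<leftarrow>weave (map attach xs) (snd q). \<Sum>w'\<leftarrow>weave (map attach w) (snd v). k (a @ s' # w'))"
    by (simp only: sum_list_swap[where xs="attach t _" and ys="splits _"] sum_list_swap[where xs="weave _ _" and ys="splits _"]
      sum_list_swap[where xs="weave (map attach xs) _" and ys="weave (map attach (fst _)) _"]
      sum_list_swap[where xs="weave (map attach xs) _" and ys="attach _ _"]
      sum_list_swap[where xs="attach t (fst _)" and ys="weave (map attach (fst _)) _"])
  \<comment> \<open>Associativity for the tree \<open>t\<close> and for the remaining forest
    \<open>xs\<close> is applied on their own intervals.\<close>
  also have "\<dots> = (\<Sum>p\<leftarrow>splits ys. \<Sum>q\<leftarrow>splits (snd p). \<Sum>u\<leftarrow>splits zs. \<Sum>v\<leftarrow>splits (snd u). ?K p q u v)"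
    by (simp add: IH t)
  \<comment> \<open>The cuts of \<open>ys\<close> are moved to \<open>map attach ys\<close>, where
    \<open>sum_weave_splits\<close> can merge them with the cuts of \<open>zs\<close>: first the
    inner pair of cuts, later the outer one.\<close>
  also have "\<dots> = (\<Sum>P\<leftarrow>splits (map attach ys). \<Sum>Q\<leftarrow>splits (snd P). \<Sum>u\<leftarrow>splits zs. \<Sum>v\<leftarrow>splits (snd u). ?L P Q u v)"
    by (simp add: splits_map o_def sum_list_swap[where xs="attach t _" and ys="weave (map attach (snd _)) _"])
  also have "\<dots> = (\<Sum>P\<leftarrow>splits (map attach ys). \<Sum>u\<leftarrow>splits zs. \<Sum>a\<leftarrow>weave (fst P) (fst u).
      \<Sum>Q\<leftarrow>splits (snd P). \<Sum>v\<leftarrow>splits (snd u). \<Sum>b\<leftarrow>weave (fst Q) (fst v).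
        \<Sum>c\<leftarrow>weave (snd Q) (snd v). \<Sum>s\<leftarrow>attach t b. \<Sum>d\<leftarrow>weave (map attach xs) c. k (a @ s # d))"
    by (simp only: sum_list_swap[where xs="splits (snd _)" and ys="splits zs"]
       sum_list_swap[where xs="weave (fst _) (fst _)" and ys="splits (snd _)"])
  also have "\<dots> = (\<Sum>P\<leftarrow>splits (map attach ys). \<Sum>u\<leftarrow>splits zs. \<Sum>a\<leftarrow>weave (fst P) (fst u).
      \<Sum>w\<leftarrow>weave (snd P) (snd u). \<Sum>r\<leftarrow>splits w. \<Sum>s\<leftarrow>attach t (fst r).
      \<Sum>d\<leftarrow>weave (map attach xs) (snd r). k (a @ s # d))"
    by (simp only: sum_weave_splits[where f="\<lambda>b c. \<Sum>s\<leftarrow>attach t b. \<Sum>d\<leftarrow>weave (map attach xs) c. k (_ @ s # d)"])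
  also have "\<dots> = (\<Sum>w\<leftarrow>weave (map attach ys) zs. \<Sum>p\<leftarrow>splits w. \<Sum>q\<leftarrow>splits (snd p). \<Sum>s\<leftarrow>attach t (fst q).
      \<Sum>d\<leftarrow>weave (map attach xs) (snd q). k (fst p @ s # d))"
    by (rule sum_weave_splits[symmetric])
  also have "\<dots> = (\<Sum>w\<leftarrow>weave (map attach ys) zs. \<Sum>v\<leftarrow>weave (map attach (t # xs)) w. k v)"
    by (simp add: sum_weave_Cons)
  finally show ?case .
qed

text \<open>Forests act on trees from the right, with \<open>weave\<close> as their product. This
  and the preceding lemma are one mutual induction on trees and forests: the forest statement
  assumes the tree statement for its members, and the subtrees of the root supply these.\<close>

lemma attach_assoc:
  "(\<Sum>u\<leftarrow>attach t ys. \<Sum>v\<leftarrow>attach u zs. k v)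
    = (\<Sum>w\<leftarrow>weave (map attach ys) zs. \<Sum>v\<leftarrow>attach t w. (k v :: 'c::comm_monoid_add))"
proof (induction t arbitrary: ys zs k)
  case (Node r xs)
  show ?case using weave_attach_assoc[where xs=xs and ys=ys and zs=zs and k="\<lambda>v. k (Node r v)"] Node by (simp add: o_def)
qed

section \<open>Simultaneous substitution in planar trees\<close>

text \<open>
  Substitution for all vertices at once; \<open>T \<circ>\<^sub>j S\<close> is the case where \<open>\<sigma> j = [S]\<close> and every other vertex
  is replaced by itself.
\<close>

primrec graft_all :: "('a \<Rightarrow> 'b ptree list) \<Rightarrow> 'a ptree \<Rightarrow> 'b ptree list" where
  "graft_all \<sigma> (Node r ts) = [w. S \<leftarrow> \<sigma> r, us \<leftarrow> product_lists (map (graft_all \<sigma>) ts), w \<leftarrow> attach S us]"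

abbreviation graft_alls where "graft_alls \<sigma> ts \<equiv> product_lists (map (graft_all \<sigma>) ts)"

lemma sum_product_lists_Cons:
  "(\<Sum>w\<leftarrow>product_lists (L # Ls). k w) = (\<Sum>x\<leftarrow>L. \<Sum>w\<leftarrow>product_lists Ls. (k (x # w) :: 'c::comm_monoid_add))"
  by (simp add: sum_list_concat_map o_def)

lemma sum_product_lists_append:
  "(\<Sum>w\<leftarrow>product_lists (Ls @ Ms). k w)
    = (\<Sum>v\<leftarrow>product_lists Ls. \<Sum>w\<leftarrow>product_lists Ms. (k (v @ w) :: 'c::comm_monoid_add))"
  by (induction Ls arbitrary: k) (simp_all add: sum_product_lists_Cons del: product_lists.simps(2))

lemma sum_graft_all_Node:
  "(\<Sum>w\<leftarrow>graft_all \<sigma> (Node r ts). k w)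
    = (\<Sum>S\<leftarrow>\<sigma> r. \<Sum>us\<leftarrow>graft_alls \<sigma> ts. \<Sum>w\<leftarrow>attach S us. (k w :: 'c::comm_monoid_add))"
  by (simp add: sum_list_concat_map)

declare graft_all.simps [simp del] product_lists.simps(2) [simp del]

lemma sum_splits_product_lists:
  "(\<Sum>w\<leftarrow>product_lists Ls. \<Sum>p\<leftarrow>splits w. f (fst p) (snd p))
    = (\<Sum>p\<leftarrow>splits Ls. \<Sum>v\<leftarrow>product_lists (fst p). \<Sum>w\<leftarrow>product_lists (snd p). (f v w :: 'c::comm_monoid_add))"
proof (induction Ls arbitrary: f)
  case (Cons L Ls)
  show ?case
    by (simp add: sum_product_lists_Cons o_def sum_list_addf Cons[of "\<lambda>a. f (_ # a)"]
        sum_list_swap[where xs=L and ys="splits _"])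
qed simp

text \<open>Substitution is multiplicative for the forest product. As with associativity, the
  statement for trees is assumed for the members of \<open>xs\<close>, and both factors are followed
  interval by interval.\<close>

lemma graft_alls_weave:
  assumes "\<And>t ys k. t \<in> set xs \<Longrightarrow> (\<Sum>w\<leftarrow>attach t ys. \<Sum>v\<leftarrow>graft_all \<sigma> w. k v)
    = (\<Sum>u\<leftarrow>graft_all \<sigma> t. \<Sum>us\<leftarrow>graft_alls \<sigma> ys. \<Sum>v\<leftarrow>attach u us. (k v :: 'c::comm_monoid_add))"
  shows "(\<Sum>w\<leftarrow>weave (map attach xs) ys. \<Sum>v\<leftarrow>graft_alls \<sigma> w. k v)
    = (\<Sum>us\<leftarrow>graft_alls \<sigma> xs. \<Sum>vs\<leftarrow>graft_alls \<sigma> ys. \<Sum>v\<leftarrow>weave (map attach us) vs. (k v :: 'c))"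
  using assms
proof (induction xs arbitrary: ys k)
  case Nil
  then show ?case by simp
next
  case (Cons t xs)
  have IH: "(\<Sum>w\<leftarrow>weave (map attach xs) ys. \<Sum>v\<leftarrow>graft_alls \<sigma> w. k v)
    = (\<Sum>us\<leftarrow>graft_alls \<sigma> xs. \<Sum>vs\<leftarrow>graft_alls \<sigma> ys. \<Sum>v\<leftarrow>weave (map attach us) vs. (k v :: 'c))" for ys k
    using Cons by simp
  have t: "(\<Sum>w\<leftarrow>attach t ys. \<Sum>v\<leftarrow>graft_all \<sigma> w. k v)
    = (\<Sum>u\<leftarrow>graft_all \<sigma> t. \<Sum>us\<leftarrow>graft_alls \<sigma> ys. \<Sum>v\<leftarrow>attach u us. (k v :: 'c))" for ys k
    using Cons.prems by simp
  have "(\<Sum>w\<leftarrow>weave (map attach (t # xs)) ys. \<Sum>v\<leftarrow>graft_alls \<sigma> w. k v) =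
     (\<Sum>p\<leftarrow>splits ys. \<Sum>q\<leftarrow>splits (snd p). \<Sum>s\<leftarrow>attach t (fst q). \<Sum>w\<leftarrow>weave (map attach xs) (snd q).
        \<Sum>a\<leftarrow>graft_alls \<sigma> (fst p). \<Sum>s'\<leftarrow>graft_all \<sigma> s. \<Sum>w'\<leftarrow>graft_alls \<sigma> w. k (a @ s' # w'))"
    by (simp add: sum_weave_Cons sum_product_lists_append sum_product_lists_Cons)
  also have "\<dots> = (\<Sum>p\<leftarrow>splits ys. \<Sum>q\<leftarrow>splits (snd p). \<Sum>a\<leftarrow>graft_alls \<sigma> (fst p).
        \<Sum>s\<leftarrow>attach t (fst q). \<Sum>s'\<leftarrow>graft_all \<sigma> s. \<Sum>w\<leftarrow>weave (map attach xs) (snd q). \<Sum>w'\<leftarrow>graft_alls \<sigma> w. k (a @ s' # w'))"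
    by (simp only: sum_list_swap[where xs="weave (map attach xs) _" and ys="graft_alls \<sigma> _"]
       sum_list_swap[where xs="weave (map attach xs) _" and ys="graft_all \<sigma> _"]
       sum_list_swap[where xs="attach t _" and ys="graft_alls \<sigma> (fst _)"])
  also have "\<dots> = (\<Sum>p\<leftarrow>splits ys. \<Sum>q\<leftarrow>splits (snd p). \<Sum>a\<leftarrow>graft_alls \<sigma> (fst p).
        \<Sum>u\<leftarrow>graft_all \<sigma> t. \<Sum>b\<leftarrow>graft_alls \<sigma> (fst q). \<Sum>s'\<leftarrow>attach u b.
        \<Sum>us\<leftarrow>graft_alls \<sigma> xs. \<Sum>c\<leftarrow>graft_alls \<sigma> (snd q). \<Sum>w'\<leftarrow>weave (map attach us) c. k (a @ s' # w'))"
    by (simp add: IH t)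
  also have "\<dots> = (\<Sum>u\<leftarrow>graft_all \<sigma> t. \<Sum>us\<leftarrow>graft_alls \<sigma> xs. \<Sum>p\<leftarrow>splits ys. \<Sum>q\<leftarrow>splits (snd p).
       \<Sum>a\<leftarrow>graft_alls \<sigma> (fst p). \<Sum>b\<leftarrow>graft_alls \<sigma> (fst q). \<Sum>c\<leftarrow>graft_alls \<sigma> (snd q).
       \<Sum>s'\<leftarrow>attach u b. \<Sum>w'\<leftarrow>weave (map attach us) c. k (a @ s' # w'))"
    by (simp only: sum_list_swap[where xs="attach _ _" and ys="graft_alls \<sigma> _"]
       sum_list_swap[where xs="graft_alls \<sigma> (fst _)" and ys="graft_all \<sigma> _"]
       sum_list_swap[where xs="graft_alls \<sigma> (fst _)" and ys="graft_alls \<sigma> xs"]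
       sum_list_swap[where xs="splits _" and ys="graft_all \<sigma> _"]
       sum_list_swap[where xs="splits _" and ys="graft_alls \<sigma> xs"])
  also have "\<dots> = (\<Sum>u\<leftarrow>graft_all \<sigma> t. \<Sum>us\<leftarrow>graft_alls \<sigma> xs. \<Sum>P\<leftarrow>splits (map (graft_all \<sigma>) ys). \<Sum>Q\<leftarrow>splits (snd P).
       \<Sum>a\<leftarrow>product_lists (fst P). \<Sum>b\<leftarrow>product_lists (fst Q). \<Sum>c\<leftarrow>product_lists (snd Q).
       \<Sum>s'\<leftarrow>attach u b. \<Sum>w'\<leftarrow>weave (map attach us) c. k (a @ s' # w'))"
    by (simp add: splits_map o_def)
  also have "\<dots> = (\<Sum>u\<leftarrow>graft_all \<sigma> t. \<Sum>us\<leftarrow>graft_alls \<sigma> xs. \<Sum>P\<leftarrow>splits (map (graft_all \<sigma>) ys).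
       \<Sum>a\<leftarrow>product_lists (fst P). \<Sum>Q\<leftarrow>splits (snd P). \<Sum>b\<leftarrow>product_lists (fst Q). \<Sum>c\<leftarrow>product_lists (snd Q).
       \<Sum>s'\<leftarrow>attach u b. \<Sum>w'\<leftarrow>weave (map attach us) c. k (a @ s' # w'))"
    by (simp only: sum_list_swap[where xs="product_lists _" and ys="splits _"])
  also have "\<dots> = (\<Sum>u\<leftarrow>graft_all \<sigma> t. \<Sum>us\<leftarrow>graft_alls \<sigma> xs. \<Sum>P\<leftarrow>splits (map (graft_all \<sigma>) ys).
       \<Sum>a\<leftarrow>product_lists (fst P). \<Sum>w\<leftarrow>product_lists (snd P). \<Sum>q\<leftarrow>splits w.
       \<Sum>s'\<leftarrow>attach u (fst q). \<Sum>w'\<leftarrow>weave (map attach us) (snd q). k (a @ s' # w'))"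
    by (simp only: sum_splits_product_lists[where f="\<lambda>b c. \<Sum>s'\<leftarrow>attach _ b. \<Sum>w'\<leftarrow>weave (map attach _) c. k (_ @ s' # w')"])
  also have "\<dots> = (\<Sum>u\<leftarrow>graft_all \<sigma> t. \<Sum>us\<leftarrow>graft_alls \<sigma> xs. \<Sum>w\<leftarrow>graft_alls \<sigma> ys. \<Sum>p\<leftarrow>splits w.
       \<Sum>q\<leftarrow>splits (snd p). \<Sum>s'\<leftarrow>attach u (fst q). \<Sum>w'\<leftarrow>weave (map attach us) (snd q). k (fst p @ s' # w'))"
    by (simp only: sum_splits_product_lists[where f="\<lambda>a w. \<Sum>q\<leftarrow>splits w. \<Sum>s'\<leftarrow>attach _ (fst q).
        \<Sum>w'\<leftarrow>weave (map attach _) (snd q). k (a @ s' # w')"])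
  also have "\<dots> = (\<Sum>us\<leftarrow>graft_alls \<sigma> (t # xs). \<Sum>vs\<leftarrow>graft_alls \<sigma> ys. \<Sum>v\<leftarrow>weave (map attach us) vs. k v)"
    by (simp add: sum_weave_Cons sum_product_lists_Cons)
  finally show ?case .
qed

text \<open>This makes substitution of trees compatible with the operation that interprets the
  generators, and thus with evaluation.\<close>

lemma graft_all_attach:
  "(\<Sum>w\<leftarrow>attach t ys. \<Sum>v\<leftarrow>graft_all \<sigma> w. k v)
    = (\<Sum>u\<leftarrow>graft_all \<sigma> t. \<Sum>us\<leftarrow>graft_alls \<sigma> ys. \<Sum>v\<leftarrow>attach u us. (k v :: 'c::comm_monoid_add))"
proof (induction t arbitrary: ys k)
  case (Node r xs)
  have "(\<Sum>w\<leftarrow>attach (Node r xs) ys. \<Sum>v\<leftarrow>graft_all \<sigma> w. k v) =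
     (\<Sum>S\<leftarrow>\<sigma> r. \<Sum>w\<leftarrow>weave (map attach xs) ys. \<Sum>us\<leftarrow>graft_alls \<sigma> w. \<Sum>v\<leftarrow>attach S us. k v)"
    by (simp add: o_def sum_graft_all_Node sum_list_swap[where ys="\<sigma> r"])
  also have "\<dots> = (\<Sum>S\<leftarrow>\<sigma> r. \<Sum>us\<leftarrow>graft_alls \<sigma> xs. \<Sum>vs\<leftarrow>graft_alls \<sigma> ys. \<Sum>w\<leftarrow>weave (map attach us) vs. \<Sum>v\<leftarrow>attach S w. k v)"
    using Node by (intro sum_list_cong graft_alls_weave)
  \<comment> \<open>The tree \<open>S\<close> put in place of the root carries the product of two
    forests; by \<open>attach_assoc\<close> they may be grafted one after the other.\<close>
  also have "\<dots> = (\<Sum>S\<leftarrow>\<sigma> r. \<Sum>us\<leftarrow>graft_alls \<sigma> xs. \<Sum>vs\<leftarrow>graft_alls \<sigma> ys. \<Sum>w\<leftarrow>attach S us. \<Sum>v\<leftarrow>attach w vs. k v)"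
    by (simp only: attach_assoc)
  also have "\<dots> = (\<Sum>u\<leftarrow>graft_all \<sigma> (Node r xs). \<Sum>us\<leftarrow>graft_alls \<sigma> ys. \<Sum>v\<leftarrow>attach u us. k v)"
    by (simp only: sum_graft_all_Node sum_list_swap[where xs="attach _ _" and ys="graft_alls \<sigma> ys"])
  finally show ?case .
qed

lemma product_lists_singletons: "product_lists (map (\<lambda>t. [f t]) ts) = [map f ts]"
  by (induction ts) (simp_all add: product_lists.simps(2))

section \<open>Substitution and evaluation of monomials\<close>

text \<open>Both \<open>substitute\<close> and relabelling by \<open>map_monomial id\<close> are
  instances, so one law for composed substitutions and one for evaluation serve both.\<close>

primrec subst_all :: "('a \<Rightarrow> ('g, 'b) monomial) \<Rightarrow> ('g, 'a) monomial \<Rightarrow> ('g, 'b) monomial" where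
  "subst_all \<sigma> (Var i) = \<sigma> i"
| "subst_all \<sigma> (Op g ts) = Op g (map (subst_all \<sigma>) ts)"

lemma substitute_eq_subst_all: "substitute j t s = subst_all (Var(j := s)) t"
  by (induction t) auto

lemma map_monomial_eq_subst_all: "map_monomial id \<sigma> t = subst_all (\<lambda>i. Var (\<sigma> i)) t"
  by (induction t) auto

lemma concat_map_concat: "concat (map (\<lambda>t. concat (f t)) ts) = concat (concat (map f ts))"
  by (induction ts) simp_all

lemma variables_subst_all: "variables (subst_all \<sigma> t) = concat (map (variables \<circ> \<sigma>) (variables t))"
proof (induction t)
  case (Op g ts)
  have "variables (subst_all \<sigma> (Op g ts)) = concat (map (\<lambda>t. concat (map (variables \<circ> \<sigma>) (variables t))) ts)"
    using Op by (simp add: o_def cong: map_cong)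
  also have "\<dots> = concat (map (variables \<circ> \<sigma>) (variables (Op g ts)))"
    by (simp add: map_concat o_def concat_map_concat)
  finally show ?case .
qed simp

lemma subst_all_cong: "(\<And>i. i \<in> set (variables t) \<Longrightarrow> \<sigma> i = \<tau> i) \<Longrightarrow> subst_all \<sigma> t = subst_all \<tau> t"
  by (induction t) auto

lemma subst_all_Var: "subst_all Var t = t"
  by (induction t) (auto simp: map_idI)

lemma subst_all_subst_all: "subst_all \<tau> (subst_all \<sigma> t) = subst_all (\<lambda>i. subst_all \<tau> (\<sigma> i)) t"
  by (induction t) auto

lemma well_formed_subst_all:
  "\<lbrakk>well_formed G ar t; \<And>i. i \<in> set (variables t) \<Longrightarrow> well_formed G ar (\<sigma> i)\<rbrakk> \<Longrightarrow> well_formed G ar (subst_all \<sigma> t)"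
  by (induction t) (auto simp: list_all_iff)

text \<open>Inserting trees into a corolla amounts to grafting the values of the later arguments on
  the value of the first one, hence \<open>attach\<close>. An operation without arguments has no
  first one and gets the value 0; brace generators have at least two inputs.\<close>

primrec eval_monomial :: "('g, 'a) monomial \<Rightarrow> 'a ptree list" where
  "eval_monomial (Var i) = [Node i []]"
| "eval_monomial (Op g ts) = [w. us \<leftarrow> product_lists (map eval_monomial ts),
     w \<leftarrow> (case us of [] \<Rightarrow> [] | u # us \<Rightarrow> attach u us)]"

abbreviation eval_monomials where "eval_monomials ts \<equiv> product_lists (map eval_monomial ts)"

lemma sum_eval_monomial_Op:
  "(\<Sum>w\<leftarrow>eval_monomial (Op g (t # ts)). k w)
    = (\<Sum>u\<leftarrow>eval_monomial t. \<Sum>us\<leftarrow>eval_monomials ts. \<Sum>w\<leftarrow>attach u us. (k w :: 'c::comm_monoid_add))"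
  by (simp add: sum_list_concat_map sum_product_lists_Cons)

lemma eval_monomial_Op_Nil: "eval_monomial (Op g []) = []"
  by simp

declare eval_monomial.simps(2) [simp del]

lemma attach_Nil: "attach u [] = [u]"
proof (induction u)
  case (Node r ts)
  then have "weave (map attach ts) [] = [ts]"
    by (induction ts) (simp_all add: weave.simps)
  then show ?case by simp
qed

text \<open>A variable evaluates to a one-vertex tree, in which substitution replaces that vertex.
  At an operation the claim is \<open>graft_all_attach\<close> for the values of the
  arguments.\<close>

lemma eval_monomial_subst_all:
  "(\<Sum>w\<leftarrow>eval_monomial (subst_all \<sigma> t). k w)
    = (\<Sum>u\<leftarrow>eval_monomial t. \<Sum>w\<leftarrow>graft_all (\<lambda>i. eval_monomial (\<sigma> i)) u. (k w :: 'c::comm_monoid_add))"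
proof (induction t arbitrary: k)
  case (Var i)
  show ?case by (simp add: sum_graft_all_Node attach_Nil)
next
  case (Op g ts)
  \<comment> \<open>The same for lists of arguments. The superset \<open>ts'\<close> stays fixed
    while \<open>ts\<close> shrinks, so that the hypothesis on single arguments remains
    available.\<close>
  have *: "(\<Sum>ws\<leftarrow>eval_monomials (map (subst_all \<sigma>) ts). k ws)
     = (\<Sum>us\<leftarrow>eval_monomials ts. \<Sum>ws\<leftarrow>graft_alls (\<lambda>i. eval_monomial (\<sigma> i)) us. (k ws :: 'c))"
    if "set ts \<subseteq> set ts'" "\<And>t k. t \<in> set ts' \<Longrightarrow> (\<Sum>w\<leftarrow>eval_monomial (subst_all \<sigma> t). (k w :: 'c))
    = (\<Sum>u\<leftarrow>eval_monomial t. \<Sum>w\<leftarrow>graft_all (\<lambda>i. eval_monomial (\<sigma> i)) u. k w)" for ts ts' k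
    using that(1)
  proof (induction ts arbitrary: k)
    case Nil
    then show ?case by simp
  next
    case (Cons t ts)
    have "(\<Sum>ws\<leftarrow>eval_monomials (map (subst_all \<sigma>) (t # ts)). k ws) =
      (\<Sum>u\<leftarrow>eval_monomial t. \<Sum>w\<leftarrow>graft_all (\<lambda>i. eval_monomial (\<sigma> i)) u. \<Sum>us\<leftarrow>eval_monomials ts.
         \<Sum>ws\<leftarrow>graft_alls (\<lambda>i. eval_monomial (\<sigma> i)) us. k (w # ws))"
      using Cons that(2) by (simp add: sum_product_lists_Cons o_def)
    also have "\<dots> = (\<Sum>u\<leftarrow>eval_monomial t. \<Sum>us\<leftarrow>eval_monomials ts. \<Sum>w\<leftarrow>graft_all (\<lambda>i. eval_monomial (\<sigma> i)) u.
         \<Sum>ws\<leftarrow>graft_alls (\<lambda>i. eval_monomial (\<sigma> i)) us. k (w # ws))"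
      by (intro sum_list_cong sum_list_swap)
    finally show ?case by (simp add: sum_product_lists_Cons o_def)
  qed
  show ?case
  proof (cases ts)
    case Nil
    then show ?thesis by (simp add: eval_monomial_Op_Nil)
  next
    case (Cons t ts')
    have "(\<Sum>w\<leftarrow>eval_monomial (subst_all \<sigma> (Op g ts)). k w) =
       (\<Sum>w\<leftarrow>eval_monomial (subst_all \<sigma> t). \<Sum>ws\<leftarrow>eval_monomials (map (subst_all \<sigma>) ts'). \<Sum>v\<leftarrow>attach w ws. k v)"
      by (simp add: sum_eval_monomial_Op Cons)
    also have "\<dots> = (\<Sum>u\<leftarrow>eval_monomial t. \<Sum>w\<leftarrow>graft_all (\<lambda>i. eval_monomial (\<sigma> i)) u. \<Sum>us\<leftarrow>eval_monomials ts'.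
         \<Sum>ws\<leftarrow>graft_alls (\<lambda>i. eval_monomial (\<sigma> i)) us. \<Sum>v\<leftarrow>attach w ws. k v)"
      using Op *[of ts' ts] by (simp add: Cons subset_iff)
    also have "\<dots> = (\<Sum>u\<leftarrow>eval_monomial t. \<Sum>us\<leftarrow>eval_monomials ts'. \<Sum>w\<leftarrow>graft_all (\<lambda>i. eval_monomial (\<sigma> i)) u.
         \<Sum>ws\<leftarrow>graft_alls (\<lambda>i. eval_monomial (\<sigma> i)) us. \<Sum>v\<leftarrow>attach w ws. k v)"
      by (intro sum_list_cong sum_list_swap)
    also have "\<dots> = (\<Sum>u\<leftarrow>eval_monomial (Op g ts). \<Sum>w\<leftarrow>graft_all (\<lambda>i. eval_monomial (\<sigma> i)) u. k w)"
      by (simp add: sum_eval_monomial_Op Cons graft_all_attach)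
    finally show ?thesis .
  qed
qed

lemma graft_all_leaves: "graft_all (\<lambda>i. [Node (\<sigma> i) []]) u = [map_ptree \<sigma> u]"
proof (induction u)
  case (Node r ts)
  then have "map (graft_all (\<lambda>i. [Node (\<sigma> i) []])) ts = map (\<lambda>t. [map_ptree \<sigma> t]) ts" by simp
  then have "graft_alls (\<lambda>i. [Node (\<sigma> i) []]) ts = [map (map_ptree \<sigma>) ts]"
    by (simp only: product_lists_singletons)
  then show ?case by (simp add: graft_all.simps)
qed

text \<open>Multisets, because grafting changes the order in which vertices are listed. Distinctness
  of labels and the label set are both read off from them.\<close>

lemma mset_vertices_weave:
  assumes "w \<in> set (weave (map attach ts) ys)"
    and "\<And>t ys w. t \<in> set ts \<Longrightarrow> w \<in> set (attach t ys) \<Longrightarrow>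
      mset (vertices w) = mset (vertices t) + mset (concat (map vertices ys))"
  shows "mset (concat (map vertices w)) = mset (concat (map vertices ts)) + mset (concat (map vertices ys))"
  using assms
proof (induction ts arbitrary: ys w)
  case (Cons t ts)
  from Cons.prems(1) obtain p q s v where *: "p \<in> set (splits ys)" "q \<in> set (splits (snd p))"
    "s \<in> set (attach t (fst q))" "v \<in> set (weave (map attach ts) (snd q))" "w = fst p @ s # v"
    by (auto simp: weave.simps)
  have "ys = fst p @ fst q @ snd q" using *(1,2) splits_append by metis
  moreover have "mset (concat (map vertices v)) = mset (concat (map vertices ts)) + mset (concat (map vertices (snd q)))"
    using Cons *(4) by simp
  moreover have "mset (vertices s) = mset (vertices t) + mset (concat (map vertices (fst q)))"
    using Cons.prems(2)[of t s "fst q"] *(3) by simp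
  ultimately show ?case using *(5) by (simp del: concat_map_singleton)
qed simp

lemma mset_vertices_attach:
  "w \<in> set (attach t ys) \<Longrightarrow> mset (vertices w) = mset (vertices t) + mset (concat (map vertices ys))"
proof (induction t arbitrary: ys w)
  case (Node r ts)
  from Node.prems obtain v where "w = Node r v" "v \<in> set (weave (map attach ts) ys)" by auto
  moreover from this have "mset (concat (map vertices v)) = mset (concat (map vertices ts)) + mset (concat (map vertices ys))"
    using mset_vertices_weave[of v ts ys] Node.IH by blast
  ultimately show ?case by simp
qed

lemma mset_vertices_eval_monomial:
  "w \<in> set (eval_monomial t) \<Longrightarrow> mset (vertices w) = mset (variables t)"
proof (induction t arbitrary: w)
  case (Op g ts)
  have *: "mset (concat (map vertices us)) = mset (concat (map variables vs))"
    if "us \<in> set (eval_monomials vs)" "set vs \<subseteq> set ts" for us vs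
    using that by (induction vs arbitrary: us) (auto simp: Op.IH product_lists.simps(2))
  from Op.prems obtain u us where "u # us \<in> set (eval_monomials ts)" "w \<in> set (attach u us)"
    by (auto simp: eval_monomial.simps(2) split: list.splits)
  then show ?case
    using mset_vertices_attach[of w u us] *[of "u # us" ts] by simp
qed simp

section \<open>Grafting along interval partitions\<close>

lemma set_splits: "set (splits ys) = {p. fst p @ snd p = ys}"
proof (induction ys)
  case (Cons y ys)
  have "p \<in> set (splits (y # ys))" if "fst p @ snd p = y # ys" for p
    using that Cons by (cases p; cases "fst p") (auto simp: image_iff)
  then show ?case using splits_append by fastforce
qed auto

lemma distinct_splits: "distinct (splits ys)"
  by (induction ys) (auto simp: distinct_map inj_on_def)

lemma finite_interval_partitions: "finite (interval_partitions n ys)"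
proof (induction n arbitrary: ys)
  case 0
  have "interval_partitions 0 ys \<subseteq> {[]}" by (auto simp: interval_partitions_def)
  then show ?case using finite_subset by blast
next
  case (Suc n)
  have "interval_partitions (Suc n) ys \<subseteq> (\<Union>p\<in>set (splits ys). (#) (fst p) ` interval_partitions n (snd p))"
  proof
    fix Y assume "Y \<in> interval_partitions (Suc n) ys"
    then obtain A Z where "Y = A # Z" "length Z = n" "A @ concat Z = ys"
      by (auto simp: interval_partitions_def length_Suc_conv)
    then show "Y \<in> (\<Union>p\<in>set (splits ys). (#) (fst p) ` interval_partitions n (snd p))"
      by (intro UN_I[of "(A, concat Z)"]) (auto simp: interval_partitions_def set_splits)
  qed
  then show ?case using Suc by (auto intro: finite_subset)
qed

lemma interval_partitions_0: "interval_partitions 0 ys = (if ys = [] then {[]} else {})"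
  by (auto simp: interval_partitions_def)

text \<open>Detaching the first interval leads from the sets used in the definitions to the lists of
  cuts used for products.\<close>

lemma sum_interval_partitions_Suc:
  "(\<Sum>Y\<in>interval_partitions (Suc n) ys. k Y)
    = (\<Sum>p\<leftarrow>splits ys. \<Sum>Y\<in>interval_partitions n (snd p). (k (fst p # Y) :: 'c::comm_monoid_add))"
proof -
  have "(\<Sum>p\<leftarrow>splits ys. \<Sum>Y\<in>interval_partitions n (snd p). k (fst p # Y)) =
    (\<Sum>p\<in>set (splits ys). \<Sum>Y\<in>interval_partitions n (snd p). k (fst p # Y))"
    by (simp add: sum_list_distinct_conv_sum_set distinct_splits)
  also have "\<dots> = (\<Sum>(p, Y)\<in>(SIGMA p:set (splits ys). interval_partitions n (snd p)). k (fst p # Y))"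
    by (simp add: sum.Sigma finite_interval_partitions)
  also have "\<dots> = (\<Sum>Y\<in>interval_partitions (Suc n) ys. k Y)"
    by (rule sum.reindex_bij_witness[where i="\<lambda>Y. ((hd Y, concat (tl Y)), tl Y)" and j="\<lambda>(p, Y). fst p # Y"])
       (auto simp: interval_partitions_def set_splits length_Suc_conv)
  finally show ?thesis by simp
qed

lemma sum_interval_partitions_1: "(\<Sum>Y\<in>interval_partitions (Suc 0) ys. k Y) = (k [ys] :: 'c::comm_monoid_add)"
proof -
  have "interval_partitions (Suc 0) ys = {[ys]}" by (auto simp: interval_partitions_def length_Suc_conv)
  then show ?thesis by simp
qed

lemma sum_interval_partitions_add:
  "(\<Sum>Y\<in>interval_partitions (m + n) ys. k Y)
    = (\<Sum>p\<leftarrow>splits ys. \<Sum>Y\<in>interval_partitions m (fst p). \<Sum>Z\<in>interval_partitions n (snd p). (k (Y @ Z) :: 'c::comm_monoid_add))"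
proof (induction m arbitrary: ys k)
  case 0
  \<comment> \<open>Only the empty list has a partition into zero intervals, so just the cut with
    empty prefix contributes.\<close>
  show ?case by (induction ys arbitrary: k) (simp_all add: interval_partitions_0 o_def)
next
  case (Suc m)
  have "(\<Sum>Y\<in>interval_partitions (Suc m + n) ys. k Y) = (\<Sum>p\<leftarrow>splits ys. \<Sum>q\<leftarrow>splits (snd p).
     \<Sum>Y\<in>interval_partitions m (fst q). \<Sum>Z\<in>interval_partitions n (snd q). k (fst p # Y @ Z))"
    by (simp add: sum_interval_partitions_Suc Suc)
  also have "\<dots> = (\<Sum>p\<leftarrow>splits ys. \<Sum>q\<leftarrow>splits (fst p).
     \<Sum>Y\<in>interval_partitions m (snd q). \<Sum>Z\<in>interval_partitions n (snd p). k (fst q # Y @ Z))"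
    by (rule splits_coassoc[where f="\<lambda>a b c. \<Sum>Y\<in>interval_partitions m b. \<Sum>Z\<in>interval_partitions n c. k (a # Y @ Z)"])
  finally show ?case by (simp add: sum_interval_partitions_Suc)
qed

text \<open>Allows positions to stand for the trees found there, as grafting maps are defined on
  positions of incoming edges.\<close>

lemma sum_interval_partitions_map:
  "(\<Sum>Y\<in>interval_partitions n (map h ys). k Y)
    = (\<Sum>Y\<in>interval_partitions n ys. (k (map (map h) Y) :: 'c::comm_monoid_add))"
  by (induction n arbitrary: ys k) (simp_all add: interval_partitions_0 sum_interval_partitions_Suc splits_map o_def)

section \<open>Angles and grafting by recursion on the list of subtrees\<close>

text \<open>The sectors at a root are numbered from 0, which blocks an induction on its subtrees; a
  variable first number \<open>i\<close> gives a recursion over \<open>ts\<close>.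
  \<open>graft_from\<close> generalises \<open>graft\<close> for the same reason.\<close>

definition angles_from :: "'a \<Rightarrow> 'a ptree list \<Rightarrow> nat \<Rightarrow> ('a \<times> nat) list" where
  "angles_from r ts i = (r, i) # concat (map2 (\<lambda>i as. as @ [(r, i + 1)]) [i..<i + length ts] (map angles ts))"

lemma angles_from_Nil: "angles_from r [] i = [(r, i)]"
  by (simp add: angles_from_def)

lemma angles_from_Cons: "angles_from r (t # ts) i = (r, i) # angles t @ angles_from r ts (Suc i)"
  by (simp add: angles_from_def upt_conv_Cons del: upt_Suc)

lemma angles_Node: "angles (Node r ts) = angles_from r ts 0"
  by (simp add: angles_from_def)

definition graft_from :: "('a \<times> nat \<Rightarrow> 'a ptree list) \<Rightarrow> 'a \<Rightarrow> 'a ptree list \<Rightarrow> nat \<Rightarrow> 'a ptree list" where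
  "graft_from g r ts i = g (r, i) @ concat (map2 (\<lambda>i t. t # g (r, i + 1)) [i..<i + length ts] (map (graft g) ts))"

lemma graft_from_Nil: "graft_from g r [] i = g (r, i)"
  by (simp add: graft_from_def)

lemma graft_from_Cons: "graft_from g r (t # ts) i = g (r, i) @ graft g t # graft_from g r ts (Suc i)"
  by (simp add: graft_from_def upt_conv_Cons del: upt_Suc)

lemma graft_Node: "graft g (Node r ts) = Node r (graft_from g r ts 0)"
  by (simp add: graft_from_def)

declare angles.simps [simp del] graft.simps [simp del]

lemma graft_cong: "(\<And>a. a \<in> set (angles S) \<Longrightarrow> g a = h a) \<Longrightarrow> graft g S = graft h S"
proof (induction S)
  case (Node r ts)
  have "graft_from g r us i = graft_from h r us i" if "set us \<subseteq> set ts" "\<And>a. a \<in> set (angles_from r us i) \<Longrightarrow> g a = h a" for us i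
    using that
  proof (induction us arbitrary: i)
    case (Cons u us)
    then have "graft g u = graft h u" using Node.IH[of u] by (simp add: angles_from_Cons)
    with Cons show ?case by (simp add: angles_from_Cons graft_from_Cons)
  qed (simp add: graft_from_Nil angles_from_Nil)
  with Node.prems show ?case by (simp add: graft_Node angles_Node)
qed

lemma graft_from_cong: "(\<And>a. a \<in> set (angles_from r ts i) \<Longrightarrow> g a = h a) \<Longrightarrow> graft_from g r ts i = graft_from h r ts i"
proof (induction ts arbitrary: i)
  case (Cons u us)
  then have "graft g u = graft h u" by (intro graft_cong) (simp add: angles_from_Cons)
  with Cons show ?case by (simp add: angles_from_Cons graft_from_Cons)
qed (simp add: graft_from_Nil angles_from_Nil)

lemma set_angles_from: "set (angles_from r ts i) \<subseteq> {r} \<times> {i..} \<union> (\<Union>t\<in>set ts. set (angles t))"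
proof (induction ts arbitrary: i)
  case (Cons t ts)
  from Cons[of "Suc i"] show ?case by (simp add: angles_from_Cons) fastforce
qed (simp add: angles_from_Nil)

lemma fst_angles: "a \<in> set (angles S) \<Longrightarrow> fst a \<in> set (vertices S)"
proof (induction S)
  case (Node r ts)
  then show ?case using set_angles_from[of r ts 0] by (cases a) (auto simp: angles_Node dest!: subsetD)
qed

text \<open>Angles at different vertices differ in the vertex, and those at the root in the sector
  number, which only increases along the list.\<close>

lemma distinct_angles_from:
  assumes "\<And>t. t \<in> set ts \<Longrightarrow> distinct (angles t)" "distinct (r # concat (map vertices ts))"
  shows "distinct (angles_from r ts i)"
  using assms
proof (induction ts arbitrary: i)
  case (Cons t ts)
  have "a \<notin> set (angles_from r ts (Suc i))" if "a \<in> set (angles t)" for a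
  proof
    assume "a \<in> set (angles_from r ts (Suc i))"
    then have "fst a = r \<or> (\<exists>t\<in>set ts. a \<in> set (angles t))" using set_angles_from by fastforce
    then have "fst a \<in> set (r # concat (map vertices ts))" using fst_angles by fastforce
    moreover have "fst a \<in> set (vertices t)" using that by (rule fst_angles)
    ultimately show False using Cons.prems(2) by auto
  qed
  moreover have "(r, i) \<notin> set (angles_from r ts (Suc i))"
  proof
    assume "(r, i) \<in> set (angles_from r ts (Suc i))"
    then have "\<exists>t\<in>set ts. (r, i) \<in> set (angles t)" using set_angles_from by fastforce
    then show False using fst_angles Cons.prems(2) by fastforce
  qed
  moreover have "(r, i) \<notin> set (angles t)" using fst_angles Cons.prems(2) by fastforce
  moreover have "distinct (angles_from r ts (Suc i))" using Cons by simp
  ultimately show ?case using Cons.prems(1) by (auto simp: angles_from_Cons)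
qed (simp add: angles_from_Nil)

lemma distinct_angles: "distinct (vertices S) \<Longrightarrow> distinct (angles S)"
proof (induction S)
  case (Node r ts)
  have "distinct (angles t)" if "t \<in> set ts" for t
    using Node.IH[OF that] Node.prems split_list[OF that] by auto
  then show ?case using Node.prems distinct_angles_from[of ts r 0] by (simp add: angles_Node)
qed

text \<open>Turns a partition with one interval for each angle into the function that
  \<open>graft\<close> expects. Outside \<open>as\<close> the value is unspecified, so such
  functions are compared through \<open>graft_cong\<close>, on the angles of the tree only.\<close>

definition lookup_list :: "'b list \<Rightarrow> 'c list list \<Rightarrow> 'b \<Rightarrow> 'c list" where
  "lookup_list as Y a = the (map_of (zip as Y) a)"

lemma map_lookup_list: "\<lbrakk>distinct as; length Y = length as\<rbrakk> \<Longrightarrow> map (lookup_list as Y) as = Y"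
  by (rule nth_equalityI) (auto simp: lookup_list_def map_of_zip_nth)

lemma lookup_list_Cons: "lookup_list (a # as) (A # Y) b = (if b = a then A else lookup_list as Y b)"
  by (simp add: lookup_list_def)

lemma lookup_list_append:
  "length Y = length as \<Longrightarrow>
    lookup_list (as @ bs) (Y @ Z) b = (if b \<in> set as then lookup_list as Y b else lookup_list bs Z b)"
  by (induction as Y rule: list_induct2') (auto simp: lookup_list_Cons)

text \<open>The angles are the first sector at \<open>r\<close>, the angles of \<open>t\<close>, and
  those from the next sector on. Cutting a partition into these three blocks reproduces the
  recursion of \<open>weave\<close>: a gap, a subtree, the remaining forest.\<close>

lemma sum_graft_weave:
  assumes "\<And>t ys k. \<lbrakk>t \<in> set ts; distinct (angles t)\<rbrakk> \<Longrightarrow>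
     (\<Sum>Y\<in>interval_partitions (length (angles t)) ys. k (graft (lookup_list (angles t) Y) t))
       = (\<Sum>w\<leftarrow>attach t ys. (k w :: 'c::comm_monoid_add))"
    and "distinct (angles_from r ts i)"
  shows "(\<Sum>Y\<in>interval_partitions (length (angles_from r ts i)) ys. k (graft_from (lookup_list (angles_from r ts i) Y) r ts i))
       = (\<Sum>w\<leftarrow>weave (map attach ts) ys. (k w :: 'c::comm_monoid_add))"
  using assms
proof (induction ts arbitrary: ys i k)
  case Nil
  then show ?case
    by (simp add: angles_from_Nil graft_from_Nil sum_interval_partitions_1 lookup_list_def)
next
  case (Cons t ts)
  let ?A = "angles t" and ?B = "angles_from r ts (Suc i)"
  have d: "distinct ?A" "distinct ?B" "(r, i) \<notin> set ?A" "(r, i) \<notin> set ?B" "set ?A \<inter> set ?B = {}"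
    using Cons.prems(2) by (auto simp: angles_from_Cons)
  have B: "(\<Sum>Y\<in>interval_partitions (length ?B) ys. k (graft_from (lookup_list ?B Y) r ts (Suc i)))
       = (\<Sum>w\<leftarrow>weave (map attach ts) ys. (k w :: 'c))" for ys k
    using Cons.prems(1) d(2) by (intro Cons.IH) auto
  have t: "(\<Sum>Y\<in>interval_partitions (length ?A) ys. k (graft (lookup_list ?A Y) t)) = (\<Sum>w\<leftarrow>attach t ys. (k w :: 'c))" for ys k
    using Cons.prems(1)[of t] d(1) by simp
  \<comment> \<open>\<open>P\<close>, \<open>Y\<close> and \<open>Z\<close> are the intervals of the
    three blocks. As the angles are distinct, no block influences what is grafted at the angles of
    another.\<close>
  have *: "graft_from (lookup_list (angles_from r (t # ts) i) (P # Y @ Z)) r (t # ts) i =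
      P @ graft (lookup_list ?A Y) t # graft_from (lookup_list ?B Z) r ts (Suc i)"
    if "length Y = length ?A" "length Z = length ?B" for P Y Z
  proof -
    let ?g = "lookup_list (angles_from r (t # ts) i) (P # Y @ Z)"
    have g: "?g a = (if a = (r, i) then P else if a \<in> set ?A then lookup_list ?A Y a else lookup_list ?B Z a)" for a
      using that by (simp add: angles_from_Cons lookup_list_Cons lookup_list_append)
    then have "?g (r, i) = P" by simp
    moreover have "graft ?g t = graft (lookup_list ?A Y) t"
      using d(3) by (intro graft_cong) (auto simp: g)
    moreover have "graft_from ?g r ts (Suc i) = graft_from (lookup_list ?B Z) r ts (Suc i)"
      using d(4,5) by (intro graft_from_cong) (auto simp: g)
    ultimately show ?thesis by (simp add: graft_from_Cons)
  qed
  have "(\<Sum>Y\<in>interval_partitions (length (angles_from r (t # ts) i)) ys. k (graft_from (lookup_list (angles_from r (t # ts) i) Y) r (t # ts) i)) =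
     (\<Sum>p\<leftarrow>splits ys. \<Sum>q\<leftarrow>splits (snd p). \<Sum>Y\<in>interval_partitions (length ?A) (fst q). \<Sum>Z\<in>interval_partitions (length ?B) (snd q).
        k (graft_from (lookup_list (angles_from r (t # ts) i) (fst p # Y @ Z)) r (t # ts) i))"
    by (subst angles_from_Cons) (simp add: sum_interval_partitions_Suc sum_interval_partitions_add)
  also have "\<dots> = (\<Sum>p\<leftarrow>splits ys. \<Sum>q\<leftarrow>splits (snd p). \<Sum>Y\<in>interval_partitions (length ?A) (fst q). \<Sum>Z\<in>interval_partitions (length ?B) (snd q).
        k (fst p @ graft (lookup_list ?A Y) t # graft_from (lookup_list ?B Z) r ts (Suc i)))"
    by (intro sum_list_cong sum.cong refl arg_cong[where f=k] *) (auto simp: interval_partitions_def)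
  also have "\<dots> = (\<Sum>p\<leftarrow>splits ys. \<Sum>q\<leftarrow>splits (snd p). \<Sum>s\<leftarrow>attach t (fst q). \<Sum>w\<leftarrow>weave (map attach ts) (snd q). k (fst p @ s # w))"
    by (simp only: B[where k="\<lambda>w. k (_ @ _ # w)"] t[where k="\<lambda>s. \<Sum>w\<leftarrow>weave (map attach ts) _. k (_ @ s # w)"])
  finally show ?case by (simp add: sum_weave_Cons)
qed

lemma sum_graft_attach:
  "distinct (angles t) \<Longrightarrow> (\<Sum>Y\<in>interval_partitions (length (angles t)) ys. k (graft (lookup_list (angles t) Y) t))
       = (\<Sum>w\<leftarrow>attach t ys. (k w :: 'c::comm_monoid_add))"
proof (induction t arbitrary: ys k)
  case (Node r ts)
  show ?case
    using sum_graft_weave[where ts=ts and r=r and i=0 and ys=ys and k="\<lambda>w. k (Node r w)"] Node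
    by (simp add: graft_Node angles_Node o_def)
qed


section \<open>Weakly increasing maps and interval partitions\<close>

lemma filter_less_Suc:
  fixes \<phi> :: "'b \<Rightarrow> nat"
  assumes "sorted (map \<phi> xs)"
  shows "filter (\<lambda>x. \<phi> x < Suc n) xs = filter (\<lambda>x. \<phi> x < n) xs @ filter (\<lambda>x. \<phi> x = n) xs"
  using assms
proof (induction xs)
  case (Cons a xs)
  then have "filter (\<lambda>x. \<phi> x < \<phi> a) xs = []" by (auto simp: filter_empty_conv)
  with Cons show ?case by auto
qed simp

text \<open>In a sorted list each level set is a block, and the blocks come in the order of their
  levels.\<close>

lemma concat_filter_levels:
  fixes \<phi> :: "'b \<Rightarrow> nat"
  assumes "sorted (map \<phi> xs)"
  shows "concat (map (\<lambda>n. filter (\<lambda>x. \<phi> x = n) xs) [0..<N]) = filter (\<lambda>x. \<phi> x < N) xs"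
  by (induction N) (simp_all add: filter_less_Suc[OF assms])

definition fibres :: "'b list \<Rightarrow> nat \<Rightarrow> (nat \<Rightarrow> 'b) \<Rightarrow> nat list list" where
  "fibres as m f = map (\<lambda>a. filter (\<lambda>p. f p = a) [0..<m]) as"

text \<open>Grafting maps with an arbitrary list in place of the angles, ordered by position.
  Extensionality makes a map determined by its fibres.\<close>

definition monotone_maps :: "'b list \<Rightarrow> nat \<Rightarrow> (nat \<Rightarrow> 'b) set" where
  "monotone_maps as m = {f \<in> {..<m} \<rightarrow>\<^sub>E set as.
     \<forall>p<m. \<forall>q<m. p \<le> q \<longrightarrow> (\<exists>i k. i \<le> k \<and> k < length as \<and> as ! i = f p \<and> as ! k = f q)}"

text \<open>The fibres of a weakly increasing map, listed in the order of its values, are successive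
  and possibly empty intervals; conversely each position is sent to the entry of \<open>as\<close>
  that belongs to its interval.\<close>

lemma bij_betw_fibres:
  assumes "distinct as"
  shows "bij_betw (fibres as m) (monotone_maps as m) (interval_partitions (length as) [0..<m])"
  unfolding bij_betw_def
proof (intro conjI equalityI subsetI)
  show "inj_on (fibres as m) (monotone_maps as m)"
  proof (rule inj_onI)
    fix f g assume fg: "f \<in> monotone_maps as m" "g \<in> monotone_maps as m" "fibres as m f = fibres as m g"
    show "f = g"
    proof (rule PiE_ext[of _ "{..<m}" "\<lambda>_. set as"])
      show "f \<in> {..<m} \<rightarrow>\<^sub>E set as" "g \<in> {..<m} \<rightarrow>\<^sub>E set as" using fg by (auto simp: monotone_maps_def)
      fix p assume p: "p \<in> {..<m}"
      then have "f p \<in> set as" using fg by (auto simp: monotone_maps_def)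
      then have "filter (\<lambda>q. f q = f p) [0..<m] = filter (\<lambda>q. g q = f p) [0..<m]"
        using fg(3) by (auto simp: fibres_def)
      moreover have "p \<in> set (filter (\<lambda>q. f q = f p) [0..<m])" using p by simp
      ultimately have "p \<in> set (filter (\<lambda>q. g q = f p) [0..<m])" by simp
      then show "f p = g p" by simp
    qed
  qed
next
  fix Y assume "Y \<in> fibres as m ` monotone_maps as m"
  then obtain f where f: "f \<in> monotone_maps as m" "Y = fibres as m f" by auto
  have "\<exists>n<length as. as ! n = f p" if "p < m" for p
    using f(1) that by (auto simp: monotone_maps_def PiE_iff in_set_conv_nth)
  \<comment> \<open>The position of the value of \<open>f\<close> in \<open>as\<close>. Since
    \<open>as\<close> is distinct it is unique, and monotonicity of \<open>f\<close> becomes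
    monotonicity of \<open>\<phi>\<close>.\<close>
  then obtain \<phi> where \<phi>: "\<And>p. p < m \<Longrightarrow> \<phi> p < length as \<and> as ! \<phi> p = f p" by metis
  have "\<phi> p \<le> \<phi> q" if pq: "p \<le> q" "q < m" for p q
  proof -
    have "\<forall>p<m. \<forall>q<m. p \<le> q \<longrightarrow> (\<exists>i k. i \<le> k \<and> k < length as \<and> as ! i = f p \<and> as ! k = f q)"
      using f(1) by (simp add: monotone_maps_def)
    then obtain i k where ik: "i \<le> k" "k < length as" "as ! i = f p" "as ! k = f q" using pq by (meson le_less_trans)
    have "i = \<phi> p" "k = \<phi> q"
      using ik \<phi>[of p] \<phi>[of q] pq nth_eq_iff_index_eq[OF assms, of i "\<phi> p"] nth_eq_iff_index_eq[OF assms, of k "\<phi> q"]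
      by auto
    then show ?thesis using ik by simp
  qed
  then have "sorted (map \<phi> [0..<m])" by (auto simp: sorted_iff_nth_mono)
  from concat_filter_levels[OF this] have "concat (map (\<lambda>n. filter (\<lambda>x. \<phi> x = n) [0..<m]) [0..<length as]) = filter (\<lambda>x. \<phi> x < length as) [0..<m]" .
  also have "\<dots> = [0..<m]" using \<phi> by (simp add: filter_id_conv)
  also have "map (\<lambda>n. filter (\<lambda>x. \<phi> x = n) [0..<m]) [0..<length as] = fibres as m f"
    unfolding fibres_def
  proof (rule nth_equalityI)
    fix n assume "n < length (map (\<lambda>n. filter (\<lambda>x. \<phi> x = n) [0..<m]) [0..<length as])"
    then have n: "n < length as" by simp
    have "filter (\<lambda>x. \<phi> x = n) [0..<m] = filter (\<lambda>p. f p = as ! n) [0..<m]"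
    proof (rule filter_cong[OF refl])
      fix x assume "x \<in> set [0..<m]"
      then have "x < m" by simp
      show "\<phi> x = n \<longleftrightarrow> f x = as ! n"
        using \<phi>[OF \<open>x < m\<close>] nth_eq_iff_index_eq[OF assms _ n, of "\<phi> x"] by metis
    qed
    then show "map (\<lambda>n. filter (\<lambda>x. \<phi> x = n) [0..<m]) [0..<length as] ! n = map (\<lambda>a. filter (\<lambda>p. f p = a) [0..<m]) as ! n"
      using n by simp
  qed simp
  finally show "Y \<in> interval_partitions (length as) [0..<m]"
    using f(2) by (simp add: interval_partitions_def fibres_def)
next
  fix Y assume "Y \<in> interval_partitions (length as) [0..<m]"
  then have Y: "length Y = length as" "concat Y = [0..<m]" by (auto simp: interval_partitions_def)
  have dec: "[0..<m] = concat (take n Y) @ Y ! n @ concat (drop (Suc n) Y)" if "n < length Y" for n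
    using Y(2) id_take_nth_drop[OF that] by (metis concat.simps(2) concat_append)
  have less: "p < q" if "n < n'" "n' < length Y" "p \<in> set (Y ! n)" "q \<in> set (Y ! n')" for n n' p q
  proof -
    have "take n' Y ! n \<in> set (take n' Y)" using that(1,2) by (intro nth_mem) simp
    then have "Y ! n \<in> set (take n' Y)" using that(1) by simp
    then have p: "p \<in> set (concat (take n' Y))" using that(3) by auto
    have "sorted_wrt (<) (concat (take n' Y) @ Y ! n' @ concat (drop (Suc n') Y))"
      by (fold dec[OF that(2)]) simp
    then have "\<forall>x\<in>set (concat (take n' Y)). \<forall>y\<in>set (Y ! n' @ concat (drop (Suc n') Y)). x < y"
      unfolding sorted_wrt_append by (elim conjE)
    from this[rule_format, OF p, of q] show ?thesis using that(4) by simp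
  qed
  have "\<exists>n<length Y. p \<in> set (Y ! n)" if "p < m" for p
  proof -
    have "p \<in> set (concat Y)" using that Y(2) by simp
    then obtain Z where "Z \<in> set Y" "p \<in> set Z" by auto
    then show ?thesis by (metis in_set_conv_nth)
  qed
  \<comment> \<open>The number of the interval containing \<open>p\<close>; it is unique and weakly
    increasing in \<open>p\<close> because \<open>[0..<m]\<close> is strictly increasing.\<close>
  then obtain \<phi> where \<phi>: "\<And>p. p < m \<Longrightarrow> \<phi> p < length Y \<and> p \<in> set (Y ! \<phi> p)" by metis
  have \<phi>_iff: "\<phi> p = n \<longleftrightarrow> p \<in> set (Y ! n)" if "p < m" "n < length Y" for p n
    using \<phi>[OF that(1)] that(2) less[of n "\<phi> p" p p] less[of "\<phi> p" n p p] by (metis less_irrefl nat_neq_iff)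
  define f where "f = (\<lambda>p\<in>{..<m}. as ! \<phi> p)"
  have "\<phi> p \<le> \<phi> q" if "p \<le> q" "q < m" for p q
    using less[of "\<phi> q" "\<phi> p" q p] \<phi>[of p] \<phi>[of q] that by (meson leD le_less_trans not_le_imp_less)
  then have "f \<in> monotone_maps as m"
    using \<phi> Y(1) by (fastforce simp: monotone_maps_def f_def)
  moreover have "fibres as m f = Y"
  proof (rule nth_equalityI)
    fix n assume "n < length (fibres as m f)"
    then have n: "n < length Y" using Y(1) by (simp add: fibres_def)
    have "fibres as m f ! n = filter (\<lambda>p. p \<in> set (Y ! n)) [0..<m]"
      using n Y(1) \<phi> \<phi>_iff assms by (auto simp: fibres_def f_def nth_eq_iff_index_eq intro!: filter_cong)
    also have "\<dots> = Y ! n"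
    proof (rule sorted_distinct_set_unique)
      have "sorted (concat (take n Y) @ Y ! n @ concat (drop (Suc n) Y))" "distinct (concat (take n Y) @ Y ! n @ concat (drop (Suc n) Y))"
        by (fold dec[OF n]) simp_all
      then show "sorted (Y ! n)" "distinct (Y ! n)" by (auto simp: sorted_append)
      show "set (filter (\<lambda>p. p \<in> set (Y ! n)) [0..<m]) = set (Y ! n)"
        using arg_cong[OF dec[OF n], of set] by auto
    qed (simp_all add: sorted_wrt_filter)
    finally show "fibres as m f ! n = Y ! n" .
  qed (simp add: fibres_def Y(1))
  ultimately show "Y \<in> fibres as m ` monotone_maps as m" by blast
qed

text \<open>The fibres of a map prescribe the interval of \<open>ts\<close> for each angle, so the
  sum over partitions of positions can be transported along \<open>bij_betw_fibres\<close>.\<close>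

lemma sum_monotone_maps_graft:
  assumes "distinct (vertices S)"
  shows "(\<Sum>f\<in>monotone_maps (angles S) (length ts).
      k (graft (\<lambda>a. map (\<lambda>p. ts ! p) (filter (\<lambda>p. f p = a) [0..<length ts])) S))
    = (\<Sum>w\<leftarrow>attach S ts. (k w :: 'c::comm_monoid_add))"
proof -
  let ?A = "angles S"
  have d: "distinct ?A" using assms by (rule distinct_angles)
  have "(\<Sum>w\<leftarrow>attach S ts. k w) = (\<Sum>Y\<in>interval_partitions (length ?A) (map (\<lambda>p. ts ! p) [0..<length ts]).
      k (graft (lookup_list ?A Y) S))"
    by (simp only: sum_graft_attach[OF d] map_nth)
  also have "\<dots> = (\<Sum>Y\<in>interval_partitions (length ?A) [0..<length ts].
      k (graft (lookup_list ?A (map (map (\<lambda>p. ts ! p)) Y)) S))"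
    by (rule sum_interval_partitions_map)
  also have "\<dots> = (\<Sum>f\<in>monotone_maps ?A (length ts).
      k (graft (lookup_list ?A (map (map (\<lambda>p. ts ! p)) (fibres ?A (length ts) f))) S))"
    by (rule sum.reindex_bij_betw[symmetric, OF bij_betw_fibres[OF d]])
  also have "\<dots> = (\<Sum>f\<in>monotone_maps ?A (length ts).
      k (graft (\<lambda>a. map (\<lambda>p. ts ! p) (filter (\<lambda>p. f p = a) [0..<length ts])) S))"
  proof (intro sum.cong refl arg_cong[where f=k] graft_cong)
    fix f a assume "a \<in> set ?A"
    then obtain n where "n < length ?A" "a = ?A ! n" by (auto simp: in_set_conv_nth)
    then show "lookup_list ?A (map (map (\<lambda>p. ts ! p)) (fibres ?A (length ts) f)) a = map (\<lambda>p. ts ! p) (filter (\<lambda>p. f p = a) [0..<length ts])"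
      using arg_cong[OF map_lookup_list[OF d, of "map (map (\<lambda>p. ts ! p)) (fibres ?A (length ts) f)"], of "\<lambda>l. l ! n"]
      by (simp add: fibres_def)
  qed
  finally show ?thesis ..
qed

section \<open>Partial composition as simultaneous substitution\<close>

lemma grafting_maps_eq_monotone_maps:
  "grafting_maps T j S = monotone_maps (angles S) (length (subtrees_at j T))"
  by (auto simp: grafting_maps_def monotone_maps_def Entr_def angle_le_def)

lemma subtrees_at_notin: "j \<notin> set (vertices T) \<Longrightarrow> subtrees_at j T = []"
  by (induction T) auto

lemma insert_tree_notin: "j \<notin> set (vertices T) \<Longrightarrow> insert_tree j S f T = T"
  by (induction T) (auto simp: map_idI)

lemma graft_all_notin:
  assumes "j \<notin> set (vertices T)"
  shows "graft_all (\<lambda>i. if i = j then L else [Node i []]) T = [T]"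
  using assms
proof (induction T)
  case (Node r ts)
  then have "graft_alls (\<lambda>i. if i = j then L else [Node i []]) ts = product_lists (map (\<lambda>t. [id t]) ts)"
    by (intro arg_cong[where f=product_lists] map_cong) auto
  also have "\<dots> = [ts]" by (subst product_lists_singletons) simp
  finally show ?case using Node.prems by (auto simp: graft_all.simps)
qed

text \<open>If \<open>j\<close> is the root, this is the comparison of \<open>attach\<close> with
  monotone maps. Otherwise distinctness of the labels puts \<open>j\<close> into exactly one
  subtree; the other subtrees are unchanged, and the edges entering \<open>j\<close> are the same in
  that subtree as in the whole tree.\<close>

lemma sum_grafting_maps:
  assumes "distinct (vertices T)" "j \<in> set (vertices T)" "\<And>S. S \<in> set L \<Longrightarrow> distinct (vertices S)"
  shows "(\<Sum>w\<leftarrow>graft_all (\<lambda>i. if i = j then L else [Node i []]) T. k w)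
    = (\<Sum>S\<leftarrow>L. \<Sum>f\<in>grafting_maps T j S. (k (insert_tree j S f T) :: 'c::comm_monoid_add))"
  using assms
proof (induction T arbitrary: k)
  case (Node r ts)
  let ?\<sigma> = "\<lambda>i. if i = j then L else [Node i []]"
  have notin: "graft_alls ?\<sigma> us = [us]" if "j \<notin> set (concat (map vertices us))" for us
  proof -
    have "graft_alls ?\<sigma> us = product_lists (map (\<lambda>t. [id t]) us)"
      using that by (intro arg_cong[where f=product_lists] map_cong) (auto simp: graft_all_notin)
    also have "\<dots> = [us]" by (subst product_lists_singletons) simp
    finally show ?thesis .
  qed
  show ?case
  proof (cases "r = j")
    case True
    then have "graft_alls ?\<sigma> ts = [ts]" using Node.prems by (intro notin) auto
    then have "(\<Sum>w\<leftarrow>graft_all ?\<sigma> (Node r ts). k w) = (\<Sum>S\<leftarrow>L. \<Sum>w\<leftarrow>attach S ts. k w)"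
      using True by (simp add: sum_graft_all_Node)
    also have "\<dots> = (\<Sum>S\<leftarrow>L. \<Sum>f\<in>grafting_maps (Node r ts) j S. k (insert_tree j S f (Node r ts)))"
      using Node.prems(3) True
      by (intro sum_list_cong) (simp add: grafting_maps_eq_monotone_maps sum_monotone_maps_graft)
    finally show ?thesis .
  next
    case False
    then obtain t where "t \<in> set ts" "j \<in> set (vertices t)" using Node.prems by auto
    then obtain us vs where ts: "ts = us @ t # vs" and j: "j \<in> set (vertices t)" using split_list by metis
    have n: "j \<notin> set (concat (map vertices us))" "j \<notin> set (concat (map vertices vs))" "distinct (vertices t)"
      using Node.prems(1) j by (auto simp: ts)
    then have n': "\<And>u. u \<in> set us \<union> set vs \<Longrightarrow> j \<notin> set (vertices u)" by auto
    have "(\<Sum>w\<leftarrow>graft_all ?\<sigma> (Node r ts). k w) = (\<Sum>w\<leftarrow>graft_all ?\<sigma> t. k (Node r (us @ w # vs)))"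
      using False n(1,2) by (simp add: sum_graft_all_Node ts sum_product_lists_append sum_product_lists_Cons notin)
    also have "\<dots> = (\<Sum>S\<leftarrow>L. \<Sum>f\<in>grafting_maps t j S. k (Node r (us @ insert_tree j S f t # vs)))"
      by (intro Node.IH) (use n j Node.prems(3) ts in auto)
    also have "\<dots> = (\<Sum>S\<leftarrow>L. \<Sum>f\<in>grafting_maps (Node r ts) j S. k (insert_tree j S f (Node r ts)))"
    proof -
      have e: "concat (map (subtrees_at j) us) = []" "concat (map (subtrees_at j) vs) = []"
        using n' by (auto simp: subtrees_at_notin)
      have "subtrees_at j (Node r ts) = subtrees_at j t"
        using False by (simp add: ts e)
      moreover have "insert_tree j S f (Node r ts) = Node r (us @ insert_tree j S f t # vs)" for S f
        using False n' by (simp add: ts insert_tree_notin map_idI)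
      ultimately show ?thesis by (simp add: grafting_maps_eq_monotone_maps)
    qed
    finally show ?thesis .
  qed
qed

section \<open>The first isomorphism theorem for operads\<close>

text \<open>The axioms of an operad are not part of this notion, since those of the target are to be
  obtained by transport along the map.\<close>

definition surj_operad_hom :: "('a, 'm) operad \<Rightarrow> ('a, 'n) operad \<Rightarrow> ('a set \<Rightarrow> 'm \<Rightarrow> 'n) \<Rightarrow> bool" where
  "surj_operad_hom P Q \<phi> \<longleftrightarrow>
     (\<forall>I. finite I \<longrightarrow> \<phi> I \<in> hom (component P I) (component Q I)) \<and>
     (\<forall>I. finite I \<longrightarrow> \<phi> I ` carrier (component P I) = carrier (component Q I)) \<and>
     (\<forall>i. \<phi> {i} (op_unit P i) = op_unit Q i) \<and>
     (\<forall>I I' \<sigma>. \<forall>x\<in>carrier (component P I). finite I \<longrightarrow> bij_betw \<sigma> I I' \<longrightarrow>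
        \<phi> I' (relabel P \<sigma> x) = relabel Q \<sigma> (\<phi> I x)) \<and>
     (\<forall>J I j. \<forall>x\<in>carrier (component P J). \<forall>y\<in>carrier (component P I). composable J I j \<longrightarrow>
        \<phi> (J - {j} \<union> I) (circ P J I j x y) = circ Q J I j (\<phi> J x) (\<phi> I y))"

lemma composable_finite: "composable J I j \<Longrightarrow> finite J \<and> finite I \<and> finite (J - {j} \<union> I)"
  by (simp add: composable_def)

context operad
begin

lemma relabel_closed:
  "\<lbrakk>finite I; bij_betw \<sigma> I I'; x \<in> carrier (component P I)\<rbrakk> \<Longrightarrow> relabel P \<sigma> x \<in> carrier (component P I')"
  using relabel_hom hom_in_carrier by metis

lemma circ_closed:
  "\<lbrakk>composable J I j; x \<in> carrier (component P J); y \<in> carrier (component P I)\<rbrakk>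
    \<Longrightarrow> circ P J I j x y \<in> carrier (component P (J - {j} \<union> I))"
  using circ_hom_left hom_in_carrier by metis

text \<open>Each axiom is lifted to \<open>P\<close> by choosing preimages and then pushed forward.
  The groups of the target are a separate assumption: \<open>hom\<close> constrains only the product
  and says nothing about the field for the neutral element.\<close>

lemma operad_surj_image:
  assumes h: "surj_operad_hom P Q \<phi>" and Q: "\<And>I. finite I \<Longrightarrow> comm_group (component Q I)"
  shows "operad Q"
proof -
  have hom: "finite I \<Longrightarrow> \<phi> I \<in> hom (component P I) (component Q I)" for I
    using h by (simp add: surj_operad_hom_def)
  have surj: "y \<in> carrier (component Q I) \<Longrightarrow> finite I \<Longrightarrow> \<exists>x\<in>carrier (component P I). y = \<phi> I x" for I y
    using h unfolding surj_operad_hom_def by (metis imageE)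
  have unit: "op_unit Q i = \<phi> {i} (op_unit P i)" for i
    using h by (simp add: surj_operad_hom_def)
  have rel: "finite I \<Longrightarrow> bij_betw \<sigma> I I' \<Longrightarrow> x \<in> carrier (component P I) \<Longrightarrow>
     relabel Q \<sigma> (\<phi> I x) = \<phi> I' (relabel P \<sigma> x)" for I I' \<sigma> x
    using h by (simp add: surj_operad_hom_def)
  have circ: "composable J I j \<Longrightarrow> x \<in> carrier (component P J) \<Longrightarrow> y \<in> carrier (component P I) \<Longrightarrow>
      circ Q J I j (\<phi> J x) (\<phi> I y) = \<phi> (J - {j} \<union> I) (circ P J I j x y)" for J I j x y
    using h by (simp add: surj_operad_hom_def)
  have closed: "finite I \<Longrightarrow> x \<in> carrier (component P I) \<Longrightarrow> \<phi> I x \<in> carrier (component Q I)" for I x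
    using hom hom_in_carrier by metis
  have mult: "finite I \<Longrightarrow> x \<in> carrier (component P I) \<Longrightarrow> y \<in> carrier (component P I) \<Longrightarrow>
     \<phi> I x \<otimes>\<^bsub>component Q I\<^esub> \<phi> I y = \<phi> I (x \<otimes>\<^bsub>component P I\<^esub> y)" for I x y
    using hom hom_mult by metis
  have mcl: "finite I \<Longrightarrow> x \<in> carrier (component P I) \<Longrightarrow> y \<in> carrier (component P I) \<Longrightarrow>
     x \<otimes>\<^bsub>component P I\<^esub> y \<in> carrier (component P I)" for I x y
    using component_group comm_groupE(1) by metis
  show ?thesis
  proof (rule operad.intro)
    show "comm_group (component Q I)" if "finite I" for I using Q that .
    show "op_unit Q i \<in> carrier (component Q {i})" for i
      unfolding unit by (rule closed) (simp_all add: unit_closed)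
    show "relabel Q \<sigma> \<in> hom (component Q I) (component Q I')" if "finite I" "bij_betw \<sigma> I I'" for I I' \<sigma>
    proof (rule homI)
      have f: "finite I'" using that bij_betw_finite by blast
      fix y assume "y \<in> carrier (component Q I)"
      then obtain x where x: "x \<in> carrier (component P I)" "y = \<phi> I x" using surj \<open>finite I\<close> by blast
      then show "relabel Q \<sigma> y \<in> carrier (component Q I')"
        using that f by (simp add: rel closed relabel_closed)
      fix y' assume "y' \<in> carrier (component Q I)"
      then obtain x' where x': "x' \<in> carrier (component P I)" "y' = \<phi> I x'" using surj \<open>finite I\<close> by blast
      then show "relabel Q \<sigma> (y \<otimes>\<^bsub>component Q I\<^esub> y') = relabel Q \<sigma> y \<otimes>\<^bsub>component Q I'\<^esub> relabel Q \<sigma> y'"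
        using that f x by (simp add: rel mult mcl relabel_closed hom_mult[OF relabel_hom])
    qed
    show "relabel Q \<sigma> y = relabel Q \<tau> y"
      if *: "finite I" "inj_on \<sigma> I" "\<And>i. i \<in> I \<Longrightarrow> \<sigma> i = \<tau> i" "y \<in> carrier (component Q I)" for I \<sigma> \<tau> y
    proof -
      obtain x where x: "x \<in> carrier (component P I)" "y = \<phi> I x" using surj * by blast
      have b: "bij_betw \<sigma> I (\<sigma> ` I)" using * by (simp add: bij_betw_def)
      have b': "bij_betw \<tau> I (\<sigma> ` I)" using b * by (simp cong: bij_betw_cong)
      show ?thesis using * x by (simp add: rel[OF _ b] rel[OF _ b'] relabel_cong[of I \<sigma> \<tau> x])
    qed
    show "relabel Q id y = y" if *: "finite I" "y \<in> carrier (component Q I)" for I y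
    proof -
      obtain x where x: "x \<in> carrier (component P I)" "y = \<phi> I x" using surj * by blast
      then show ?thesis using * rel[of I id I x] by (simp add: relabel_id[of I])
    qed
    show "relabel Q (\<tau> \<circ> \<sigma>) y = relabel Q \<tau> (relabel Q \<sigma> y)"
      if *: "finite I" "bij_betw \<sigma> I I'" "bij_betw \<tau> I' I''" "y \<in> carrier (component Q I)" for I I' I'' \<sigma> \<tau> y
    proof -
      obtain x where x: "x \<in> carrier (component P I)" "y = \<phi> I x" using surj * by blast
      have "finite I'" using * bij_betw_finite by blast
      then show ?thesis
        using x * bij_betw_trans[OF *(2,3)] by (simp add: rel relabel_closed relabel_comp[of I \<sigma> I' \<tau> I''])
    qed
    show "relabel Q \<sigma> (op_unit Q i) = op_unit Q (\<sigma> i)" for \<sigma> i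
      unfolding unit using rel[of "{i}" \<sigma> "{\<sigma> i}" "op_unit P i"] by (simp add: unit_closed relabel_unit)
    show "(\<lambda>x. circ Q J I j x y) \<in> hom (component Q J) (component Q (J - {j} \<union> I))"
      if *: "composable J I j" "y \<in> carrier (component Q I)" for J I j y
    proof (rule homI)
      have f: "finite J" "finite I" "finite (J - {j} \<union> I)" using composable_finite[OF *(1)] by auto
      obtain v where v: "v \<in> carrier (component P I)" "y = \<phi> I v" using surj * f by blast
      fix x assume "x \<in> carrier (component Q J)"
      then obtain u where u: "u \<in> carrier (component P J)" "x = \<phi> J u" using surj f by blast
      then show "circ Q J I j x y \<in> carrier (component Q (J - {j} \<union> I))"
        using * v by (simp only: circ closed[OF f(3)] circ_closed)
      fix x' assume "x' \<in> carrier (component Q J)"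
      then obtain u' where u': "u' \<in> carrier (component P J)" "x' = \<phi> J u'" using surj f by blast
      then show "circ Q J I j (x \<otimes>\<^bsub>component Q J\<^esub> x') y = circ Q J I j x y \<otimes>\<^bsub>component Q (J - {j} \<union> I)\<^esub> circ Q J I j x' y"
        using * u v f(1) hom_mult[OF circ_hom_left[OF *(1) v(1)] u(1) u'(1)]
        by (simp only: circ mult[OF f(1)] mult[OF f(3)] mcl circ_closed)
    qed
    show "circ Q J I j x \<in> hom (component Q I) (component Q (J - {j} \<union> I))"
      if *: "composable J I j" "x \<in> carrier (component Q J)" for J I j x
    proof (rule homI)
      have f: "finite J" "finite I" "finite (J - {j} \<union> I)" using composable_finite[OF *(1)] by auto
      obtain u where u: "u \<in> carrier (component P J)" "x = \<phi> J u" using surj * f by blast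
      fix y assume "y \<in> carrier (component Q I)"
      then obtain v where v: "v \<in> carrier (component P I)" "y = \<phi> I v" using surj f by blast
      then show "circ Q J I j x y \<in> carrier (component Q (J - {j} \<union> I))"
        using * u by (simp only: circ closed[OF f(3)] circ_closed)
      fix y' assume "y' \<in> carrier (component Q I)"
      then obtain v' where v': "v' \<in> carrier (component P I)" "y' = \<phi> I v'" using surj f by blast
      then show "circ Q J I j x (y \<otimes>\<^bsub>component Q I\<^esub> y') = circ Q J I j x y \<otimes>\<^bsub>component Q (J - {j} \<union> I)\<^esub> circ Q J I j x y'"
        using * u v f(2) hom_mult[OF circ_hom_right[OF *(1) u(1)] v(1) v'(1)]
        by (simp only: circ mult[OF f(2)] mult[OF f(3)] mcl circ_closed)
    qed
    show "circ Q J' I' (\<sigma> j) (relabel Q \<sigma> x) (relabel Q \<tau> y) = relabel Q (\<lambda>a. if a \<in> I then \<tau> a else \<sigma> a) (circ Q J I j x y)"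
      if *: "composable J I j" "bij_betw \<sigma> J J'" "bij_betw \<tau> I I'" "composable J' I' (\<sigma> j)"
        "x \<in> carrier (component Q J)" "y \<in> carrier (component Q I)" for J I j \<sigma> J' \<tau> I' x y
    proof -
      have f: "finite J" "finite I" "finite (J - {j} \<union> I)" using composable_finite[OF *(1)] by auto
      obtain u where u: "u \<in> carrier (component P J)" "x = \<phi> J u" using surj[OF *(5) f(1)] by blast
      obtain v where v: "v \<in> carrier (component P I)" "y = \<phi> I v" using surj[OF *(6) f(2)] by blast
      \<comment> \<open>Compatibility of \<open>\<phi>\<close> with relabelling is available along
        bijections, so the glued map has to be one.\<close>
      have b: "bij_betw (\<lambda>a. if a \<in> I then \<tau> a else \<sigma> a) (J - {j} \<union> I) (J' - {\<sigma> j} \<union> I')"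
      proof -
        have "bij_betw \<sigma> (J - {j}) (J' - {\<sigma> j})"
        proof (rule bij_betw_DiffI[OF *(2)])
          show "bij_betw \<sigma> {j} {\<sigma> j}" by (simp add: bij_betw_def)
          show "{j} \<subseteq> J" "{\<sigma> j} \<subseteq> J'" using *(1,4) by (simp_all add: composable_def)
        qed
        then have "bij_betw (\<lambda>a. if a \<in> I then \<tau> a else \<sigma> a) (J - {j}) (J' - {\<sigma> j})"
          using *(1) by (subst bij_betw_cong[where g=\<sigma>]) (auto simp: composable_def)
        moreover have "bij_betw (\<lambda>a. if a \<in> I then \<tau> a else \<sigma> a) I I'"
          using *(3) by (simp cong: bij_betw_cong)
        ultimately show ?thesis using *(4) by (intro bij_betw_combine) (auto simp: composable_def)
      qed
      show ?thesis
        using circ_relabel[OF *(1-4) u(1) v(1)] * u v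
        by (simp only: rel[OF f(1)] rel[OF f(2)] rel[OF f(3) b] circ relabel_closed[OF f(1)] relabel_closed[OF f(2)] circ_closed)
    qed
    show "circ Q {j} I j (op_unit Q j) y = y" if *: "finite I" "y \<in> carrier (component Q I)" for I y j
    proof -
      obtain v where v: "v \<in> carrier (component P I)" "y = \<phi> I v" using surj * by blast
      have "composable {j} I j" using * by (simp add: composable_def)
      then show ?thesis
        using v * unit_left[of I v j] circ[of "{j}" I j "op_unit P j" v] by (simp add: unit unit_closed)
    qed
    show "circ Q J {i} j x (op_unit Q i) = relabel Q (id(j := i)) x"
      if *: "composable J {i} j" "x \<in> carrier (component Q J)" for J i j x
    proof -
      have f: "finite J" using composable_finite[OF *(1)] by auto
      obtain u where u: "u \<in> carrier (component P J)" "x = \<phi> J u" using surj * f by blast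
      have b: "bij_betw (id(j := i)) J (J - {j} \<union> {i})"
        using *(1) by (auto simp: composable_def bij_betw_def inj_on_def)
      show ?thesis
        using u * unit_right[OF *(1) u(1)] rel[OF f b u(1)] circ[OF *(1) u(1) unit_closed]
        by (simp add: unit)
    qed
    show "circ Q (J - {j} \<union> I) K i (circ Q J I j x y) z = circ Q J (I - {i} \<union> K) j x (circ Q I K i y z)"
      if *: "composable J I j" "i \<in> I" "composable (J - {j} \<union> I) K i"
        "x \<in> carrier (component Q J)" "y \<in> carrier (component Q I)" "z \<in> carrier (component Q K)" for J I j i K x y z
    proof -
      have f: "finite J" "finite I" "finite K" using composable_finite[OF *(1)] composable_finite[OF *(3)] by auto
      obtain u where u: "u \<in> carrier (component P J)" "x = \<phi> J u" using surj * f by blast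
      obtain v where v: "v \<in> carrier (component P I)" "y = \<phi> I v" using surj * f by blast
      obtain w where w: "w \<in> carrier (component P K)" "z = \<phi> K w" using surj * f by blast
      have c: "composable I K i" "composable J (I - {i} \<union> K) j" "J - {j} \<union> (I - {i} \<union> K) = J - {j} \<union> I - {i} \<union> K"
        using * by (auto simp: composable_def)
      have "circ Q (J - {j} \<union> I) K i (circ Q J I j x y) z = \<phi> (J - {j} \<union> I - {i} \<union> K) (circ P (J - {j} \<union> I) K i (circ P J I j u v) w)"
        using u v w * by (simp only: circ circ_closed)
      also have "\<dots> = \<phi> (J - {j} \<union> (I - {i} \<union> K)) (circ P J (I - {i} \<union> K) j u (circ P I K i v w))"
        using assoc_sequential[OF *(1-3) u(1) v(1) w(1)] c(3) by simp
      also have "\<dots> = circ Q J (I - {i} \<union> K) j x (circ Q I K i y z)"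
        using u v w c(1,2) by (simp only: circ circ_closed)
      finally show ?thesis .
    qed
    show "circ Q (J - {j} \<union> I) K k (circ Q J I j x y) z = circ Q (J - {k} \<union> K) I j (circ Q J K k x z) y"
      if *: "composable J I j" "composable J K k" "j \<noteq> k" "I \<inter> K = {}"
        "x \<in> carrier (component Q J)" "y \<in> carrier (component Q I)" "z \<in> carrier (component Q K)" for J I j k K x y z
    proof -
      have f: "finite J" "finite I" "finite K" using composable_finite[OF *(1)] composable_finite[OF *(2)] by auto
      obtain u where u: "u \<in> carrier (component P J)" "x = \<phi> J u" using surj * f by blast
      obtain v where v: "v \<in> carrier (component P I)" "y = \<phi> I v" using surj * f by blast
      obtain w where w: "w \<in> carrier (component P K)" "z = \<phi> K w" using surj * f by blast
      have c: "composable (J - {j} \<union> I) K k" "composable (J - {k} \<union> K) I j" "J - {k} \<union> K - {j} \<union> I = J - {j} \<union> I - {k} \<union> K"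
        using * by (auto simp: composable_def)
      have "circ Q (J - {j} \<union> I) K k (circ Q J I j x y) z = \<phi> (J - {j} \<union> I - {k} \<union> K) (circ P (J - {j} \<union> I) K k (circ P J I j u v) w)"
        using u v w * c(1) by (simp only: circ circ_closed)
      also have "\<dots> = \<phi> (J - {k} \<union> K - {j} \<union> I) (circ P (J - {k} \<union> K) I j (circ P J K k u w) v)"
        using assoc_parallel[OF *(1-4) u(1) v(1) w(1)] c(3) by simp
      also have "\<dots> = circ Q (J - {k} \<union> K) I j (circ Q J K k x z) y"
        using u v w c(2) * by (simp only: circ circ_closed)
      finally show ?thesis .
    qed
  qed
qed

text \<open>Cosets of the kernel are the fibres of \<open>\<phi>\<close>; composition and
  relabelling of cosets are therefore determined by the images in \<open>Q\<close>.\<close>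

lemma operad_first_isomorphism:
  assumes h: "surj_operad_hom P Q \<phi>" and Q: "\<And>I. finite I \<Longrightarrow> comm_group (component Q I)"
    and N: "\<And>I. finite I \<Longrightarrow> N I = kernel (component P I) (component Q I) (\<phi> I)"
  shows "operad_isomorphic Q (quotient_operad P N)"
proof -
  let ?R = "quotient_operad P N"
  have surj: "y \<in> carrier (component Q I) \<Longrightarrow> finite I \<Longrightarrow> \<exists>x\<in>carrier (component P I). y = \<phi> I x" for I y
    using h unfolding surj_operad_hom_def by (metis imageE)
  have unit: "op_unit Q i = \<phi> {i} (op_unit P i)" for i
    using h by (simp add: surj_operad_hom_def)
  have rel: "finite I \<Longrightarrow> bij_betw \<sigma> I I' \<Longrightarrow> x \<in> carrier (component P I) \<Longrightarrow>
     relabel Q \<sigma> (\<phi> I x) = \<phi> I' (relabel P \<sigma> x)" for I I' \<sigma> x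
    using h by (simp add: surj_operad_hom_def)
  have circ: "composable J I j \<Longrightarrow> x \<in> carrier (component P J) \<Longrightarrow> y \<in> carrier (component P I) \<Longrightarrow>
      circ Q J I j (\<phi> J x) (\<phi> I y) = \<phi> (J - {j} \<union> I) (circ P J I j x y)" for J I j x y
    using h by (simp add: surj_operad_hom_def)
  have gh: "group_hom (component P I) (component Q I) (\<phi> I)" if "finite I" for I
    using h that component_group[OF that] Q[OF that]
    by (intro group_hom.intro) (auto simp: group_hom_axioms_def surj_operad_hom_def comm_group_def)
  have normal: "N I \<lhd> component P I" if "finite I" for I
    using group_hom.normal_kernel[OF gh[OF that]] N[OF that] by simp
  \<comment> \<open>The isomorphism sends an element to its fibre, so no preimage has to be
    chosen.\<close>
  define \<theta> where "\<theta> = (\<lambda>I y. {x \<in> carrier (component P I). \<phi> I x = y})"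
  have coset: "N I #>\<^bsub>component P I\<^esub> x = \<theta> I (\<phi> I x)" if "finite I" "x \<in> carrier (component P I)" for I x
  proof -
    interpret group_hom "component P I" "component Q I" "\<phi> I" using gh that(1) .
    show ?thesis
    proof
      show "N I #>\<^bsub>component P I\<^esub> x \<subseteq> \<theta> I (\<phi> I x)"
        using that by (auto simp: r_coset_def \<theta>_def N kernel_def)
      show "\<theta> I (\<phi> I x) \<subseteq> N I #>\<^bsub>component P I\<^esub> x"
      proof
        fix z assume "z \<in> \<theta> I (\<phi> I x)"
        then have z: "z \<in> carrier (component P I)" "\<phi> I z = \<phi> I x" by (auto simp: \<theta>_def)
        then have "z \<otimes>\<^bsub>component P I\<^esub> inv\<^bsub>component P I\<^esub> x \<in> N I" using that by (simp add: N kernel_def)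
        moreover have "z = z \<otimes>\<^bsub>component P I\<^esub> inv\<^bsub>component P I\<^esub> x \<otimes>\<^bsub>component P I\<^esub> x"
          using z that by (simp add: G.m_assoc)
        ultimately show "z \<in> N I #>\<^bsub>component P I\<^esub> x" unfolding r_coset_def by blast
      qed
    qed
  qed
  have self: "x \<in> \<theta> I (\<phi> I x)" if "x \<in> carrier (component P I)" for I x
    using that by (simp add: \<theta>_def)
  have R_comm: "comm_group (component ?R I)" if "finite I" for I
    using comm_group.abelian_FactGroup[OF component_group[OF that]] normal[OF that] normal_imp_subgroup
    by (auto simp: quotient_operad_def)
  have R_carrier: "carrier (component ?R I) = (\<lambda>x. \<theta> I (\<phi> I x)) ` carrier (component P I)" if "finite I" for I
    using coset[OF that] by (auto simp: quotient_operad_def FactGroup_def RCOSETS_def)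
  have R_mult: "\<theta> I (\<phi> I x) \<otimes>\<^bsub>component ?R I\<^esub> \<theta> I (\<phi> I y) = \<theta> I (\<phi> I (x \<otimes>\<^bsub>component P I\<^esub> y))"
    if "finite I" "x \<in> carrier (component P I)" "y \<in> carrier (component P I)" for I x y
  proof -
    interpret group_hom "component P I" "component Q I" "\<phi> I" using gh that(1) .
    show ?thesis
      using that normal.rcos_sum[OF normal[OF that(1)], of x y]
      by (simp add: quotient_operad_def coset[symmetric] del: hom_mult)
  qed
  have R_unit: "op_unit ?R i = \<theta> {i} (\<phi> {i} (op_unit P i))" for i
    using coset[of "{i}"] unit_closed by (simp add: quotient_operad_def)
  have R_rel: "relabel ?R \<sigma> (\<theta> I (\<phi> I x)) = \<theta> I' (\<phi> I' (relabel P \<sigma> x))"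
    if "finite I" "bij_betw \<sigma> I I'" "x \<in> carrier (component P I)" for I I' \<sigma> x
  proof -
    \<comment> \<open>Relabelling in the quotient is a direct image. That this image fills a whole
      fibre requires preimages of all its elements, and the inverse bijection supplies them.\<close>
    let ?\<tau> = "inv_into I \<sigma>"
    have f: "finite I'" using that bij_betw_finite by blast
    have b: "bij_betw ?\<tau> I' I" using that(2) by (rule bij_betw_inv_into)
    have "z \<in> relabel P \<sigma> ` \<theta> I (\<phi> I x)" if z: "z \<in> \<theta> I' (\<phi> I' (relabel P \<sigma> x))" for z
    proof (rule image_eqI)
      have z: "z \<in> carrier (component P I')" "\<phi> I' z = \<phi> I' (relabel P \<sigma> x)" using z by (auto simp: \<theta>_def)
      have "relabel P \<sigma> (relabel P ?\<tau> z) = relabel P (\<sigma> \<circ> ?\<tau>) z"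
        using relabel_comp[OF f b \<open>bij_betw \<sigma> I I'\<close> z(1)] by simp
      also have "\<dots> = relabel P id z"
        using z f \<open>bij_betw \<sigma> I I'\<close>
        by (intro relabel_cong[OF f]) (auto simp: bij_betw_inv_into_right inj_on_def)
      finally show "z = relabel P \<sigma> (relabel P ?\<tau> z)" using relabel_id[OF f z(1)] by simp
      have "relabel P ?\<tau> (relabel P \<sigma> x) = relabel P (?\<tau> \<circ> \<sigma>) x"
        using relabel_comp[OF \<open>finite I\<close> \<open>bij_betw \<sigma> I I'\<close> b \<open>x \<in> _\<close>] by simp
      also have "\<dots> = relabel P id x"
        using \<open>bij_betw \<sigma> I I'\<close> \<open>x \<in> _\<close>
        by (intro relabel_cong[OF \<open>finite I\<close>]) (auto simp: bij_betw_inv_into_left inj_on_def)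
      finally have x: "relabel P ?\<tau> (relabel P \<sigma> x) = x" using relabel_id[OF \<open>finite I\<close> \<open>x \<in> _\<close>] by simp
      have "\<phi> I (relabel P ?\<tau> z) = \<phi> I (relabel P ?\<tau> (relabel P \<sigma> x))"
        using rel[OF f b z(1)] rel[OF f b relabel_closed[OF \<open>finite I\<close> \<open>bij_betw \<sigma> I I'\<close> \<open>x \<in> _\<close>]] z(2) by simp
      then show "relabel P ?\<tau> z \<in> \<theta> I (\<phi> I x)"
        using x relabel_closed[OF f b z(1)] by (simp add: \<theta>_def)
    qed
    moreover have "relabel P \<sigma> z \<in> \<theta> I' (\<phi> I' (relabel P \<sigma> x))" if "z \<in> \<theta> I (\<phi> I x)" for z
      using that \<open>x \<in> _\<close> rel[OF \<open>finite I\<close> \<open>bij_betw \<sigma> I I'\<close>] relabel_closed[OF \<open>finite I\<close> \<open>bij_betw \<sigma> I I'\<close>]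
      by (auto simp: \<theta>_def) metis
    ultimately show ?thesis by (auto simp: quotient_operad_def)
  qed
  have R_circ: "circ ?R J I j (\<theta> J (\<phi> J x)) (\<theta> I (\<phi> I y)) = \<theta> (J - {j} \<union> I) (\<phi> (J - {j} \<union> I) (circ P J I j x y))"
    if "composable J I j" "x \<in> carrier (component P J)" "y \<in> carrier (component P I)" for J I j x y
  proof -
    have "N (J - {j} \<union> I) #>\<^bsub>component P (J - {j} \<union> I)\<^esub> circ P J I j x' y' = \<theta> (J - {j} \<union> I) (\<phi> (J - {j} \<union> I) (circ P J I j x y))"
      if "x' \<in> \<theta> J (\<phi> J x)" "y' \<in> \<theta> I (\<phi> I y)" for x' y'
      using that \<open>composable J I j\<close> \<open>x \<in> _\<close> \<open>y \<in> _\<close> composable_finite[of J I j] circ_closed[of J I j x' y']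
      by (simp add: \<theta>_def coset circ[symmetric])
    then have "circ ?R J I j (\<theta> J (\<phi> J x)) (\<theta> I (\<phi> I y))
      = (\<Union>x'\<in>\<theta> J (\<phi> J x). \<Union>y'\<in>\<theta> I (\<phi> I y). \<theta> (J - {j} \<union> I) (\<phi> (J - {j} \<union> I) (circ P J I j x y)))"
      by (simp add: quotient_operad_def)
    \<comment> \<open>All members of the union are the same coset, and the index sets are nonempty
      fibres.\<close>
    then show ?thesis using self[OF that(2)] self[OF that(3)] by auto
  qed
  \<comment> \<open>The quotient is a surjective image of \<open>P\<close> too, so its axioms follow
    by the same transport.\<close>
  have R_hom: "surj_operad_hom P ?R (\<lambda>I x. \<theta> I (\<phi> I x))"
    unfolding surj_operad_hom_def
    by (intro conjI allI ballI impI homI) (simp_all add: R_carrier R_mult R_unit R_rel R_circ)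
  have "\<theta> \<in> operad_iso Q ?R"
    unfolding operad_iso_def mem_Collect_eq
  proof (intro conjI allI ballI impI)
    fix I :: "'a set" assume f: "finite I"
    interpret group_hom "component P I" "component Q I" "\<phi> I" using gh f .
    show "\<theta> I \<in> iso (component Q I) (component ?R I)"
      unfolding iso_def mem_Collect_eq
    proof (intro conjI homI)
      fix y assume "y \<in> carrier (component Q I)"
      then obtain x where x: "x \<in> carrier (component P I)" "y = \<phi> I x" using surj f by blast
      then show "\<theta> I y \<in> carrier (component ?R I)" using R_carrier f by auto
      fix y' assume "y' \<in> carrier (component Q I)"
      then obtain x' where x': "x' \<in> carrier (component P I)" "y' = \<phi> I x'" using surj f by blast
      show "\<theta> I (y \<otimes>\<^bsub>component Q I\<^esub> y') = \<theta> I y \<otimes>\<^bsub>component ?R I\<^esub> \<theta> I y'"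
        using R_mult[OF f x(1) x'(1)] x x' by simp
    next
      show "bij_betw (\<theta> I) (carrier (component Q I)) (carrier (component ?R I))"
        unfolding bij_betw_def
      proof
        show "inj_on (\<theta> I) (carrier (component Q I))"
        proof (rule inj_onI)
          fix y y' assume y: "y \<in> carrier (component Q I)" "\<theta> I y = \<theta> I y'"
          then obtain x where "x \<in> carrier (component P I)" "y = \<phi> I x" using surj f by blast
          then show "y = y'" using self y by (auto simp: \<theta>_def)
        qed
        show "\<theta> I ` carrier (component Q I) = carrier (component ?R I)"
          using surj[of _ I] f by (auto simp: R_carrier)
      qed
    qed
  next
    show "\<theta> {i} (op_unit Q i) = op_unit ?R i" for i by (simp add: R_unit unit)
  next
    fix I I' :: "'a set" and \<sigma> y assume *: "finite I" "bij_betw \<sigma> I I'" "y \<in> carrier (component Q I)"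
    then obtain x where "x \<in> carrier (component P I)" "y = \<phi> I x" using surj by blast
    then show "\<theta> I' (relabel Q \<sigma> y) = relabel ?R \<sigma> (\<theta> I y)" using * by (simp add: R_rel rel)
  next
    fix J I :: "'a set" and j x y assume *: "composable J I j" "x \<in> carrier (component Q J)" "y \<in> carrier (component Q I)"
    then obtain u v where "u \<in> carrier (component P J)" "x = \<phi> J u" "v \<in> carrier (component P I)" "y = \<phi> I v"
      using surj composable_finite by metis
    then show "\<theta> (J - {j} \<union> I) (circ Q J I j x y) = circ ?R J I j (\<theta> J x) (\<theta> I y)"
      using * by (simp add: R_circ circ)
  qed
  moreover have "operad Q" using operad_surj_image[OF h Q] .
  moreover have "operad ?R" using operad_surj_image[OF R_hom R_comm] .
  ultimately show ?thesis by (auto simp: operad_isomorphic_def)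
qed

end

section \<open>The free operad\<close>

lemma frag_extend_fun_0: "frag_extend (\<lambda>t. 0) x = 0"
  by (simp add: frag_extend_eq_0)

lemma frag_extend_fun_add: "frag_extend (\<lambda>t. f t + g t) x = frag_extend f x + frag_extend g x"
  by (simp add: frag_extend_def frag_cmul_distrib2 sum.distrib)

lemma frag_cmul_diff_distrib2: "frag_cmul c (a - b) = frag_cmul c a - frag_cmul c b"
  by (metis add_diff_cancel diff_add_cancel frag_cmul_distrib2)

lemma frag_extend_fun_diff: "frag_extend (\<lambda>t. f t - g t) x = frag_extend f x - frag_extend g x"
  by (simp add: frag_extend_def frag_cmul_diff_distrib2 sum_subtractf)

lemma frag_extend_sum_list: "frag_extend f (\<Sum>x\<leftarrow>xs. g x) = (\<Sum>x\<leftarrow>xs. frag_extend f (g x))"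
  by (induction xs) (simp_all add: frag_extend_add)

lemma keys_sum_list: "(\<And>x. x \<in> set xs \<Longrightarrow> Poly_Mapping.keys (f x) \<subseteq> S) \<Longrightarrow> Poly_Mapping.keys (\<Sum>x\<leftarrow>xs. f x) \<subseteq> S"
  by (induction xs) (auto dest!: subsetD[OF keys_add])

text \<open>The form of \<open>circ\<close> in a linear operad in which two basis elements compose
  to a single basis element.\<close>

definition frag_map2 :: "('b \<Rightarrow> 'c \<Rightarrow> 'd) \<Rightarrow> ('b \<Rightarrow>\<^sub>0 int) \<Rightarrow> ('c \<Rightarrow>\<^sub>0 int) \<Rightarrow> ('d \<Rightarrow>\<^sub>0 int)" where
  "frag_map2 k x y = frag_extend (\<lambda>t. frag_extend (\<lambda>s. frag_of (k t s)) y) x"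

lemma frag_map2_simps [simp]:
  "frag_map2 k 0 y = 0" "frag_map2 k x 0 = 0"
  "frag_map2 k (x - x') y = frag_map2 k x y - frag_map2 k x' y"
  "frag_map2 k x (y - y') = frag_map2 k x y - frag_map2 k x y'"
  "frag_map2 k (frag_of t) (frag_of s) = frag_of (k t s)"
  by (simp_all add: frag_map2_def frag_extend_diff frag_extend_fun_diff frag_extend_fun_0)

lemma frag_map2_add:
  "frag_map2 k (x + x') y = frag_map2 k x y + frag_map2 k x' y"
  "frag_map2 k x (y + y') = frag_map2 k x y + frag_map2 k x y'"
  by (simp_all add: frag_map2_def frag_extend_add frag_extend_fun_add)

lemma keys_frag_map2:
  assumes "Poly_Mapping.keys x \<subseteq> A" "Poly_Mapping.keys y \<subseteq> B" "\<And>t s. t \<in> A \<Longrightarrow> s \<in> B \<Longrightarrow> k t s \<in> C"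
  shows "Poly_Mapping.keys (frag_map2 k x y) \<subseteq> C"
proof -
  have "Poly_Mapping.keys (frag_extend (\<lambda>s. frag_of (k t s)) y) \<subseteq> C" if "t \<in> A" for t
    using keys_frag_extend[of "\<lambda>s. frag_of (k t s)" y] assms(2,3) that by (force simp: keys_frag_of)
  then show ?thesis
    unfolding frag_map2_def using keys_frag_extend[of "\<lambda>t. frag_extend (\<lambda>s. frag_of (k t s)) y" x] assms(1) by blast
qed

lemma keys_frag_extend_frag_of:
  assumes "Poly_Mapping.keys x \<subseteq> A" "\<And>t. t \<in> A \<Longrightarrow> k t \<in> C"
  shows "Poly_Mapping.keys (frag_extend (\<lambda>t. frag_of (k t)) x) \<subseteq> C"
  using keys_frag_extend[of "\<lambda>t. frag_of (k t)" x] assms by (force simp: keys_frag_of)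

text \<open>The hypotheses are the axioms of an operad in sets.\<close>

lemma operad_linear_operad:
  fixes B :: "'a set \<Rightarrow> 'b set" and k :: "'a \<Rightarrow> 'b \<Rightarrow> 'b \<Rightarrow> 'b"
  assumes u: "\<And>i. u i \<in> B {i}"
    and r: "\<And>I I' \<sigma> t. \<lbrakk>finite I; bij_betw \<sigma> I I'; t \<in> B I\<rbrakk> \<Longrightarrow> r \<sigma> t \<in> B I'"
    and r_cong: "\<And>I \<sigma> \<tau> t. \<lbrakk>finite I; inj_on \<sigma> I; \<And>i. i \<in> I \<Longrightarrow> \<sigma> i = \<tau> i; t \<in> B I\<rbrakk> \<Longrightarrow> r \<sigma> t = r \<tau> t"
    and r_id: "\<And>I t. t \<in> B I \<Longrightarrow> r id t = t"
    and r_comp: "\<And>I \<sigma> \<tau> t. t \<in> B I \<Longrightarrow> r (\<tau> \<circ> \<sigma>) t = r \<tau> (r \<sigma> t)"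
    and r_u: "\<And>\<sigma> i. r \<sigma> (u i) = u (\<sigma> i)"
    and k: "\<And>J I j t s. \<lbrakk>composable J I j; t \<in> B J; s \<in> B I\<rbrakk> \<Longrightarrow> k j t s \<in> B (J - {j} \<union> I)"
    and k_r: "\<And>J I j J' I' \<sigma> \<tau> t s. \<lbrakk>composable J I j; bij_betw \<sigma> J J'; bij_betw \<tau> I I'; composable J' I' (\<sigma> j);
        t \<in> B J; s \<in> B I\<rbrakk> \<Longrightarrow> k (\<sigma> j) (r \<sigma> t) (r \<tau> s) = r (\<lambda>a. if a \<in> I then \<tau> a else \<sigma> a) (k j t s)"
    and k_u: "\<And>j s. k j (u j) s = s"
    and u_k: "\<And>J j i t. \<lbrakk>composable J {i} j; t \<in> B J\<rbrakk> \<Longrightarrow> k j t (u i) = r (id(j := i)) t"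
    and seq: "\<And>J I K j i t s v. \<lbrakk>composable J I j; i \<in> I; composable (J - {j} \<union> I) K i; t \<in> B J; s \<in> B I; v \<in> B K\<rbrakk> \<Longrightarrow>
      k i (k j t s) v = k j t (k i s v)"
    and par: "\<And>J I K j l t s v. \<lbrakk>composable J I j; composable J K l; j \<noteq> l; I \<inter> K = {}; t \<in> B J; s \<in> B I; v \<in> B K\<rbrakk> \<Longrightarrow>
      k l (k j t s) v = k j (k l t v) s"
  shows "operad (linear_operad B u r (\<lambda>j t s. frag_of (k j t s)))"
proof -
  have circ: "circ (linear_operad B u r (\<lambda>j t s. frag_of (k j t s))) = (\<lambda>J I j. frag_map2 (k j))"
    by (simp add: linear_operad_def frag_map2_def fun_eq_iff)
  have comps: "component (linear_operad B u r (\<lambda>j t s. frag_of (k j t s))) = (\<lambda>I. free_Abelian_group (B I))"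
    "op_unit (linear_operad B u r (\<lambda>j t s. frag_of (k j t s))) = (\<lambda>i. frag_of (u i))"
    "relabel (linear_operad B u r (\<lambda>j t s. frag_of (k j t s))) = (\<lambda>\<sigma>. frag_extend (\<lambda>t. frag_of (r \<sigma> t)))"
    by (simp_all add: linear_operad_def)
  show ?thesis
  proof (rule operad.intro; unfold circ comps)
    show "comm_group (free_Abelian_group (B I))" for I by (rule abelian_free_Abelian_group)
    show "frag_of (u i) \<in> carrier (free_Abelian_group (B {i}))" for i
      using u by simp
    show "frag_extend (\<lambda>t. frag_of (r \<sigma> t)) \<in> hom (free_Abelian_group (B I)) (free_Abelian_group (B I'))"
      if "finite I" "bij_betw \<sigma> I I'" for I I' \<sigma>
      using r[OF that] by (intro homI) (simp_all add: frag_extend_add keys_frag_extend_frag_of[of _ "B I"])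
    show "frag_extend (\<lambda>t. frag_of (r \<sigma> t)) x = frag_extend (\<lambda>t. frag_of (r \<tau> t)) x"
      if "finite I" "inj_on \<sigma> I" "\<And>i. i \<in> I \<Longrightarrow> \<sigma> i = \<tau> i" "x \<in> carrier (free_Abelian_group (B I))" for I \<sigma> \<tau> x
    proof (rule frag_extend_eq)
      fix t assume "t \<in> Poly_Mapping.keys x"
      then have "t \<in> B I" using that(4) by auto
      then show "frag_of (r \<sigma> t) = frag_of (r \<tau> t)" using r_cong[OF that(1-3)] by simp
    qed
    show "frag_extend (\<lambda>t. frag_of (r id t)) x = x" if "x \<in> carrier (free_Abelian_group (B I))" for I x
    proof -
      have "Poly_Mapping.keys x \<subseteq> B I" using that by simp
      then show ?thesis by (induction rule: frag_induction) (simp_all add: r_id[unfolded id_def] id_def frag_extend_diff)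
    qed
    show "frag_extend (\<lambda>t. frag_of (r (\<tau> \<circ> \<sigma>) t)) x = frag_extend (\<lambda>t. frag_of (r \<tau> t)) (frag_extend (\<lambda>t. frag_of (r \<sigma> t)) x)"
      if "x \<in> carrier (free_Abelian_group (B I))" for I \<sigma> \<tau> x
    proof -
      have "Poly_Mapping.keys x \<subseteq> B I" using that by simp
      then show ?thesis by (induction rule: frag_induction) (simp_all add: r_comp[unfolded o_def] o_def frag_extend_diff)
    qed
    show "frag_extend (\<lambda>t. frag_of (r \<sigma> t)) (frag_of (u i)) = frag_of (u (\<sigma> i))" for \<sigma> i
      by (simp add: r_u)
    show "(\<lambda>x. frag_map2 (k j) x y) \<in> hom (free_Abelian_group (B J)) (free_Abelian_group (B (J - {j} \<union> I)))"
      if "composable J I j" "y \<in> carrier (free_Abelian_group (B I))" for J I j y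
      using that k[OF that(1)] by (intro homI) (simp_all add: frag_map2_add keys_frag_map2[of _ "B J" _ "B I"])
    show "frag_map2 (k j) x \<in> hom (free_Abelian_group (B I)) (free_Abelian_group (B (J - {j} \<union> I)))"
      if "composable J I j" "x \<in> carrier (free_Abelian_group (B J))" for J I j x
      using that k[OF that(1)] by (intro homI) (simp_all add: frag_map2_add keys_frag_map2[of _ "B J" _ "B I"])
    show "frag_map2 (k (\<sigma> j)) (frag_extend (\<lambda>t. frag_of (r \<sigma> t)) x) (frag_extend (\<lambda>t. frag_of (r \<tau> t)) y)
        = frag_extend (\<lambda>t. frag_of (r (\<lambda>a. if a \<in> I then \<tau> a else \<sigma> a) t)) (frag_map2 (k j) x y)"
      if *: "composable J I j" "bij_betw \<sigma> J J'" "bij_betw \<tau> I I'" "composable J' I' (\<sigma> j)"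
        and "x \<in> carrier (free_Abelian_group (B J))" "y \<in> carrier (free_Abelian_group (B I))" for J I j \<sigma> J' \<tau> I' x y
    proof -
      have "Poly_Mapping.keys x \<subseteq> B J" "Poly_Mapping.keys y \<subseteq> B I" using that by simp_all
      then show ?thesis
      \<comment> \<open>Both sides are additive in each argument, so basis elements suffice; the
        conditions on the supports keep these in \<open>B J\<close> and \<open>B I\<close>.\<close>
      proof (induction x rule: frag_induction)
        case (one t)
        from one(2) show ?case
          by (induction y rule: frag_induction) (simp_all add: k_r[OF * one(1)] frag_extend_diff)
      qed (simp_all add: frag_extend_diff)
    qed
    show "frag_map2 (k j) (frag_of (u j)) y = y" for y j
      by (induction y rule: frag_induction[OF subset_UNIV]) (simp_all add: k_u)
    show "frag_map2 (k j) x (frag_of (u i)) = frag_extend (\<lambda>t. frag_of (r (id(j := i)) t)) x"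
      if *: "composable J {i} j" and "x \<in> carrier (free_Abelian_group (B J))" for J i j x
    proof -
      have "Poly_Mapping.keys x \<subseteq> B J" using that by simp
      then show ?thesis by (induction rule: frag_induction) (simp_all add: u_k[OF *, unfolded fun_upd_def id_def] fun_upd_def id_def frag_extend_diff)
    qed
    show "frag_map2 (k i) (frag_map2 (k j) x y) z = frag_map2 (k j) x (frag_map2 (k i) y z)"
      if *: "composable J I j" "i \<in> I" "composable (J - {j} \<union> I) K i"
        and "x \<in> carrier (free_Abelian_group (B J))" "y \<in> carrier (free_Abelian_group (B I))"
        "z \<in> carrier (free_Abelian_group (B K))" for J I j i K x y z
    proof -
      have "Poly_Mapping.keys x \<subseteq> B J" "Poly_Mapping.keys y \<subseteq> B I" "Poly_Mapping.keys z \<subseteq> B K" using that by simp_all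
      then show ?thesis
      proof (induction x rule: frag_induction)
        case (one t)
        from one(2,3) show ?case
        proof (induction y rule: frag_induction)
          case (one s)
          from one(2) show ?case
            by (induction z rule: frag_induction) (simp_all add: seq[OF * \<open>t \<in> B J\<close> one(1)])
        qed simp_all
      qed simp_all
    qed
    show "frag_map2 (k l) (frag_map2 (k j) x y) z = frag_map2 (k j) (frag_map2 (k l) x z) y"
      if *: "composable J I j" "composable J K l" "j \<noteq> l" "I \<inter> K = {}"
        and "x \<in> carrier (free_Abelian_group (B J))" "y \<in> carrier (free_Abelian_group (B I))"
        "z \<in> carrier (free_Abelian_group (B K))" for J I j l K x y z
    proof -
      have "Poly_Mapping.keys x \<subseteq> B J" "Poly_Mapping.keys y \<subseteq> B I" "Poly_Mapping.keys z \<subseteq> B K" using that by simp_all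
      then show ?thesis
      proof (induction x rule: frag_induction)
        case (one t)
        from one(2,3) show ?case
        proof (induction y rule: frag_induction)
          case (one s)
          from one(2) show ?case
            by (induction z rule: frag_induction) (simp_all add: par[OF * \<open>t \<in> B J\<close> one(1)])
        qed simp_all
      qed simp_all
    qed
  qed
qed

section \<open>Substitution of tree monomials\<close>

lemma set_variables_subst_all: "set (variables (subst_all \<sigma> t)) = (\<Union>i\<in>set (variables t). set (variables (\<sigma> i)))"
  by (simp add: variables_subst_all)

lemma distinct_variables_subst_all:
  assumes "distinct (variables t)" "\<And>i. i \<in> set (variables t) \<Longrightarrow> distinct (variables (\<sigma> i))"
    "\<And>i i'. \<lbrakk>i \<in> set (variables t); i' \<in> set (variables t); i \<noteq> i'\<rbrakk> \<Longrightarrow> set (variables (\<sigma> i)) \<inter> set (variables (\<sigma> i')) = {}"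
  shows "distinct (variables (subst_all \<sigma> t))"
proof -
  have "distinct (concat (map (variables \<circ> \<sigma>) xs))"
    if "distinct xs" "set xs \<subseteq> set (variables t)" for xs
    using that
  proof (induction xs)
    case (Cons x xs)
    then show ?case using assms(2)[of x] assms(3)[of x] by (simp add: disjoint_iff) blast
  qed simp
  then show ?thesis using assms(1) by (simp add: variables_subst_all)
qed

lemma substitute_tree_monomials:
  assumes "composable J I j" "t \<in> tree_monomials G ar J" "s \<in> tree_monomials G ar I"
  shows "substitute j t s \<in> tree_monomials G ar (J - {j} \<union> I)"
proof -
  have t: "well_formed G ar t" "distinct (variables t)" "set (variables t) = J"
    and s: "well_formed G ar s" "distinct (variables s)" "set (variables s) = I"
    and j: "j \<in> J" "(J - {j}) \<inter> I = {}"
    using assms by (auto simp: tree_monomials_def composable_def)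
  have "well_formed G ar (substitute j t s)"
    unfolding substitute_eq_subst_all using t s by (intro well_formed_subst_all) auto
  moreover have "distinct (variables (substitute j t s))"
    unfolding substitute_eq_subst_all using t s j by (intro distinct_variables_subst_all) auto
  moreover have "set (variables (substitute j t s)) = J - {j} \<union> I"
    unfolding substitute_eq_subst_all using t s j by (auto simp: set_variables_subst_all split: if_splits)
  ultimately show ?thesis by (simp add: tree_monomials_def)
qed

text \<open>Written with \<open>subst_all\<close>, the two sides of a composition axiom are
  simultaneous substitutions in the same monomial, so they need only agree on its variables. The
  disjointness contained in \<open>composable\<close> gives this agreement.\<close>

lemma operad_free_operad: "operad (free_operad G ar :: ('a, ('g, 'a) monomial \<Rightarrow>\<^sub>0 int) operad)"
  unfolding free_operad_def
proof (rule operad_linear_operad)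
  fix J I K J' I' :: "'a set" and i j l :: 'a and t s v :: "('g, 'a) monomial" and \<sigma> \<tau> :: "'a \<Rightarrow> 'a"
  let ?B = "tree_monomials G ar :: 'a set \<Rightarrow> ('g, 'a) monomial set"
  show "Var i \<in> ?B {i}" by (simp add: tree_monomials_def)
  show "map_monomial id \<sigma> t \<in> ?B I'" if "bij_betw \<sigma> I I'" "t \<in> ?B I"
    using that unfolding tree_monomials_def map_monomial_eq_subst_all bij_betw_def
    by (auto simp: set_variables_subst_all intro!: well_formed_subst_all distinct_variables_subst_all dest: inj_onD)
  show "map_monomial id \<sigma> t = map_monomial id \<tau> t" if "\<And>i. i \<in> I \<Longrightarrow> \<sigma> i = \<tau> i" "t \<in> ?B I"
    using that unfolding map_monomial_eq_subst_all by (intro subst_all_cong) (auto simp: tree_monomials_def)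
  show "map_monomial id id t = t" by (rule monomial.map_id)
  show "map_monomial id (\<tau> \<circ> \<sigma>) t = map_monomial id \<tau> (map_monomial id \<sigma> t)"
    by (simp add: monomial.map_comp)
  show "map_monomial id \<sigma> (Var i) = Var (\<sigma> i)" by simp
  show "substitute j t s \<in> ?B (J - {j} \<union> I)" if "composable J I j" "t \<in> ?B J" "s \<in> ?B I"
    using that by (rule substitute_tree_monomials)
  show "substitute (\<sigma> j) (map_monomial id \<sigma> t) (map_monomial id \<tau> s)
      = map_monomial id (\<lambda>a. if a \<in> I then \<tau> a else \<sigma> a) (substitute j t s)"
    if "composable J I j" "bij_betw \<sigma> J J'" "t \<in> ?B J" "s \<in> ?B I"
  proof -
    have "\<sigma> a \<noteq> \<sigma> j" "a \<notin> I" if "a \<in> J" "a \<noteq> j" for a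
      using that \<open>bij_betw \<sigma> J J'\<close> \<open>composable J I j\<close> by (auto simp: composable_def bij_betw_def dest: inj_onD)
    then show ?thesis using that(3,4)
      unfolding substitute_eq_subst_all map_monomial_eq_subst_all subst_all_subst_all tree_monomials_def
      by (auto intro!: subst_all_cong)
  qed
  show "substitute j (Var j) s = s" by simp
  show "substitute j t (Var i) = map_monomial id (id(j := i)) t"
    unfolding substitute_eq_subst_all map_monomial_eq_subst_all by (intro subst_all_cong) auto
  show "substitute i (substitute j t s) v = substitute j t (substitute i s v)"
    if "composable J I j" "i \<in> I" "t \<in> ?B J"
  proof -
    have "a \<noteq> i" if "a \<in> J" "a \<noteq> j" for a
      using that \<open>composable J I j\<close> \<open>i \<in> I\<close> by (auto simp: composable_def)
    then show ?thesis using that(3)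
      unfolding substitute_eq_subst_all subst_all_subst_all tree_monomials_def
      by (auto intro!: subst_all_cong)
  qed
  show "substitute l (substitute j t s) v = substitute j (substitute l t v) s"
    if "composable J I j" "composable J K l" "j \<noteq> l" "s \<in> ?B I" "v \<in> ?B K"
  proof -
    have "l \<notin> I" "j \<notin> K" using that by (auto simp: composable_def)
    then have "substitute l s v = s" "substitute j v s = v"
      using that(4,5) unfolding substitute_eq_subst_all tree_monomials_def
      by (auto intro!: trans[OF subst_all_cong subst_all_Var])
    with that(3) show ?thesis
      unfolding substitute_eq_subst_all subst_all_subst_all by (intro subst_all_cong) auto
  qed
qed

section \<open>Evaluation of tree monomials\<close>

definition evaluate :: "(('g, 'a) monomial \<Rightarrow>\<^sub>0 int) \<Rightarrow> ('a ptree \<Rightarrow>\<^sub>0 int)" where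
  "evaluate = frag_extend (\<lambda>t. \<Sum>w\<leftarrow>eval_monomial t. frag_of w)"

lemma evaluate_frag_of: "evaluate (frag_of t) = (\<Sum>w\<leftarrow>eval_monomial t. frag_of w)"
  by (simp add: evaluate_def)

lemma evaluate_linear:
  "evaluate 0 = 0" "evaluate (x + y) = evaluate x + evaluate y" "evaluate (x - y) = evaluate x - evaluate y"
  by (simp_all add: evaluate_def frag_extend_add frag_extend_diff)

lemma evaluate_sum_list: "evaluate (\<Sum>x\<leftarrow>xs. f x) = (\<Sum>x\<leftarrow>xs. evaluate (f x))"
  by (simp add: evaluate_def frag_extend_sum_list)

lemma eval_monomial_planar_trees:
  assumes "t \<in> tree_monomials G ar I" "w \<in> set (eval_monomial t)"
  shows "w \<in> planar_trees I"
proof -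
  have "mset (vertices w) = mset (variables t)" using assms(2) by (rule mset_vertices_eval_monomial)
  then show ?thesis
    using assms(1) by (auto simp: tree_monomials_def planar_trees_def dest: mset_eq_setD mset_eq_imp_distinct_iff)
qed

lemma keys_evaluate:
  assumes "Poly_Mapping.keys x \<subseteq> tree_monomials G ar I"
  shows "Poly_Mapping.keys (evaluate x) \<subseteq> planar_trees I"
proof -
  have "Poly_Mapping.keys (\<Sum>w\<leftarrow>eval_monomial t. frag_of w) \<subseteq> planar_trees I" if "t \<in> tree_monomials G ar I" for t
    using eval_monomial_planar_trees[OF that] by (intro keys_sum_list) (auto simp: keys_frag_of)
  then show ?thesis
    unfolding evaluate_def using keys_frag_extend[of "\<lambda>t. \<Sum>w\<leftarrow>eval_monomial t. frag_of w" x] assms by blast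
qed

lemma evaluate_relabel:
  "evaluate (frag_extend (\<lambda>t. frag_of (map_monomial id \<sigma> t)) x) = frag_extend (\<lambda>t. frag_of (map_ptree \<sigma> t)) (evaluate x)"
proof (induction x rule: frag_induction[OF subset_UNIV])
  case (2 t)
  show ?case
    unfolding frag_extend_of evaluate_frag_of map_monomial_eq_subst_all eval_monomial_subst_all
    by (simp add: graft_all_leaves frag_extend_sum_list)
qed (simp_all add: evaluate_linear frag_extend_diff)

text \<open>Here composition defined by grafting maps meets evaluation: the value of a composite is
  a simultaneous substitution, and the trees involved have distinct labels because no variable of a
  tree monomial is repeated.\<close>

lemma evaluate_substitute:
  assumes "t \<in> tree_monomials G ar J" "s \<in> tree_monomials G ar I" "j \<in> J"
  shows "evaluate (frag_of (substitute j t s)) = (\<Sum>T\<leftarrow>eval_monomial t. \<Sum>S\<leftarrow>eval_monomial s. ape_circ j T S)"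
proof -
  have "evaluate (frag_of (substitute j t s)) =
     (\<Sum>T\<leftarrow>eval_monomial t. \<Sum>w\<leftarrow>graft_all (\<lambda>i. if i = j then eval_monomial s else [Node i []]) T. frag_of w)"
    unfolding evaluate_frag_of substitute_eq_subst_all eval_monomial_subst_all by (simp add: fun_upd_def if_distrib cong: if_cong)
  also have "\<dots> = (\<Sum>T\<leftarrow>eval_monomial t. \<Sum>S\<leftarrow>eval_monomial s. ape_circ j T S)"
    unfolding ape_circ_def
  proof (intro sum_list_cong sum_grafting_maps)
    fix T assume "T \<in> set (eval_monomial t)"
    then have "T \<in> planar_trees J" using eval_monomial_planar_trees assms(1) by blast
    then show "distinct (vertices T)" "j \<in> set (vertices T)" using assms(3) by (simp_all add: planar_trees_def)
    fix S assume "S \<in> set (eval_monomial s)"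
    then have "S \<in> planar_trees I" using eval_monomial_planar_trees assms(2) by blast
    then show "distinct (vertices S)" by (simp add: planar_trees_def)
  qed
  finally show ?thesis .
qed

lemma evaluate_circ:
  assumes "Poly_Mapping.keys x \<subseteq> tree_monomials G ar J" "Poly_Mapping.keys y \<subseteq> tree_monomials G ar I" "j \<in> J"
  shows "evaluate (frag_map2 (substitute j) x y)
    = frag_extend (\<lambda>T. frag_extend (\<lambda>S. ape_circ j T S) (evaluate y)) (evaluate x)"
  using assms(1)
proof (induction x rule: frag_induction)
  case (one t)
  from assms(2) show ?case
  proof (induction y rule: frag_induction)
    case (one s)
    show ?case
      using evaluate_substitute[OF \<open>t \<in> _\<close> one assms(3)]
      by (simp add: evaluate_frag_of frag_extend_sum_list)
  qed (simp_all add: evaluate_linear frag_extend_fun_0 frag_extend_fun_diff frag_extend_diff)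
qed (simp_all add: evaluate_linear frag_extend_diff)

section \<open>Brace monomials and normal forms\<close>

text \<open>Kept folded, since the simplifier rewrites the arguments \<open>{1..}\<close> and \<open>\<lambda>n. n + 1\<close>.\<close>

definition brace_well_formed :: "(nat, 'a) monomial \<Rightarrow> bool" where
  "brace_well_formed = well_formed {1..} (\<lambda>n. n + 1)"

definition brace_monomials :: "'a set \<Rightarrow> (nat, 'a) monomial set" where
  "brace_monomials = tree_monomials {1..} (\<lambda>n. n + 1)"

lemma brace_monomials_iff:
  "t \<in> brace_monomials I \<longleftrightarrow> brace_well_formed t \<and> distinct (variables t) \<and> set (variables t) = I"
  by (simp add: brace_monomials_def tree_monomials_def brace_well_formed_def)

lemma brace_well_formed_simps [simp]:
  "brace_well_formed (Var i)"
  "brace_well_formed (Op n ts) \<longleftrightarrow> n \<ge> 1 \<and> length ts = n + 1 \<and> (\<forall>t\<in>set ts. brace_well_formed t)"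
  by (auto simp: brace_well_formed_def list_all_iff)

primrec normal_form :: "'a ptree \<Rightarrow> (nat, 'a) monomial" where
  "normal_form (Node r ts) = brace (Var r) (map normal_form ts)"

lemma variables_brace: "variables (brace z xs) = concat (map variables (z # xs))"
  by (simp add: brace_def)

lemma well_formed_brace:
  "brace_well_formed (brace z xs) \<longleftrightarrow>
    brace_well_formed z \<and> (\<forall>x\<in>set xs. brace_well_formed x)"
  by (auto simp: brace_def Suc_le_eq)

lemma variables_normal_form: "variables (normal_form T) = vertices T"
proof (induction T)
  case (Node r ts)
  then show ?case by (simp add: variables_brace o_def cong: map_cong)
qed

lemma well_formed_normal_form: "brace_well_formed (normal_form T)"
  by (induction T) (auto simp: well_formed_brace)

lemma sum_eval_brace:
  "(\<Sum>w\<leftarrow>eval_monomial (brace z xs). k w)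
    = (\<Sum>u\<leftarrow>eval_monomial z. \<Sum>us\<leftarrow>eval_monomials xs. \<Sum>w\<leftarrow>attach u us. (k w :: 'c::comm_monoid_add))"
  by (cases xs) (simp_all add: brace_def sum_eval_monomial_Op attach_Nil)

text \<open>A one-vertex tree has a single angle, so grafting an ordered forest on it yields just
  one tree. Normal forms thus provide a right inverse of evaluation, which proves
  surjectivity.\<close>

lemma eval_normal_form: "eval_monomial (normal_form T) = [T]"
proof (induction T)
  case (Node r ts)
  have "map eval_monomial (map normal_form ts) = map (\<lambda>t. [id t]) ts" using Node by simp
  then have *: "eval_monomials (map normal_form ts) = [ts]" by (simp only: product_lists_singletons) simp
  show ?case
  proof (cases ts)
    case (Cons t us)
    have "eval_monomials (Var r # map normal_form ts) = [Node r [] # ts]"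
      using * by (simp add: product_lists.simps(2))
    then have "eval_monomial (Op n (Var r # map normal_form ts)) = attach (Node r []) ts" for n
      by (simp only: eval_monomial.simps(2)) simp
    then show ?thesis using Cons by (simp add: brace_def)
  qed (simp add: brace_def)
qed

lemma evaluate_normal_form: "evaluate (frag_extend (\<lambda>T. frag_of (normal_form T)) y) = y"
  by (induction y rule: frag_induction[OF subset_UNIV])
     (simp_all add: evaluate_linear evaluate_frag_of eval_normal_form frag_extend_diff)

lemma APE_simps:
  "component APE I = free_Abelian_group (planar_trees I)"
  "op_unit APE i = frag_of (Node i [])"
  "relabel APE \<sigma> = frag_extend (\<lambda>t. frag_of (map_ptree \<sigma> t))"
  "circ APE J I j x y = frag_extend (\<lambda>T. frag_extend (\<lambda>S. ape_circ j T S) y) x"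
  by (simp_all add: APE_def linear_operad_def)

lemma free_operad_simps:
  "component (free_operad G ar) I = free_Abelian_group (tree_monomials G ar I)"
  "op_unit (free_operad G ar) i = frag_of (Var i)"
  "relabel (free_operad G ar) \<sigma> = frag_extend (\<lambda>t. frag_of (map_monomial id \<sigma> t))"
  "circ (free_operad G ar) J I j x y = frag_map2 (substitute j) x y"
  by (simp_all add: free_operad_def linear_operad_def frag_map2_def)

lemma normal_form_tree_monomials: "T \<in> planar_trees I \<Longrightarrow> normal_form T \<in> brace_monomials I"
  by (simp add: planar_trees_def brace_monomials_iff variables_normal_form well_formed_normal_form)

lemma keys_evaluate_brace:
  "Poly_Mapping.keys x \<subseteq> brace_monomials I \<Longrightarrow> Poly_Mapping.keys (evaluate x) \<subseteq> planar_trees I"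
  unfolding brace_monomials_def by (rule keys_evaluate)

lemma surj_operad_hom_evaluate: "surj_operad_hom free_brace_operad APE (\<lambda>I. evaluate)"
  unfolding surj_operad_hom_def APE_simps free_operad_simps brace_monomials_def[symmetric]
proof (intro conjI allI impI ballI)
  fix I J I' :: "'a set" and i j :: 'a and \<sigma> :: "'a \<Rightarrow> 'a" and x y :: "(nat, 'a) monomial \<Rightarrow>\<^sub>0 int"
  let ?F = "\<lambda>I. free_Abelian_group (brace_monomials I) :: ((nat, 'a) monomial \<Rightarrow>\<^sub>0 int) monoid"
  show "evaluate \<in> hom (?F I) (free_Abelian_group (planar_trees I))"
    by (intro homI) (simp_all add: evaluate_linear keys_evaluate_brace)
  show "evaluate ` carrier (?F I) = carrier (free_Abelian_group (planar_trees I))"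
  proof
    show "evaluate ` carrier (?F I) \<subseteq> carrier (free_Abelian_group (planar_trees I))"
      by (auto dest!: keys_evaluate_brace)
    show "carrier (free_Abelian_group (planar_trees I)) \<subseteq> evaluate ` carrier (?F I)"
    proof
      fix y :: "'a ptree \<Rightarrow>\<^sub>0 int" assume "y \<in> carrier (free_Abelian_group (planar_trees I))"
      then have "frag_extend (\<lambda>T. frag_of (normal_form T)) y \<in> carrier (?F I)"
        by (simp add: keys_frag_extend_frag_of[of _ "planar_trees I"] normal_form_tree_monomials)
      then show "y \<in> evaluate ` carrier (?F I)" using evaluate_normal_form by (metis image_eqI)
    qed
  qed
  show "evaluate (frag_of (Var i)) = frag_of (Node i [])" by (simp add: evaluate_frag_of)
  show "evaluate (frag_extend (\<lambda>t. frag_of (map_monomial id \<sigma> t)) x) = frag_extend (\<lambda>t. frag_of (map_ptree \<sigma> t)) (evaluate x)"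
    by (rule evaluate_relabel)
  show "evaluate (frag_map2 (substitute j) x y) = frag_extend (\<lambda>T. frag_extend (\<lambda>S. ape_circ j T S) (evaluate y)) (evaluate x)"
    if "composable J I j" "x \<in> carrier (?F J)" "y \<in> carrier (?F I)"
    using that unfolding brace_monomials_def by (intro evaluate_circ) (auto simp: composable_def)
qed

section \<open>Relations between braces\<close>

text \<open>The forest product with formal brackets in place of grafting: a factor \<open>x\<close>
  that receives the interval \<open>ys\<close> becomes \<open>{x | ys}\<close>, and stays
  \<open>x\<close> when the interval is empty.\<close>

abbreviation brace_product :: "(nat, 'a) monomial list \<Rightarrow> (nat, 'a) monomial list \<Rightarrow> (nat, 'a) monomial list list" where
  "brace_product xs \<equiv> weave (map (\<lambda>x ys. [brace x ys]) xs)"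

text \<open>Removing the first argument together with the first two intervals, the gap before it and
  the content of its bracket, leaves an expression of the same kind with interval numbers shifted by
  two.\<close>

lemma sum_brace_rhs_list:
  "(\<Sum>Y\<in>interval_partitions (2 * length xs + 1) ys. k (map Var (Y ! 0) @
      concat (map (\<lambda>i. brace (Var (xs ! i)) (map Var (Y ! (2*i + 1))) # map Var (Y ! (2*i + 2))) [0..<length xs])))
    = (\<Sum>w\<leftarrow>brace_product (map Var xs) (map Var ys). (k w :: 'c::comm_monoid_add))"
proof (induction xs arbitrary: ys k)
  case Nil
  show ?case by (simp add: sum_interval_partitions_1)
next
  case (Cons x xs)
  have "[0..<length (x # xs)] = 0 # map Suc [0..<length xs]" by (simp add: map_Suc_upt upt_conv_Cons del: upt_Suc)
  then have *: "concat (map (\<lambda>i. brace (Var ((x # xs) ! i)) (map Var ((A # B # Y) ! (2*i + 1))) # map Var ((A # B # Y) ! (2*i + 2))) [0..<length (x # xs)])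
     = brace (Var x) (map Var B) # map Var (Y ! 0) @ concat (map (\<lambda>i. brace (Var (xs ! i)) (map Var (Y ! (2*i + 1))) # map Var (Y ! (2*i + 2))) [0..<length xs])"
    for A B Y by (simp add: o_def)
  have "2 * length (x # xs) + 1 = Suc (Suc (2 * length xs + 1))" by simp
  then show ?case
    by (simp only: sum_interval_partitions_Suc * nth_Cons_0)
       (simp add: Cons[where k="\<lambda>w. k (_ @ _ # w)", simplified] sum_weave_Cons splits_map o_def)
qed

lemma sum_brace_rhs_term:
  "(\<Sum>Y\<in>interval_partitions (2 * length xs + 1) ys. k (brace_rhs_term z xs Y))
    = (\<Sum>w\<leftarrow>brace_product (map Var xs) (map Var ys). (k (brace (Var z) w) :: 'c::comm_monoid_add))"
  unfolding brace_rhs_term_def by (rule sum_brace_rhs_list[where k="\<lambda>w. k (brace (Var z) w)"])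

text \<open>A bracket on a variable has the value of grafting on a one-vertex tree, so formal
  brackets may be exchanged for \<open>attach\<close> factor by factor.\<close>

lemma eval_brace_product_Var:
  "(\<Sum>w\<leftarrow>brace_product (map Var xs) (map Var ys). \<Sum>us\<leftarrow>eval_monomials w. k us)
    = (\<Sum>us\<leftarrow>weave (map attach (map (\<lambda>x. Node x []) xs)) (map (\<lambda>y. Node y []) ys). (k us :: 'c::comm_monoid_add))"
proof (induction xs arbitrary: ys k)
  case (Cons x xs)
  show ?case using Cons
    by (simp add: sum_weave_Cons splits_map o_def sum_product_lists_append sum_product_lists_Cons
        product_lists_singletons sum_eval_brace)
qed (simp add: o_def product_lists_singletons)

text \<open>Both sides have the same value: the root \<open>z\<close> carrying the product of the
  forests of one-vertex trees labelled by \<open>xs\<close> and \<open>ys\<close>.\<close>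

lemma evaluate_brace_relations:
  assumes "x \<in> brace_relations I"
  shows "evaluate x = 0"
proof -
  obtain z xs ys where x: "x = frag_of (brace_lhs z xs ys)
      - (\<Sum>Y\<in>interval_partitions (2 * length xs + 1) ys. frag_of (brace_rhs_term z xs Y))"
    using assms by (auto simp: brace_relations_def)
  let ?L = "map (\<lambda>z. Node z [])"
  have "evaluate (frag_of (brace_lhs z xs ys)) = (\<Sum>us\<leftarrow>weave (map attach (?L xs)) (?L ys). frag_of (Node z us))"
    by (simp add: evaluate_frag_of brace_lhs_def sum_eval_brace product_lists_singletons o_def)
  also have "\<dots> = (\<Sum>w\<leftarrow>brace_product (map Var xs) (map Var ys). \<Sum>us\<leftarrow>eval_monomials w. frag_of (Node z us))"
    by (rule eval_brace_product_Var[symmetric])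
  also have "\<dots> = (\<Sum>w\<leftarrow>brace_product (map Var xs) (map Var ys). evaluate (frag_of (brace (Var z) w)))"
    by (simp add: evaluate_frag_of sum_eval_brace)
  also have "\<dots> = evaluate (\<Sum>Y\<in>interval_partitions (2 * length xs + 1) ys. frag_of (brace_rhs_term z xs Y))"
    by (simp only: evaluate_sum_list sum_brace_rhs_term[where k=frag_of])
  finally show ?thesis by (simp add: x evaluate_linear)
qed

section \<open>Reduction to normal forms\<close>

lemma brace_product_monomials:
  assumes "w \<in> set (brace_product xs ys)" "\<forall>m\<in>set (xs @ ys). brace_well_formed m"
  shows "mset (concat (map variables w)) = mset (concat (map variables (xs @ ys))) \<and> (\<forall>m\<in>set w. brace_well_formed m)"
  using assms
proof (induction xs arbitrary: w ys)
  case (Cons x xs)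
  from Cons.prems(1) obtain p q v where *: "p \<in> set (splits ys)" "q \<in> set (splits (snd p))"
    "v \<in> set (brace_product xs (snd q))" "w = fst p @ brace x (fst q) # v"
    by (auto simp: weave.simps)
  have ys: "ys = fst p @ fst q @ snd q" using *(1,2) splits_append by metis
  have wf: "\<forall>m\<in>set (x # xs @ fst p @ fst q @ snd q). brace_well_formed m" using Cons.prems(2) ys by simp
  then have "mset (concat (map variables v)) = mset (concat (map variables (xs @ snd q)))" "\<forall>m\<in>set v. brace_well_formed m"
    using Cons.IH[OF *(3)] by auto
  then show ?case using wf by (subst ys) (auto simp: *(4) variables_brace well_formed_brace)
qed simp

lemma brace_relations_monomials:
  assumes "x \<in> brace_relations I"
  shows "Poly_Mapping.keys x \<subseteq> brace_monomials I"
proof -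
  obtain z xs ys where x: "x = frag_of (brace_lhs z xs ys)
      - (\<Sum>Y\<in>interval_partitions (2 * length xs + 1) ys. frag_of (brace_rhs_term z xs Y))"
    and zxy: "distinct (z # xs @ ys)" "set (z # xs @ ys) = I"
    using assms by (auto simp: brace_relations_def)
  have vars: "concat (map variables (map Var zs :: (nat, 'a) monomial list)) = zs" for zs
    by (induction zs) auto
  have "brace_lhs z xs ys \<in> brace_monomials I"
    using zxy vars[of xs] vars[of ys] by (auto simp: brace_lhs_def brace_monomials_iff well_formed_brace variables_brace o_def)
  moreover have "brace (Var z) w \<in> brace_monomials I" if "w \<in> set (brace_product (map Var xs) (map Var ys))" for w
  proof -
    have "\<forall>m\<in>set (map Var xs @ map Var ys). brace_well_formed (m :: (nat, 'a) monomial)" by auto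
    from brace_product_monomials[OF that this]
    have "mset (concat (map variables w)) = mset (xs @ ys)" and wf: "\<forall>m\<in>set w. brace_well_formed m"
      using vars[of xs] vars[of ys] by auto
    then have "mset (variables (brace (Var z) w)) = mset (z # xs @ ys)" by (simp add: variables_brace)
    then have "distinct (variables (brace (Var z) w))" "set (variables (brace (Var z) w)) = I"
      using zxy by (metis mset_eq_imp_distinct_iff, metis mset_eq_setD)
    then show ?thesis using wf by (simp add: brace_monomials_iff well_formed_brace)
  qed
  ultimately have "Poly_Mapping.keys (frag_of (brace_lhs z xs ys)) \<subseteq> brace_monomials I"
    "Poly_Mapping.keys (\<Sum>w\<leftarrow>brace_product (map Var xs) (map Var ys). frag_of (brace (Var z) w)) \<subseteq> brace_monomials I"
    by (auto simp: keys_frag_of intro!: keys_sum_list)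
  then show ?thesis
    unfolding x sum_brace_rhs_term[where k=frag_of] using keys_diff by fastforce
qed

text \<open>Guarantees that every monomial owns a variable that can serve as its
  placeholder.\<close>

lemma variables_nonempty: "brace_well_formed m \<Longrightarrow> variables m \<noteq> []"
proof (induction m)
  case (Op n ts)
  then have "ts \<noteq> []" by auto
  then show ?case using Op by (cases ts) auto
qed simp

lemma distinct_concat_mapD:
  assumes "distinct (concat (map f xs))" "x \<in> set xs"
  shows "distinct (f x)" and "\<lbrakk>y \<in> set xs; x \<noteq> y\<rbrakk> \<Longrightarrow> set (f x) \<inter> set (f y) = {}"
  using assms by (induction xs) auto

lemma distinct_if_distinct_concat_map:
  "\<lbrakk>distinct (concat (map f xs)); \<And>x. x \<in> set xs \<Longrightarrow> f x \<noteq> []\<rbrakk> \<Longrightarrow> distinct xs"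
proof (induction xs)
  case (Cons x xs)
  have "f x \<noteq> []" using Cons.prems(2) by simp
  then obtain a where "a \<in> set (f x)" by (cases "f x") auto
  then have "x \<notin> set xs" using Cons.prems(1) by auto
  with Cons show ?case by simp
qed simp

lemma substitute_notin: "j \<notin> set (variables t) \<Longrightarrow> substitute j t s = t"
  unfolding substitute_eq_subst_all by (subst subst_all_cong[where \<tau>=Var]) (auto simp: subst_all_Var)

text \<open>An arbitrary member of the family intersected in \<open>generated_ideal\<close>;
  elements of the kernel are shown to lie in each of these.\<close>

locale brace_ideal =
  fixes N :: "'a set \<Rightarrow> ((nat, 'a) monomial \<Rightarrow>\<^sub>0 int) set"
  assumes ideal: "operadic_ideal free_brace_operad N"
    and relations: "finite K \<Longrightarrow> brace_relations K \<subseteq> N K"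
begin

lemma subgroup_N: "finite I \<Longrightarrow> subgroup (N I) (free_Abelian_group (brace_monomials I))"
  using ideal unfolding operadic_ideal_def free_operad_simps brace_monomials_def by blast

lemma N_keys: "\<lbrakk>finite I; x \<in> N I\<rbrakk> \<Longrightarrow> Poly_Mapping.keys x \<subseteq> brace_monomials I"
  using subsetD[OF subgroup.subset[OF subgroup_N], of I x] by simp

lemma N_0: "finite I \<Longrightarrow> 0 \<in> N I"
  using subgroup.one_closed[OF subgroup_N] by simp

lemma N_add: "\<lbrakk>finite I; x \<in> N I; y \<in> N I\<rbrakk> \<Longrightarrow> x + y \<in> N I"
  using subgroup.m_closed[OF subgroup_N] by simp

lemma N_diff: "\<lbrakk>finite I; x \<in> N I; y \<in> N I\<rbrakk> \<Longrightarrow> x - y \<in> N I"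
  using subgroup.m_closed[OF subgroup_N, of I x "- y"] subgroup.m_inv_closed[OF subgroup_N, of I y] N_keys[of I y]
  by simp

lemma N_trans: "\<lbrakk>finite I; a - b \<in> N I; b - c \<in> N I\<rbrakk> \<Longrightarrow> a - c \<in> N I"
  using N_add[of I "a - b" "b - c"] by simp

lemma N_sum_list:
  assumes "finite I" "\<And>x. x \<in> set xs \<Longrightarrow> f x - g x \<in> N I"
  shows "(\<Sum>x\<leftarrow>xs. f x) - (\<Sum>x\<leftarrow>xs. g x) \<in> N I"
  using assms(2)
proof (induction xs)
  case (Cons x xs)
  have "(\<Sum>x\<leftarrow>x # xs. f x) - (\<Sum>x\<leftarrow>x # xs. g x) = (f x - g x) + ((\<Sum>x\<leftarrow>xs. f x) - (\<Sum>x\<leftarrow>xs. g x))"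
    by (simp add: algebra_simps)
  moreover have "(f x - g x) + ((\<Sum>x\<leftarrow>xs. f x) - (\<Sum>x\<leftarrow>xs. g x)) \<in> N I"
    using Cons by (intro N_add[OF assms(1)]) auto
  ultimately show ?case by (simp only:)
qed (simp add: N_0[OF assms(1)])

lemma N_substitute_left:
  assumes "composable J I j" "x \<in> N J" "s \<in> brace_monomials I"
  shows "frag_extend (\<lambda>t. frag_of (substitute j t s)) x \<in> N (J - {j} \<union> I)"
proof -
  have "frag_of s \<in> carrier (component free_brace_operad I)"
    using assms(3) by (simp only: free_operad_simps brace_monomials_def[symmetric]) simp
  then have "frag_map2 (substitute j) x (frag_of s) \<in> N (J - {j} \<union> I)"
    using ideal assms(1,2) unfolding operadic_ideal_def free_operad_simps by blast
  then show ?thesis by (simp add: frag_map2_def)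
qed

lemma N_substitute_right:
  assumes "composable J I j" "t \<in> brace_monomials J" "y \<in> N I"
  shows "frag_extend (\<lambda>s. frag_of (substitute j t s)) y \<in> N (J - {j} \<union> I)"
proof -
  have "frag_of t \<in> carrier (component free_brace_operad J)"
    using assms(2) by (simp only: free_operad_simps brace_monomials_def[symmetric]) simp
  then have "frag_map2 (substitute j) (frag_of t) y \<in> N (J - {j} \<union> I)"
    using ideal assms(1,3) unfolding operadic_ideal_def free_operad_simps by blast
  then show ?thesis by (simp add: frag_map2_def)
qed

text \<open>
  Requiring \<open>i \<in> V i\<close> makes it possible to substitute one variable after the other: no variable still
  to be substituted occurs in a monomial that has already been inserted.
\<close>

lemma N_subst_all:
  assumes "finite J" "x \<in> N J" and \<sigma>: "\<And>i. i \<in> J \<Longrightarrow> \<sigma> i \<in> brace_monomials (V i)" and V: "\<And>i. i \<in> J \<Longrightarrow> i \<in> V i"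
    and disj: "\<And>i i'. \<lbrakk>i \<in> J; i' \<in> J; i \<noteq> i'\<rbrakk> \<Longrightarrow> V i \<inter> V i' = {}"
  shows "frag_extend (\<lambda>t. frag_of (subst_all \<sigma> t)) x \<in> N (\<Union>i\<in>J. V i)"
proof -
  have fin: "finite (V i)" if "i \<in> J" for i using \<sigma>[OF that] unfolding brace_monomials_iff by (metis List.finite_set)
  have "frag_extend (\<lambda>t. frag_of (subst_all (\<lambda>i. if i \<in> K then \<sigma> i else Var i) t)) x \<in> N ((J - K) \<union> (\<Union>i\<in>K. V i))"
    if "K \<subseteq> J" "finite K" for K
    using that(2,1)
  proof (induction K)
    case empty
    have "frag_extend (\<lambda>t. frag_of (subst_all (\<lambda>i. if i \<in> {} then \<sigma> i else Var i) t)) x = x"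
      by (simp add: subst_all_Var frag_expansion[symmetric])
    then show ?case using assms(2) by simp
  next
    case (insert j K)
    let ?J = "(J - K) \<union> (\<Union>i\<in>K. V i)"
    let ?\<tau> = "\<lambda>K i. if i \<in> K then \<sigma> i else Var i"
    have j: "j \<in> J" "j \<notin> K" "K \<subseteq> J" using insert by auto
    have jV: "j \<notin> V i" if "i \<in> K" for i using disj[of i j] V[of j] that j by auto
    have "composable ?J (V j) j"
      using assms(1) insert.hyps(1) fin j V disj by (auto simp: composable_def; blast)
    moreover have "frag_extend (\<lambda>t. frag_of (subst_all (?\<tau> K) t)) x \<in> N ?J"
      using insert by simp
    ultimately have "frag_extend (\<lambda>t. frag_of (substitute j t (\<sigma> j))) (frag_extend (\<lambda>t. frag_of (subst_all (?\<tau> K) t)) x) \<in> N (?J - {j} \<union> V j)"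
      using \<sigma> j by (intro N_substitute_left) auto
    also have "?J - {j} \<union> V j = (J - insert j K) \<union> (\<Union>i\<in>insert j K. V i)"
      using j jV by auto
    also have "frag_extend (\<lambda>t. frag_of (substitute j t (\<sigma> j))) (frag_extend (\<lambda>t. frag_of (subst_all (?\<tau> K) t)) x)
      = frag_extend (\<lambda>t. frag_of (substitute j (subst_all (?\<tau> K) t) (\<sigma> j))) x"
      by (induction x rule: frag_induction[OF subset_UNIV]) (simp_all add: frag_extend_diff)
    also have "\<dots> = frag_extend (\<lambda>t. frag_of (subst_all (?\<tau> (insert j K)) t)) x"
    proof (rule frag_extend_eq)
      fix t assume "t \<in> Poly_Mapping.keys x"
      then have t: "set (variables t) = J" using N_keys[OF assms(1,2)] by (auto simp: brace_monomials_iff)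
      have "substitute j (?\<tau> K i) (\<sigma> j) = ?\<tau> (insert j K) i" if "i \<in> J" for i
      proof (cases "i \<in> K")
        case True
        then have "j \<notin> set (variables (\<sigma> i))" using \<sigma>[OF that] jV by (simp add: brace_monomials_iff)
        then show ?thesis using True by (simp add: substitute_notin)
      qed auto
      then show "frag_of (substitute j (subst_all (?\<tau> K) t) (\<sigma> j)) = frag_of (subst_all (?\<tau> (insert j K)) t)"
        unfolding substitute_eq_subst_all subst_all_subst_all
        by (intro arg_cong[where f=frag_of] subst_all_cong) (simp only: t)
    qed
    finally show ?case .
  qed
  from this[OF order_refl assms(1)] have "frag_extend (\<lambda>t. frag_of (subst_all (\<lambda>i. if i \<in> J then \<sigma> i else Var i) t)) x \<in> N (\<Union>i\<in>J. V i)"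
    by simp
  also have "frag_extend (\<lambda>t. frag_of (subst_all (\<lambda>i. if i \<in> J then \<sigma> i else Var i) t)) x = frag_extend (\<lambda>t. frag_of (subst_all \<sigma> t)) x"
    using N_keys[OF assms(1,2)]
    by (intro frag_extend_eq arg_cong[where f=frag_of] subst_all_cong) (auto simp: brace_monomials_iff)
  finally show ?thesis .
qed

definition separated :: "(nat, 'a) monomial list \<Rightarrow> bool" where
  "separated ms \<longleftrightarrow> (\<forall>m\<in>set ms. brace_well_formed m) \<and> distinct (concat (map variables ms))"

abbreviation all_variables :: "(nat, 'a) monomial list \<Rightarrow> 'a set" where
  "all_variables ms \<equiv> \<Union>m\<in>set ms. set (variables m)"

text \<open>The congruence for \<open>m\<close> is inserted at a placeholder in the surrounding
  operation. A variable \<open>j\<close> of \<open>m\<close> serves: it occurs in no other argument,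
  and \<open>composable\<close> permits it to occur in the inserted monomials.\<close>

lemma N_replace:
  assumes m: "frag_of m - (\<Sum>w\<leftarrow>L. frag_of w) \<in> N (set (variables m))"
    and sep: "separated (pre @ m # post)" and n: "length pre + length post = n" "n \<ge> 1"
  shows "frag_of (Op n (pre @ m # post)) - (\<Sum>w\<leftarrow>L. frag_of (Op n (pre @ w # post))) \<in> N (all_variables (pre @ m # post))"
proof -
  let ?V = "set (variables m)" and ?U = "all_variables (pre @ post)"
  have "variables m \<noteq> []" using sep by (intro variables_nonempty) (simp add: separated_def)
  then obtain j where j: "j \<in> ?V" by (cases "variables m") auto
  have disj: "?V \<inter> ?U = {}" using sep by (auto simp: separated_def)
  have "Op n (pre @ Var j # post) \<in> brace_monomials (insert j ?U)"
    using sep n j disj by (auto simp: brace_monomials_iff separated_def)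
  moreover have "composable (insert j ?U) ?V j" using disj j by (auto simp: composable_def)
  ultimately have "frag_extend (\<lambda>s. frag_of (substitute j (Op n (pre @ Var j # post)) s)) (frag_of m - (\<Sum>w\<leftarrow>L. frag_of w))
      \<in> N (insert j ?U - {j} \<union> ?V)"
    using m by (intro N_substitute_right)
  also have "insert j ?U - {j} \<union> ?V = all_variables (pre @ m # post)"
    using j by auto
  finally have N: "frag_extend (\<lambda>s. frag_of (substitute j (Op n (pre @ Var j # post)) s)) (frag_of m - (\<Sum>w\<leftarrow>L. frag_of w))
      \<in> N (all_variables (pre @ m # post))" .
  have eq: "substitute j (Op n (pre @ Var j # post)) s = Op n (pre @ s # post)" for s
  proof -
    have "j \<notin> set (variables t)" if "t \<in> set (pre @ post)" for t
      using that disj j by auto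
    then show ?thesis by (auto simp: substitute_notin intro!: map_idI)
  qed
  from N show ?thesis unfolding eq by (simp add: frag_extend_diff frag_extend_sum_list)
qed

lemma N_replace_brace:
  assumes "frag_of m - (\<Sum>w\<leftarrow>L. frag_of w) \<in> N (set (variables m))" "separated (z # pre @ m # post)"
  shows "frag_of (brace z (pre @ m # post)) - (\<Sum>w\<leftarrow>L. frag_of (brace z (pre @ w # post))) \<in> N (all_variables (z # pre @ m # post))"
  using N_replace[of m L "z # pre" post "length pre + length post + 1"] assms by (simp add: brace_def)

text \<open>The relation is taken for one variable of each monomial and all monomials are then
  substituted by \<open>N_subst_all\<close>. Choosing the first variable of a monomial as its
  representative meets the requirement \<open>i \<in> V i\<close>, and disjointness of variables
  makes the choice injective.\<close>

lemma N_relation: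
  assumes sep: "separated (z # ss @ ys)"
  shows "frag_of (brace (brace z ss) ys) - (\<Sum>w\<leftarrow>brace_product ss ys. frag_of (brace z w)) \<in> N (all_variables (z # ss @ ys))"
\<comment> \<open>If one of the lists is empty, both sides coincide by the convention
  \<open>{x | } = x\<close>.\<close>
proof (cases "ss = [] \<or> ys = []")
  case True
  have "brace_product ss [] = [ss]" by (induction ss) (simp_all add: weave.simps brace_def)
  then have "frag_of (brace (brace z ss) ys) - (\<Sum>w\<leftarrow>brace_product ss ys. frag_of (brace z w)) = 0"
    using True by (auto simp: brace_def)
  then show ?thesis using N_0 by simp
next
  case False
  define rep where "rep = (\<lambda>m :: (nat, 'a) monomial. hd (variables m))"
  let ?ms = "z # ss @ ys"
  have wf: "brace_well_formed m" "distinct (variables m)" "rep m \<in> set (variables m)" if "m \<in> set ?ms" for m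
  proof -
    show *: "brace_well_formed m" using sep that unfolding separated_def by blast
    show "distinct (variables m)"
      using sep that distinct_concat_mapD(1)[of variables ?ms m] by (simp add: separated_def)
    show "rep m \<in> set (variables m)" using variables_nonempty[OF *] by (simp add: rep_def)
  qed
  have disj: "set (variables m) \<inter> set (variables m') = {}" if "m \<in> set ?ms" "m' \<in> set ?ms" "m \<noteq> m'" for m m'
    using sep that distinct_concat_mapD(2)[of variables ?ms m m'] unfolding separated_def by blast
  have inj: "inj_on rep (set ?ms)"
  proof (rule inj_onI, rule ccontr)
    fix m m' assume m: "m \<in> set ?ms" "m' \<in> set ?ms" "rep m = rep m'" "m \<noteq> m'"
    show False using disj[OF m(1,2,4)] wf(3)[OF m(1)] wf(3)[OF m(2)] m(3) by auto
  qed
  have "distinct ?ms"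
  proof (rule distinct_if_distinct_concat_map)
    show "distinct (concat (map variables ?ms))" using sep unfolding separated_def by blast
    show "variables m \<noteq> []" if "m \<in> set ?ms" for m using wf(1)[OF that] by (rule variables_nonempty)
  qed
  then have dist: "distinct (map rep ?ms)" using inj unfolding distinct_map by blast
  define \<sigma> where "\<sigma> = inv_into (set ?ms) rep"
  have \<sigma>: "\<sigma> (rep m) = m" if "m \<in> set ?ms" for m using inv_into_f_f[OF inj that] by (simp add: \<sigma>_def)
  let ?J = "set (map rep ?ms)"
  let ?x = "frag_of (brace_lhs (rep z) (map rep ss) (map rep ys))
     - (\<Sum>Y\<in>interval_partitions (2 * length (map rep ss) + 1) (map rep ys). frag_of (brace_rhs_term (rep z) (map rep ss) Y))"
  have "?x \<in> brace_relations ?J"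
    unfolding brace_relations_def mem_Collect_eq
    using False dist by (intro exI[of _ "rep z"] exI[of _ "map rep ss"] exI[of _ "map rep ys"]) (auto simp: Suc_le_eq)
  then have "?x \<in> N ?J" using relations by blast
  then have "frag_extend (\<lambda>t. frag_of (subst_all \<sigma> t)) ?x \<in> N (\<Union>i\<in>?J. set (variables (\<sigma> i)))"
  proof (rule N_subst_all[rotated])
    fix i assume "i \<in> ?J"
    then obtain m where m: "m \<in> set ?ms" "i = rep m" by auto
    then show "\<sigma> i \<in> brace_monomials (set (variables (\<sigma> i)))" "i \<in> set (variables (\<sigma> i))"
      using wf[OF m(1)] \<sigma>[OF m(1)] by (simp_all add: brace_monomials_iff)
    fix i' assume "i' \<in> ?J" "i \<noteq> i'"
    then obtain m' where m': "m' \<in> set ?ms" "i' = rep m'" by auto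
    then show "set (variables (\<sigma> i)) \<inter> set (variables (\<sigma> i')) = {}"
      using disj[OF m(1) m'(1)] m m' \<sigma> \<open>i \<noteq> i'\<close> by auto
  qed simp
  also have "(\<Union>i\<in>?J. set (variables (\<sigma> i))) = all_variables ?ms"
    using \<sigma> by auto
  also have "frag_extend (\<lambda>t. frag_of (subst_all \<sigma> t)) ?x =
     frag_of (brace (brace z ss) ys) - (\<Sum>w\<leftarrow>brace_product ss ys. frag_of (brace z w))"
  proof -
    have sb: "subst_all \<sigma> (brace t ts) = brace (subst_all \<sigma> t) (map (subst_all \<sigma>) ts)" for t :: "(nat, 'a) monomial" and ts
      by (simp add: brace_def)
    have sv: "map (subst_all \<sigma>) (map Var (map rep ms)) = ms" if "set ms \<subseteq> set ?ms" for ms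
      using that \<sigma> by (auto intro!: map_idI)
    have s: "map (subst_all \<sigma>) (map Var (map rep ss)) = ss" "map (subst_all \<sigma>) (map Var (map rep ys)) = ys" "\<sigma> (rep z) = z"
      by (rule sv, force)+ (rule \<sigma>, simp)
    have bp: "(\<Sum>w\<leftarrow>brace_product xs zs. k (map (subst_all \<sigma>) w)) = (\<Sum>w\<leftarrow>brace_product (map (subst_all \<sigma>) xs) (map (subst_all \<sigma>) zs). k w)"
      for xs zs :: "(nat, 'a) monomial list" and k :: "_ \<Rightarrow> (nat, 'a) monomial \<Rightarrow>\<^sub>0 int"
    proof (induction xs arbitrary: zs k)
      case (Cons x xs)
      show ?case
        by (simp add: sum_weave_Cons splits_map o_def sb Cons[of "\<lambda>w. k (_ @ _ # w)", unfolded o_def])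
    qed simp
    have "frag_extend (\<lambda>t. frag_of (subst_all \<sigma> t)) ?x = frag_of (subst_all \<sigma> (brace_lhs (rep z) (map rep ss) (map rep ys)))
      - (\<Sum>w\<leftarrow>brace_product (map Var (map rep ss)) (map Var (map rep ys)). frag_of (subst_all \<sigma> (brace (Var (rep z)) w)))"
      by (simp only: sum_brace_rhs_term[where k=frag_of] frag_extend_diff frag_extend_of frag_extend_sum_list)
    also have "subst_all \<sigma> (brace_lhs (rep z) (map rep ss) (map rep ys)) = brace (brace z ss) ys"
      by (simp only: brace_lhs_def sb s subst_all.simps)
    also have "(\<Sum>w\<leftarrow>brace_product (map Var (map rep ss)) (map Var (map rep ys)). frag_of (subst_all \<sigma> (brace (Var (rep z)) w)))
       = (\<Sum>w\<leftarrow>brace_product ss ys. frag_of (brace z w))"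
      by (simp only: sb s subst_all.simps bp[where k="\<lambda>w. frag_of (brace z w)"])
    finally show ?thesis .
  qed
  finally show ?thesis .
qed

text \<open>Reductions permute variables, so they preserve both the side condition and the component
  of the ideal in which the congruence lives.\<close>

lemma separated_cong:
  assumes "separated ms" "\<forall>m\<in>set ms'. brace_well_formed m"
    "mset (concat (map variables ms')) = mset (concat (map variables ms))"
  shows "separated ms'" and "all_variables ms' = all_variables ms"
proof -
  show "separated ms'" using assms mset_eq_imp_distinct_iff[OF assms(3)] by (simp add: separated_def)
  show "all_variables ms' = all_variables ms" using mset_eq_setD[OF assms(3)] by simp
qed

lemma concat_variables_normal_forms: "concat (map variables (map normal_form ts)) = concat (map vertices ts)"
  by (simp add: o_def variables_normal_form)

text \<open>A brace relation between normal forms leaves brackets of the form \<open>{t | B}\<close>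
  among the arguments; here they are replaced by normal forms. \<open>pre\<close> collects the
  arguments further left, where brackets may still be unreduced.\<close>

lemma N_attach_forest:
  assumes attach: "\<And>t B. \<lbrakk>t \<in> set us; separated (map normal_form (t # B))\<rbrakk> \<Longrightarrow>
      frag_of (brace (normal_form t) (map normal_form B)) - (\<Sum>s\<leftarrow>attach t B. frag_of (normal_form s))
        \<in> N (all_variables (map normal_form (t # B)))"
    and "separated (z # pre @ map normal_form us @ map normal_form ys)"
  shows "(\<Sum>w\<leftarrow>brace_product (map normal_form us) (map normal_form ys). frag_of (brace z (pre @ w)))
      - (\<Sum>v\<leftarrow>weave (map attach us) ys. frag_of (brace z (pre @ map normal_form v)))
      \<in> N (all_variables (z # pre @ map normal_form us @ map normal_form ys))"
  using assms
proof (induction us arbitrary: pre ys)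
  case Nil
  have "finite (all_variables (z # pre @ map normal_form [] @ map normal_form ys))" by simp
  from N_0[OF this] show ?case by simp
next
  case (Cons t us)
  let ?nf = "map normal_form"
  let ?ms = "z # pre @ ?nf (t # us) @ ?nf ys"
  let ?I = "all_variables ?ms"
  have fin: "finite ?I" by simp
  have "(\<Sum>w\<leftarrow>brace_product (?nf (t # us)) (?nf ys). frag_of (brace z (pre @ w))) =
    (\<Sum>p\<leftarrow>splits ys. \<Sum>q\<leftarrow>splits (snd p). \<Sum>w\<leftarrow>brace_product (?nf us) (?nf (snd q)).
       frag_of (brace z ((pre @ ?nf (fst p) @ [brace (normal_form t) (?nf (fst q))]) @ w)))" (is "?lhs = ?l")
    by (simp add: sum_weave_Cons splits_map o_def)
  moreover have "(\<Sum>v\<leftarrow>weave (map attach (t # us)) ys. frag_of (brace z (pre @ ?nf v))) =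
    (\<Sum>p\<leftarrow>splits ys. \<Sum>q\<leftarrow>splits (snd p). \<Sum>s\<leftarrow>attach t (fst q). \<Sum>v\<leftarrow>weave (map attach us) (snd q).
       frag_of (brace z (pre @ ?nf (fst p) @ normal_form s # ?nf v)))" (is "?rhs = ?r")
    by (simp add: sum_weave_Cons)
  moreover have "?l - ?r \<in> N ?I"
  proof (intro N_sum_list[OF fin])
    fix p q assume pq: "p \<in> set (splits ys)" "q \<in> set (splits (snd p))"
    let ?A = "fst p" and ?B = "fst q" and ?C = "snd q"
    have ys: "ys = ?A @ ?B @ ?C" using pq splits_append by metis
    let ?m = "brace (normal_form t) (?nf ?B)"
    \<comment> \<open>The bracket on \<open>t\<close> enters \<open>pre\<close> unreduced. The
      induction hypothesis treats the factors to its right, and then \<open>N_replace_brace\<close>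
      reduces this bracket.\<close>
    let ?pre = "pre @ ?nf ?A @ [?m]"
    have wf: "brace_well_formed z" "\<forall>m\<in>set pre. brace_well_formed m"
      using Cons.prems(2) by (simp_all add: separated_def)
    have wf': "\<forall>m\<in>set (z # ?pre @ ?nf us @ ?nf ?C). brace_well_formed m"
      using wf by (auto simp: well_formed_brace well_formed_normal_form)
    have "mset (concat (map variables (?nf ys))) = mset (concat (map variables (?nf ?A @ ?nf ?B @ ?nf ?C)))"
      using arg_cong[OF ys, of "\<lambda>ys. mset (concat (map variables (?nf ys)))"] by (simp only: map_append)
    then have mset: "mset (concat (map variables (z # ?pre @ ?nf us @ ?nf ?C))) = mset (concat (map variables ?ms))"
      by (simp add: variables_brace)
    note 1 = separated_cong[OF Cons.prems(2) wf' mset]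
    have a: "(\<Sum>w\<leftarrow>brace_product (?nf us) (?nf ?C). frag_of (brace z (?pre @ w)))
      - (\<Sum>v\<leftarrow>weave (map attach us) ?C. frag_of (brace z (?pre @ ?nf v))) \<in> N ?I"
      using Cons.IH[of ?pre ?C] Cons.prems(1) 1 by simp
    have b: "(\<Sum>v\<leftarrow>weave (map attach us) ?C. frag_of (brace z (?pre @ ?nf v)))
      - (\<Sum>v\<leftarrow>weave (map attach us) ?C. \<Sum>s\<leftarrow>attach t ?B. frag_of (brace z (pre @ ?nf ?A @ normal_form s # ?nf v))) \<in> N ?I"
    proof (intro N_sum_list[OF fin])
      fix v assume "v \<in> set (weave (map attach us) ?C)"
      then have v: "mset (concat (map vertices v)) = mset (concat (map vertices us)) + mset (concat (map vertices ?C))"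
        using mset_vertices_weave mset_vertices_attach by blast
      have wf'': "\<forall>m\<in>set (z # (pre @ ?nf ?A) @ ?m # ?nf v). brace_well_formed m"
        using wf by (auto simp: well_formed_brace well_formed_normal_form)
      have mset: "mset (concat (map variables (z # (pre @ ?nf ?A) @ ?m # ?nf v))) = mset (concat (map variables (z # ?pre @ ?nf us @ ?nf ?C)))"
        using v by (simp add: variables_normal_form o_def)
      note 2 = separated_cong[OF 1(1) wf'' mset, unfolded 1(2)]
      have "separated (?nf (t # ?B))"
        using 1(1) by (auto simp: separated_def well_formed_normal_form variables_brace)
      then have "frag_of ?m - (\<Sum>s\<leftarrow>?nf (attach t ?B). frag_of s) \<in> N (set (variables ?m))"
        using Cons.prems(1)[of t ?B] by (simp add: o_def variables_brace)
      from N_replace_brace[OF this 2(1)]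
      show "frag_of (brace z (?pre @ ?nf v)) - (\<Sum>s\<leftarrow>attach t ?B. frag_of (brace z (pre @ ?nf ?A @ normal_form s # ?nf v))) \<in> N ?I"
        unfolding 2(2) by (simp add: o_def)
    qed
    show "(\<Sum>w\<leftarrow>brace_product (?nf us) (?nf ?C). frag_of (brace z (?pre @ w)))
      - (\<Sum>s\<leftarrow>attach t ?B. \<Sum>v\<leftarrow>weave (map attach us) ?C. frag_of (brace z (pre @ ?nf ?A @ normal_form s # ?nf v))) \<in> N ?I"
      using N_trans[OF fin a b] by (subst sum_list_swap)
  qed
  ultimately show ?case by (simp only:)
qed

text \<open>The brace relation trades a bracket on a tree for brackets on its subtrees, so induction
  on the tree ends the reduction.\<close>

lemma N_attach:
  assumes "separated (map normal_form (T # ys))"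
  shows "frag_of (brace (normal_form T) (map normal_form ys)) - (\<Sum>w\<leftarrow>attach T ys. frag_of (normal_form w))
        \<in> N (all_variables (map normal_form (T # ys)))"
  using assms
proof (induction T arbitrary: ys)
  case (Node r ss)
  let ?nf = "map normal_form"
  have wf: "\<forall>m\<in>set (Var r # ?nf ss @ ?nf ys). brace_well_formed m"
    by (auto simp: well_formed_normal_form)
  have mset: "mset (concat (map variables (Var r # ?nf ss @ ?nf ys))) = mset (concat (map variables (?nf (Node r ss # ys))))"
    by (simp add: variables_brace)
  note s = separated_cong[OF Node.prems wf mset]
  have a: "frag_of (brace (normal_form (Node r ss)) (?nf ys)) - (\<Sum>w\<leftarrow>brace_product (?nf ss) (?nf ys). frag_of (brace (Var r) w))
      \<in> N (all_variables (Var r # ?nf ss @ ?nf ys))"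
    using N_relation[OF s(1)] by simp
  have b: "(\<Sum>w\<leftarrow>brace_product (?nf ss) (?nf ys). frag_of (brace (Var r) w))
      - (\<Sum>v\<leftarrow>weave (map attach ss) ys. frag_of (brace (Var r) (?nf v))) \<in> N (all_variables (Var r # ?nf ss @ ?nf ys))"
    using N_attach_forest[where us=ss and z="Var r" and pre="[]" and ys=ys] Node.IH s(1) by simp
  have "finite (all_variables (Var r # ?nf ss @ ?nf ys))" by simp
  from N_trans[OF this a b] show ?case unfolding s(2) by (simp add: o_def)
qed

lemma mset_vertices_eval_monomials:
  "us \<in> set (eval_monomials ts) \<Longrightarrow> mset (concat (map vertices us)) = mset (concat (map variables ts))"
  by (induction ts arbitrary: us) (auto simp: product_lists.simps(2) mset_vertices_eval_monomial)

text \<open>Arguments are normalised one at a time from left to right; those already treated are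
  moved to \<open>pre\<close>.\<close>

lemma N_arguments:
  assumes "\<And>t. t \<in> set ts \<Longrightarrow> frag_of t - (\<Sum>w\<leftarrow>eval_monomial t. frag_of (normal_form w)) \<in> N (set (variables t))"
    and "separated (pre @ ts)" "length pre + length ts = n + 1" "n \<ge> 1"
  shows "frag_of (Op n (pre @ ts)) - (\<Sum>us\<leftarrow>eval_monomials ts. frag_of (Op n (pre @ map normal_form us))) \<in> N (all_variables (pre @ ts))"
  using assms
proof (induction ts arbitrary: pre)
  case Nil
  have "finite (all_variables (pre @ []))" by simp
  from N_0[OF this] show ?case by simp
next
  case (Cons t ts)
  let ?I = "all_variables (pre @ t # ts)"
  have fin: "finite ?I" by simp
  have "frag_of t - (\<Sum>w\<leftarrow>map normal_form (eval_monomial t). frag_of w) \<in> N (set (variables t))"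
    using Cons.prems(1)[of t] by (simp add: o_def)
  from N_replace[OF this Cons.prems(2), where n=n] Cons.prems(3,4)
  have a: "frag_of (Op n (pre @ t # ts)) - (\<Sum>u\<leftarrow>eval_monomial t. frag_of (Op n (pre @ normal_form u # ts))) \<in> N ?I"
    by (simp add: o_def)
  have b: "(\<Sum>u\<leftarrow>eval_monomial t. frag_of (Op n (pre @ normal_form u # ts)))
     - (\<Sum>u\<leftarrow>eval_monomial t. \<Sum>us\<leftarrow>eval_monomials ts. frag_of (Op n (pre @ normal_form u # map normal_form us))) \<in> N ?I"
  proof (intro N_sum_list[OF fin])
    fix u assume "u \<in> set (eval_monomial t)"
    then have u: "mset (variables (normal_form u)) = mset (variables t)"
      by (simp add: variables_normal_form mset_vertices_eval_monomial)
    have wf: "\<forall>m\<in>set ((pre @ [normal_form u]) @ ts). brace_well_formed m"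
      using Cons.prems(2) by (auto simp: well_formed_normal_form separated_def)
    have "mset (concat (map variables ((pre @ [normal_form u]) @ ts))) = mset (concat (map variables (pre @ t # ts)))"
      using u by simp
    note s = separated_cong[OF Cons.prems(2) wf this]
    show "frag_of (Op n (pre @ normal_form u # ts)) - (\<Sum>us\<leftarrow>eval_monomials ts. frag_of (Op n (pre @ normal_form u # map normal_form us))) \<in> N ?I"
      using Cons.IH[of "pre @ [normal_form u]"] Cons.prems s by simp
  qed
  from N_trans[OF fin a b] show ?case by (simp add: sum_product_lists_Cons)
qed

text \<open>Once the arguments are in normal form, the outermost operation is a bracket on a normal
  form, which \<open>N_attach\<close> expands.\<close>

lemma N_monomial:
  assumes "brace_well_formed t" "distinct (variables t)"
  shows "frag_of t - (\<Sum>w\<leftarrow>eval_monomial t. frag_of (normal_form w)) \<in> N (set (variables t))"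
  using assms
proof (induction t)
  case (Var i)
  then show ?case using N_0[of "{i}"] by (simp add: brace_def)
next
  case (Op n ts)
  let ?I = "set (variables (Op n ts))"
  have fin: "finite ?I" by simp
  have n: "n \<ge> 1" "length ts = n + 1" and sep: "separated ts"
    using Op.prems by (auto simp: separated_def)
  have "frag_of t - (\<Sum>w\<leftarrow>eval_monomial t. frag_of (normal_form w)) \<in> N (set (variables t))" if "t \<in> set ts" for t
    using Op.IH[OF that] Op.prems that distinct_concat_mapD(1)[of variables ts t] by simp
  from N_arguments[OF this, where pre="[]" and n=n] sep n
  have a: "frag_of (Op n ts) - (\<Sum>us\<leftarrow>eval_monomials ts. frag_of (Op n (map normal_form us))) \<in> N ?I"
    by simp
  obtain t0 ts' where ts: "ts = t0 # ts'" using n by (cases ts) auto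
  have "(\<Sum>us\<leftarrow>eval_monomials ts. frag_of (Op n (map normal_form us)))
     - (\<Sum>us\<leftarrow>eval_monomials ts. \<Sum>w\<leftarrow>attach (hd us) (tl us). frag_of (normal_form w)) \<in> N ?I"
  proof (intro N_sum_list[OF fin])
    fix us assume us: "us \<in> set (eval_monomials ts)"
    then have "length us = n + 1" using n by (auto simp: product_lists_set dest: list_all2_lengthD)
    then obtain u us' where u: "us = u # us'" "length us' = n" by (cases us) auto
    have "\<forall>m\<in>set (map normal_form us). brace_well_formed m"
      "mset (concat (map variables (map normal_form us))) = mset (concat (map variables ts))"
      using mset_vertices_eval_monomials[OF us]
      by (auto simp: well_formed_normal_form concat_variables_normal_forms simp del: map_map)
    note separated_cong[OF sep this]
    \<comment> \<open>\<open>us'\<close> has exactly \<open>n\<close> entries and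
      \<open>n \<ge> 1\<close>, so \<open>brace\<close> produces the same generator instead of the
      degenerate case.\<close>
    moreover have "brace (normal_form u) (map normal_form us') = Op n (map normal_form us)"
      using u n by (auto simp: brace_def)
    ultimately show "frag_of (Op n (map normal_form us)) - (\<Sum>w\<leftarrow>attach (hd us) (tl us). frag_of (normal_form w)) \<in> N ?I"
      using N_attach[of u us'] u by simp
  qed
  then have b: "(\<Sum>us\<leftarrow>eval_monomials ts. frag_of (Op n (map normal_form us)))
     - (\<Sum>w\<leftarrow>eval_monomial (Op n ts). frag_of (normal_form w)) \<in> N ?I"
    by (simp add: ts sum_eval_monomial_Op sum_product_lists_Cons)
  show ?case using N_trans[OF fin a b] .
qed

text \<open>By additivity the congruence for monomials extends to \<open>x\<close>, whose value 0
  has normal form 0.\<close>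

lemma evaluate_eq_0_imp_N:
  assumes "finite I" "Poly_Mapping.keys x \<subseteq> brace_monomials I" "evaluate x = 0"
  shows "x \<in> N I"
proof -
  let ?f = "\<lambda>y. frag_extend (\<lambda>T. frag_of (normal_form T)) y"
  have "x - ?f (evaluate x) \<in> N I"
    using assms(2)
  proof (induction x rule: frag_induction)
    case zero
    then show ?case using N_0[OF assms(1)] by (simp add: evaluate_linear)
  next
    case (one t)
    then show ?case using N_monomial[of t] by (simp add: brace_monomials_iff evaluate_frag_of frag_extend_sum_list)
  next
    case (diff a b)
    have "a - b - ?f (evaluate (a - b)) = (a - ?f (evaluate a)) - (b - ?f (evaluate b))"
      by (simp add: evaluate_linear frag_extend_diff)
    then show ?case using N_diff[OF assms(1) diff] by (simp only:)
  qed
  then show ?thesis using assms(3) by simp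
qed

end

section \<open>The kernel of evaluation\<close>

text \<open>A composite evaluates to 0 as soon as one of its factors does, by compatibility with
  composition.\<close>

lemma operadic_ideal_kernel_evaluate:
  "operadic_ideal free_brace_operad (\<lambda>I. {x. Poly_Mapping.keys x \<subseteq> brace_monomials I \<and> evaluate x = 0})"
  unfolding operadic_ideal_def
proof (intro conjI allI impI ballI)
  interpret operad "free_brace_operad :: ('a, (nat, 'a) monomial \<Rightarrow>\<^sub>0 int) operad" by (rule operad_free_operad)
  fix I J I' :: "'a set" and j :: 'a and \<sigma> :: "'a \<Rightarrow> 'a" and x y :: "(nat, 'a) monomial \<Rightarrow>\<^sub>0 int"
  let ?N = "\<lambda>I. {x :: (nat, 'a) monomial \<Rightarrow>\<^sub>0 int. Poly_Mapping.keys x \<subseteq> brace_monomials I \<and> evaluate x = 0}"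
  have comp: "component free_brace_operad I = free_Abelian_group (brace_monomials I)" for I :: "'a set"
    by (simp only: free_operad_simps brace_monomials_def)
  have "evaluate (- a) = - evaluate a" for a :: "(nat, 'a) monomial \<Rightarrow>\<^sub>0 int"
    using evaluate_linear(3)[of 0 a] by (simp add: evaluate_linear(1))
  then show "subgroup (?N I) (component free_brace_operad I)"
    unfolding comp
  proof (intro subgroup.intro)
    show "a \<otimes>\<^bsub>free_Abelian_group (brace_monomials I)\<^esub> b \<in> ?N I" if "a \<in> ?N I" "b \<in> ?N I" for a b
      using that keys_add[of a b] by (auto simp: evaluate_linear)
  qed (simp_all add: evaluate_linear subset_iff)
  have circ_N: "circ free_brace_operad J I j x y \<in> ?N (J - {j} \<union> I)"
    if "composable J I j" "Poly_Mapping.keys x \<subseteq> brace_monomials J" "Poly_Mapping.keys y \<subseteq> brace_monomials I"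
      "evaluate x = 0 \<or> evaluate y = 0"
  proof -
    have "Poly_Mapping.keys (circ free_brace_operad J I j x y) \<subseteq> brace_monomials (J - {j} \<union> I)"
      using circ_closed[of J I j x y] that unfolding comp by simp
    moreover have "evaluate (circ free_brace_operad J I j x y) = 0"
      using that unfolding free_operad_simps brace_monomials_def
      by (subst evaluate_circ) (auto simp: composable_def frag_extend_fun_0)
    ultimately show ?thesis by simp
  qed
  show "circ free_brace_operad J I j x y \<in> ?N (J - {j} \<union> I)"
    if "x \<in> ?N J" "y \<in> carrier (component free_brace_operad I)" "composable J I j"
    using that circ_N unfolding comp by simp
  show "circ free_brace_operad J I j x y \<in> ?N (J - {j} \<union> I)"
    if "x \<in> carrier (component free_brace_operad J)" "y \<in> ?N I" "composable J I j"
    using that circ_N unfolding comp by simp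
  show "relabel free_brace_operad \<sigma> ` ?N I \<subseteq> ?N I'" if "finite I" "bij_betw \<sigma> I I'"
  proof
    fix z assume "z \<in> relabel free_brace_operad \<sigma> ` ?N I"
    then obtain x where x: "Poly_Mapping.keys x \<subseteq> brace_monomials I" "evaluate x = 0" "z = relabel free_brace_operad \<sigma> x"
      by auto
    have "Poly_Mapping.keys z \<subseteq> brace_monomials I'"
      using relabel_closed[OF that, of x] x unfolding comp by simp
    moreover have "evaluate z = 0"
      using x(2) unfolding x(3) free_operad_simps evaluate_relabel by simp
    ultimately show "z \<in> ?N I'" by simp
  qed
qed

text \<open>The kernel is one of the ideals being intersected, which bounds the generated ideal from
  above; conversely it is contained in each of them.\<close>

lemma generated_ideal_brace_relations:
  assumes "finite I"
  shows "generated_ideal free_brace_operad brace_relations I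
    = kernel (component free_brace_operad I) (component APE I) evaluate"
proof -
  have N: "x \<in> N I" if "operadic_ideal free_brace_operad N" "\<forall>K. finite K \<longrightarrow> brace_relations K \<subseteq> N K"
    "Poly_Mapping.keys x \<subseteq> brace_monomials I" "evaluate x = 0" for x :: "(nat, 'a) monomial \<Rightarrow>\<^sub>0 int" and N
  proof -
    interpret brace_ideal N using that by unfold_locales auto
    show ?thesis using assms that by (intro evaluate_eq_0_imp_N)
  qed
  have ev: "evaluate x = 0" if "x \<in> generated_ideal free_brace_operad brace_relations I" for x
  proof -
    let ?N = "\<lambda>I. {x. Poly_Mapping.keys x \<subseteq> brace_monomials I \<and> evaluate x = 0}"
    have "\<forall>K. finite K \<longrightarrow> brace_relations K \<subseteq> ?N K"
      using brace_relations_monomials evaluate_brace_relations by auto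
    then have "?N I \<in> {N I |N. operadic_ideal free_brace_operad N \<and> (\<forall>K. finite K \<longrightarrow> brace_relations K \<subseteq> N K)}"
      using operadic_ideal_kernel_evaluate by (intro CollectI exI[of _ ?N] conjI refl)
    moreover have "x \<in> \<Inter>{N I |N. operadic_ideal free_brace_operad N \<and> (\<forall>K. finite K \<longrightarrow> brace_relations K \<subseteq> N K)}"
      using that unfolding generated_ideal_def by (rule IntD2)
    ultimately have "x \<in> ?N I" by (rule InterD[rotated])
    then show ?thesis by simp
  qed
  have comp: "component free_brace_operad I = free_Abelian_group (brace_monomials I :: (nat, 'a) monomial set)"
    by (simp only: free_operad_simps brace_monomials_def)
  have kernel: "kernel (component free_brace_operad I) (component APE I) evaluate
    = {x. Poly_Mapping.keys x \<subseteq> brace_monomials I \<and> evaluate x = (0 :: 'a ptree \<Rightarrow>\<^sub>0 int)}"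
    unfolding kernel_def comp APE_simps by simp
  show ?thesis
    unfolding kernel
  proof (intro equalityI subsetI)
    fix x :: "(nat, 'a) monomial \<Rightarrow>\<^sub>0 int"
    assume x: "x \<in> generated_ideal free_brace_operad brace_relations I"
    then have "x \<in> carrier (component free_brace_operad I)" unfolding generated_ideal_def by (rule IntD1)
    then show "x \<in> {x. Poly_Mapping.keys x \<subseteq> brace_monomials I \<and> evaluate x = 0}"
      using ev[OF x] unfolding comp by simp
  next
    fix x :: "(nat, 'a) monomial \<Rightarrow>\<^sub>0 int"
    assume x: "x \<in> {x. Poly_Mapping.keys x \<subseteq> brace_monomials I \<and> evaluate x = 0}"
    show "x \<in> generated_ideal free_brace_operad brace_relations I"
      unfolding generated_ideal_def
    proof (intro IntI InterI)
      show "x \<in> carrier (component free_brace_operad I)" using x unfolding comp by simp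
      fix X assume "X \<in> {N I |N. operadic_ideal free_brace_operad N \<and> (\<forall>K. finite K \<longrightarrow> brace_relations K \<subseteq> N K)}"
      then obtain N where "X = N I" "operadic_ideal free_brace_operad N" "\<forall>K. finite K \<longrightarrow> brace_relations K \<subseteq> N K"
        by blast
      then show "x \<in> X" using N[of N x] x by simp
    qed
  qed
qed

theorem proposition2:
  assumes "infinite (UNIV :: 'a set)"
  shows "operad_isomorphic (APE :: ('a, 'a ptree \<Rightarrow>\<^sub>0 int) operad)
    (quotient_operad free_brace_operad (generated_ideal free_brace_operad brace_relations))"
proof (rule operad.operad_first_isomorphism[OF operad_free_operad surj_operad_hom_evaluate])
  show "comm_group (component APE I)" for I :: "'a set"
    unfolding APE_simps by (rule abelian_free_Abelian_group)
  show "generated_ideal free_brace_operad brace_relations I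
    = kernel (component free_brace_operad I) (component APE I) evaluate" if "finite I" for I :: "'a set"
    using that by (rule generated_ideal_brace_relations)
qed

end
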